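(* Let $K$ be an algebraically closed field of characteristic not $2$, let $a\in K$, and let $N\ge 2$ be an integer for which $P_{N,a}$ is nonsingular. Then the gonality of $\bar P_{N,a}$ (the minimum degree of a non-constant morphism $\bar P_{N,a}\to\mathbb{P}^1$) is $2^{N-2}$.
   Context: $f_c(x)=x^2+c$, $f_c^N$ its $N$-th iterate, viewed with $c$ an indeterminate. For $a\in K$, $P_{N,a}\subset\mathbb{A}^2$ (coordinates $(x,c)$) is the algebraic set defined by $f_c^N(x)-a=0$; if nonsingular it is irreducible, and $\bar P_{N,a}$ denotes the completion of its normalization. *)

theory Defs
  imports "HOL-Algebra.Algebraic_Closure_Type"
begin

section \<open>The plane curves \<open>f\<^sub>c\<^sup>N(x) = a\<close>\<close>

text \<open>
  The ring \<open>K[x,c]\<close> is rendered as \<^typ>\<open>'k poly poly\<close>: the outer variable is \<open>x\<close>, the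
  coefficients are polynomials in \<open>c\<close>.
\<close>

definition quad_map :: "'r::comm_ring_1 \<Rightarrow> 'r \<Rightarrow> 'r" where
  "quad_map c z = z\<^sup>2 + c"

definition eval_xc :: "'k::comm_ring_1 poly poly \<Rightarrow> 'k \<Rightarrow> 'k \<Rightarrow> 'k" where
  "eval_xc p x c = poly (poly p [:x:]) c"

definition preimage_poly :: "nat \<Rightarrow> 'k::comm_ring_1 \<Rightarrow> 'k poly poly" where
  "preimage_poly N a = (quad_map [:[:0, 1:]:] ^^ N) [:0, 1:] - [:[:a:]:]"

definition preimage_curve :: "nat \<Rightarrow> 'k::field \<Rightarrow> ('k \<times> 'k) set" where
  "preimage_curve N a = {(x, c). eval_xc (preimage_poly N a) x c = 0}"

text \<open>
  Jacobian criterion. In characteristic different from 2 the polynomial \<open>f\<^sub>c\<^sup>N(x) - a\<close> is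
  squarefree, so over an algebraically closed field it generates the vanishing ideal of the curve.
\<close>

definition preimage_curve_nonsingular :: "nat \<Rightarrow> 'k::field \<Rightarrow> bool" where
  "preimage_curve_nonsingular N a \<longleftrightarrow>
     (\<forall>(x, c) \<in> preimage_curve N a.
        \<not> (eval_xc (pderiv (preimage_poly N a)) x c = 0 \<and>
           eval_xc (map_poly pderiv (preimage_poly N a)) x c = 0))"


section \<open>Function fields\<close>

definition frac_rel :: "('r, 'm) ring_scheme \<Rightarrow> (('r \<times> 'r) \<times> ('r \<times> 'r)) set" where
  "frac_rel R = {((a, b), (c, d)).
     a \<in> carrier R \<and> b \<in> carrier R - {\<zero>\<^bsub>R\<^esub>} \<and> c \<in> carrier R \<and> d \<in> carrier R - {\<zero>\<^bsub>R\<^esub>} \<and>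
     a \<otimes>\<^bsub>R\<^esub> d = c \<otimes>\<^bsub>R\<^esub> b}"

definition frac_class :: "('r, 'm) ring_scheme \<Rightarrow> 'r \<Rightarrow> 'r \<Rightarrow> ('r \<times> 'r) set" where
  "frac_class R a b = frac_rel R `` {(a, b)}"

text \<open>The field of fractions; meaningful when \<open>R\<close> is an integral domain.\<close>

definition fraction_field :: "('r, 'm) ring_scheme \<Rightarrow> ('r \<times> 'r) set ring" where
  "fraction_field R =
     \<lparr> carrier = (carrier R \<times> (carrier R - {\<zero>\<^bsub>R\<^esub>})) // frac_rel R,
       monoid.mult = (\<lambda>p q. \<Union>(a, b)\<in>p. \<Union>(c, d)\<in>q. frac_class R (a \<otimes>\<^bsub>R\<^esub> c) (b \<otimes>\<^bsub>R\<^esub> d)),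
       one = frac_class R \<one>\<^bsub>R\<^esub> \<one>\<^bsub>R\<^esub>,
       ring.zero = frac_class R \<zero>\<^bsub>R\<^esub> \<one>\<^bsub>R\<^esub>,
       add = (\<lambda>p q. \<Union>(a, b)\<in>p. \<Union>(c, d)\<in>q.
                frac_class R (a \<otimes>\<^bsub>R\<^esub> d \<oplus>\<^bsub>R\<^esub> c \<otimes>\<^bsub>R\<^esub> b) (b \<otimes>\<^bsub>R\<^esub> d)) \<rparr>"

definition preimage_ideal :: "nat \<Rightarrow> 'k::field \<Rightarrow> 'k poly poly set" where
  "preimage_ideal N a = cgenideal ring_of_type_algebra (preimage_poly N a)"

definition coordinate_ring :: "nat \<Rightarrow> 'k::field \<Rightarrow> 'k poly poly set ring" where
  "coordinate_ring N a = FactRing ring_of_type_algebra (preimage_ideal N a)"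

definition function_field ::
    "nat \<Rightarrow> 'k::field \<Rightarrow> ('k poly poly set \<times> 'k poly poly set) set ring" where
  "function_field N a = fraction_field (coordinate_ring N a)"

definition constant_function ::
    "nat \<Rightarrow> 'k::field \<Rightarrow> 'k \<Rightarrow> ('k poly poly set \<times> 'k poly poly set) set" where
  "constant_function N a t =
     frac_class (coordinate_ring N a)
       (preimage_ideal N a +>\<^bsub>ring_of_type_algebra\<^esub> [:[:t:]:]) \<one>\<^bsub>coordinate_ring N a\<^esub>"


section \<open>The complete nonsingular curve of a function field\<close>

text \<open>
  Let \<open>F\<close> be a function field in one variable over \<open>K\<close>, with \<open>\<iota>\<close> embedding \<open>K\<close> into \<open>F\<close>. The
  complete nonsingular curve with function field \<open>F\<close>, which is the completion of the normalization
  of any curve with this function field, is taken to be the abstract nonsingular curve of \<open>F\<close>. Its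
  points are the valuation rings of \<open>F/K\<close> (which are all discrete), its proper closed subsets are
  the finite sets, and the regular functions on an open \<open>U\<close> are the elements of the intersection
  of the valuation rings in \<open>U\<close>, whose value at \<open>P\<close> is the class in the residue field, which is
  \<open>K\<close> when \<open>K\<close> is algebraically closed.
\<close>

definition curve_points :: "('f, 'm) ring_scheme \<Rightarrow> ('k \<Rightarrow> 'f) \<Rightarrow> 'f set set" where
  "curve_points F \<iota> =
     {P. subring P F \<and> range \<iota> \<subset> P \<and> P \<subset> carrier F \<and>
         (\<forall>z \<in> carrier F - {\<zero>\<^bsub>F\<^esub>}. z \<in> P \<or> inv\<^bsub>F\<^esub> z \<in> P)}"

definition max_ideal_at :: "('f, 'm) ring_scheme \<Rightarrow> 'f set \<Rightarrow> 'f set" where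
  "max_ideal_at F P = P - Units (F\<lparr>carrier := P\<rparr>)"

definition has_value_at ::
    "('f, 'm) ring_scheme \<Rightarrow> ('k \<Rightarrow> 'f) \<Rightarrow> 'f set \<Rightarrow> 'f \<Rightarrow> 'k \<Rightarrow> bool" where
  "has_value_at F \<iota> P h t \<longleftrightarrow> h \<in> P \<and> h \<ominus>\<^bsub>F\<^esub> \<iota> t \<in> max_ideal_at F P"

definition curve_closed :: "('f, 'm) ring_scheme \<Rightarrow> ('k \<Rightarrow> 'f) \<Rightarrow> 'f set set \<Rightarrow> bool" where
  "curve_closed F \<iota> Z \<longleftrightarrow> Z \<subseteq> curve_points F \<iota> \<and> (finite Z \<or> Z = curve_points F \<iota>)"

definition curve_regular_on ::
    "('f, 'm) ring_scheme \<Rightarrow> ('k \<Rightarrow> 'f) \<Rightarrow> 'f set set \<Rightarrow> ('f set \<Rightarrow> 'k) \<Rightarrow> bool" where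
  "curve_regular_on F \<iota> U r \<longleftrightarrow> (\<exists>h \<in> carrier F. \<forall>P \<in> U. has_value_at F \<iota> P h (r P))"


section \<open>The projective line\<close>

definition hom_point :: "'k::field \<Rightarrow> 'k \<Rightarrow> ('k \<times> 'k) set" where
  "hom_point u v = {(l * u, l * v) | l. l \<noteq> 0}"

definition proj_line :: "('k::field \<times> 'k) set set" where
  "proj_line = {hom_point u v | u v. (u, v) \<noteq> (0, 0)}"

definition binary_form :: "nat \<Rightarrow> (nat \<Rightarrow> 'k::field) \<Rightarrow> 'k \<Rightarrow> 'k \<Rightarrow> 'k" where
  "binary_form d b u v = (\<Sum>i\<le>d. b i * u ^ i * v ^ (d - i))"

definition proj_line_closed :: "('k::field \<times> 'k) set set \<Rightarrow> bool" where
  "proj_line_closed Z \<longleftrightarrow>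
     (\<exists>S. Z = {hom_point u v | u v.
                (u, v) \<noteq> (0, 0) \<and> (\<forall>(d, b) \<in> S. binary_form d b u v = 0)})"

definition proj_line_open :: "('k::field \<times> 'k) set set \<Rightarrow> bool" where
  "proj_line_open V \<longleftrightarrow> V \<subseteq> proj_line \<and> proj_line_closed (proj_line - V)"

definition proj_line_regular_on ::
    "('k::field \<times> 'k) set set \<Rightarrow> (('k \<times> 'k) set \<Rightarrow> 'k) \<Rightarrow> bool" where
  "proj_line_regular_on V g \<longleftrightarrow>
     (\<forall>Q \<in> V. \<exists>U. proj_line_open U \<and> Q \<in> U \<and> U \<subseteq> V \<and>
        (\<exists>d A B. \<forall>u v. (u, v) \<noteq> (0, 0) \<and> hom_point u v \<in> U \<longrightarrow>
            binary_form d B u v \<noteq> 0 \<and>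
            g (hom_point u v) = binary_form d A u v / binary_form d B u v))"


section \<open>Morphisms to the projective line and gonality\<close>

definition curve_preimage ::
    "('f, 'm) ring_scheme \<Rightarrow> ('k \<Rightarrow> 'f) \<Rightarrow> ('f set \<Rightarrow> ('k \<times> 'k) set) \<Rightarrow>
     ('k \<times> 'k) set set \<Rightarrow> 'f set set" where
  "curve_preimage F \<iota> \<phi> V = {P \<in> curve_points F \<iota>. \<phi> P \<in> V}"

definition morphism_to_proj_line ::
    "('f, 'm) ring_scheme \<Rightarrow> ('k::field \<Rightarrow> 'f) \<Rightarrow> ('f set \<Rightarrow> ('k \<times> 'k) set) \<Rightarrow> bool" where
  "morphism_to_proj_line F \<iota> \<phi> \<longleftrightarrow>
     (\<forall>P \<in> curve_points F \<iota>. \<phi> P \<in> proj_line) \<and>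
     (\<forall>Z. proj_line_closed Z \<longrightarrow> curve_closed F \<iota> (curve_preimage F \<iota> \<phi> Z)) \<and>
     (\<forall>V g. proj_line_open V \<and> proj_line_regular_on V g \<longrightarrow>
        curve_regular_on F \<iota> (curve_preimage F \<iota> \<phi> V) (g \<circ> \<phi>))"

definition nonconstant_on_curve ::
    "('f, 'm) ring_scheme \<Rightarrow> ('k \<Rightarrow> 'f) \<Rightarrow> ('f set \<Rightarrow> 'q) \<Rightarrow> bool" where
  "nonconstant_on_curve F \<iota> \<phi> \<longleftrightarrow> (\<exists>P \<in> curve_points F \<iota>. \<exists>Q \<in> curve_points F \<iota>. \<phi> P \<noteq> \<phi> Q)"

text \<open>
  The image of the function field of the projective line under \<open>\<phi>\<^sup>*\<close>, for a nonconstant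
  morphism \<open>\<phi>\<close>: rational functions on the line are regular functions on nonempty open sets.
\<close>

definition pullback_field ::
    "('f, 'm) ring_scheme \<Rightarrow> ('k::field \<Rightarrow> 'f) \<Rightarrow> ('f set \<Rightarrow> ('k \<times> 'k) set) \<Rightarrow> 'f set" where
  "pullback_field F \<iota> \<phi> =
     {h \<in> carrier F. \<exists>V g. proj_line_open V \<and> V \<noteq> {} \<and> proj_line_regular_on V g \<and>
        (\<forall>P \<in> curve_preimage F \<iota> \<phi> V. has_value_at F \<iota> P h (g (\<phi> P)))}"

definition has_morphism_degree ::
    "('f, 'm) ring_scheme \<Rightarrow> ('k::field \<Rightarrow> 'f) \<Rightarrow> ('f set \<Rightarrow> ('k \<times> 'k) set) \<Rightarrow> nat \<Rightarrow> bool" where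
  "has_morphism_degree F \<iota> \<phi> n \<longleftrightarrow> ring.dimension F n (pullback_field F \<iota> \<phi>) (carrier F)"

definition gonality :: "('f, 'm) ring_scheme \<Rightarrow> ('k::field \<Rightarrow> 'f) \<Rightarrow> nat" where
  "gonality F \<iota> =
     (LEAST n. \<exists>\<phi>. morphism_to_proj_line F \<iota> \<phi> \<and> nonconstant_on_curve F \<iota> \<phi> \<and>
                   has_morphism_degree F \<iota> \<phi> n)"

end

theory Submission
  imports Defs
begin

text \<open>
  Write \<open>z\<^sub>i = f\<^sub>c\<^sup>i(x)\<close>, so that the function field is \<open>F = K(x, c)\<close> with \<open>z\<^sub>N = a\<close>.

  Upper bound: \<open>u = z\<^sub>N\<^sub>-\<^sub>2\<close> and \<open>v = z\<^sub>N\<^sub>-\<^sub>1\<close> satisfy \<open>u\<^sup>2 = v\<^sup>2 + v - a\<close>, a conic parametrised by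
  \<open>t = u - v\<close>. Since \<open>c = a - v\<^sup>2\<close> lies in \<open>K(t)\<close> and \<open>x\<close> is a root of \<open>f\<^sub>c\<^sup>N\<^sup>-\<^sup>2(X) - u\<close>, the function \<open>t\<close>
  has degree at most \<open>2\<^sup>N\<^sup>-\<^sup>2\<close>.

  Lower bound, by induction on \<open>N\<close> (the argument of Castelnuovo's inequality for the double cover
  \<open>x \<mapsto> x\<^sup>2 + c\<close>): let \<open>\<sigma>\<close> be the involution \<open>x \<mapsto> -x\<close> and let \<open>h\<close> be a nonconstant function of degree \<open>n\<close>. If
  \<open>\<sigma> h = h\<close>, then \<open>h\<close> lies in the function field for \<open>N - 1\<close>, which has index 2 in \<open>F\<close>. Otherwise we may
  replace \<open>h\<close> by some \<open>1/(h - s)\<close> without poles at the fixed points of \<open>\<sigma>\<close>. Then \<open>h - \<sigma> h\<close> has degree at most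
  \<open>2n\<close> and vanishes at these fixed points, that is, at the \<open>2\<^sup>N\<^sup>-\<^sup>1\<close> points with \<open>x = 0\<close>; they are distinct
  because the curve is nonsingular there. Hence \<open>2\<^sup>N\<^sup>-\<^sup>1 \<le> 2n\<close>.

  All fields are realised inside Laurent series: at a nonsingular point \<open>F\<close> embeds into \<open>K((s))\<close>.
\<close>

text \<open>Nonsingularity enters only through \<open>crit_simple\<close>: the parameters c for
  which 0 reaches a after M steps are simple roots of \<open>crit_poly M a\<close>. They are the
  branch data of the tower of double covers, and they yield irreducibility, the number of fixed
  points and the nondegeneracy of the conic. No genus or divisor occurs. The degree of h is a
  dimension \<open>vdim n (gen j h) L\<close>, a zero is a place where h is a nonunit, and the only
  geometric input is that a function has at most as many zeros as its degree. The factor 2 is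
  algebraic: h and its conjugate satisfy a relation of bidegree at most (e, e), and replacing the
  conjugate by h - w leaves degree at most 2e in h. This controls w only on the subfield K(h, w), so
  the index of that field in L is carried along. The curve is any pair x, c in a field type with the
  right relations (\<open>preimage_field\<close>). The curve for N - 1 is then the pair x^2 + c, c
  in the same type, which lets the induction run; \<open>frac_of\<close> links this model to the
  fraction field of the statement.\<close>

locale ring_map =
  fixes \<phi> :: "'r::comm_ring_1 \<Rightarrow> 's::comm_ring_1"
  assumes one [simp]: "\<phi> 1 = 1"
    and add [simp]: "\<phi> (a + b) = \<phi> a + \<phi> b"
    and mult [simp]: "\<phi> (a * b) = \<phi> a * \<phi> b"
begin

lemma zero [simp]: "\<phi> 0 = 0"
  using add[of 0 0] by simp

lemma uminus [simp]: "\<phi> (- a) = - \<phi> a"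
  using add[of a "- a"] by (simp add: eq_neg_iff_add_eq_0 add.commute)

lemma diff [simp]: "\<phi> (a - b) = \<phi> a - \<phi> b"
  using add[of a "- b"] by simp

lemma power [simp]: "\<phi> (a ^ n) = \<phi> a ^ n"
  by (induction n) auto

lemma sum: "\<phi> (sum f A) = (\<Sum>i\<in>A. \<phi> (f i))"
  by (induction A rule: infinite_finite_induct) auto

lemma prod: "\<phi> (prod f A) = (\<Prod>i\<in>A. \<phi> (f i))"
  by (induction A rule: infinite_finite_induct) auto

lemma numeral [simp]: "\<phi> (numeral n) = numeral n"
proof -
  have "\<phi> (of_nat k) = of_nat k" for k
    by (induction k) auto
  from this[of "numeral n"] show ?thesis
    by simp
qed

lemma quad_map_funpow [simp]: "\<phi> ((quad_map c ^^ n) z) = (quad_map (\<phi> c) ^^ n) (\<phi> z)"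
  by (induction n) (auto simp: quad_map_def)

end

lemma ring_map_comp: "ring_map \<phi> \<Longrightarrow> ring_map \<psi> \<Longrightarrow> ring_map (\<lambda>z. \<psi> (\<phi> z))"
  unfolding ring_map_def by auto

lemma ring_map_const_poly: "ring_map (\<lambda>a. [:a:])"
  by unfold_locales (auto simp: one_pCons)

lemma ring_map_ident: "ring_map (\<lambda>a. a)"
  by unfold_locales auto

lemma ring_map_poly: "ring_map (\<lambda>p. poly p z)"
  by unfold_locales auto

lemma ring_map_pcompose: "ring_map (\<lambda>p. pcompose p q)"
  by unfold_locales (auto simp: pcompose_add pcompose_mult pcompose_1)

locale field_map = ring_map \<phi> for \<phi> :: "'k::field \<Rightarrow> 'f::field"
begin

lemma eq_0_iff [simp]: "\<phi> a = 0 \<longleftrightarrow> a = 0"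
proof
  assume *: "\<phi> a = 0"
  show "a = 0"
  proof (rule ccontr)
    assume "a \<noteq> 0"
    then have "\<phi> a * \<phi> (inverse a) = 1"
      by (metis mult one right_inverse)
    then show False
      using * by simp
  qed
qed auto

lemma eq_iff [simp]: "\<phi> a = \<phi> b \<longleftrightarrow> a = b"
  using eq_0_iff[of "a - b"] by (simp del: eq_0_iff)

lemma inverse [simp]: "\<phi> (inverse a) = inverse (\<phi> a)"
proof (cases "a = 0")
  case False
  then have "\<phi> a * \<phi> (inverse a) = 1"
    by (metis mult one right_inverse)
  then show ?thesis
    by (metis inverse_unique)
qed auto

lemma divide [simp]: "\<phi> (a / b) = \<phi> a / \<phi> b"
  by (simp add: field_class.field_divide_inverse)

end

section \<open>Evaluation of polynomials in one and two variables\<close>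

definition pev :: "('r::comm_ring_1 \<Rightarrow> 's::comm_ring_1) \<Rightarrow> 's \<Rightarrow> 'r poly \<Rightarrow> 's" where
  "pev \<phi> z p = poly (map_poly \<phi> p) z"

text \<open>The outer variable goes to x, the inner one to c. With a polynomial ring as target the
  same operator expresses substitutions, so \<open>comp_ev2\<close> treats evaluation and change of
  variables alike.\<close>

definition ev2 :: "('k::comm_ring_1 \<Rightarrow> 's::comm_ring_1) \<Rightarrow> 's \<Rightarrow> 's \<Rightarrow> 'k poly poly \<Rightarrow> 's" where
  "ev2 j x c = pev (pev j c) x"

lemma pev_0 [simp]: "pev \<phi> z 0 = 0"
  by (simp add: pev_def)

lemma (in ring_map) pev_pCons [simp]: "pev \<phi> z (pCons a p) = \<phi> a + z * pev \<phi> z p"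
  by (simp add: pev_def map_poly_pCons)

lemma (in ring_map) pev_add: "pev \<phi> z (p + q) = pev \<phi> z p + pev \<phi> z q"
  by (induction p q rule: poly_induct2) (auto simp: algebra_simps)

lemma (in ring_map) pev_smult: "pev \<phi> z (smult a q) = \<phi> a * pev \<phi> z q"
  by (induction q) (auto simp: algebra_simps)

lemma (in ring_map) ring_map_pev: "ring_map (pev \<phi> z)"
proof
  show "pev \<phi> z (p * q) = pev \<phi> z p * pev \<phi> z q" for p q
    by (induction p) (auto simp: algebra_simps pev_add pev_smult)
qed (auto simp: one_pCons pev_add)

lemma (in ring_map) pev_eq_sum: 
  assumes "degree p \<le> n"
  shows "pev \<phi> z p = (\<Sum>i\<le>n. \<phi> (coeff p i) * z ^ i)"
proof -
  have "degree (map_poly \<phi> p) \<le> n"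
    using assms by (intro degree_le) (auto simp: coeff_map_poly coeff_eq_0)
  then show ?thesis
    unfolding pev_def poly_altdef
    by (intro sum.mono_neutral_cong_left) (auto simp: coeff_map_poly coeff_eq_0 intro!: le_degree)
qed

lemma ev2_0 [simp]: "ev2 \<phi> x c 0 = 0"
  by (simp add: ev2_def)

lemma (in ring_map) ring_map_ev2: "ring_map (ev2 \<phi> x c)"
  unfolding ev2_def by (intro ring_map.ring_map_pev ring_map_axioms)

lemma (in ring_map) ev2_const [simp]: "ev2 \<phi> x c [:q:] = pev \<phi> c q"
  unfolding ev2_def using ring_map.pev_pCons[OF ring_map_pev] by simp

lemma (in ring_map) ev2_pCons: "ev2 \<phi> x c (pCons q p) = pev \<phi> c q + x * ev2 \<phi> x c p"
  unfolding ev2_def using ring_map.pev_pCons[OF ring_map_pev] by simp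

lemma (in ring_map) ev2_X [simp]: "ev2 \<phi> x c [:0, 1:] = x"
  by (simp add: ev2_pCons one_pCons)

lemma (in ring_map) comp_pev:
  assumes "ring_map \<theta>"
  shows "\<theta> (pev \<phi> z p) = pev (\<lambda>a. \<theta> (\<phi> a)) (\<theta> z) p"
proof -
  interpret \<theta>: ring_map \<theta> by fact
  interpret c: ring_map "\<lambda>a. \<theta> (\<phi> a)"
    by unfold_locales auto
  show ?thesis
    by (induction p) auto
qed

lemma (in ring_map) comp_ev2:
  assumes "ring_map \<theta>"
  shows "\<theta> (ev2 \<phi> x c p) = ev2 (\<lambda>a. \<theta> (\<phi> a)) (\<theta> x) (\<theta> c) p"
  unfolding ev2_def
  by (subst ring_map.comp_pev[OF ring_map_pev assms]) (simp add: comp_pev[OF assms])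

text \<open>Uniqueness in the universal property of the polynomial ring. Later, composite
  homomorphisms are identified by comparing them on constants and variables.\<close>

lemma ring_map_eq_pev:
  assumes "ring_map e"
  shows "e p = pev (\<lambda>a. e [:a:]) (e [:0, 1:]) p"
proof -
  interpret e: ring_map e by fact
  interpret c: ring_map "\<lambda>a. e [:a:]"
    using ring_map_comp[OF ring_map_const_poly assms] .
  show ?thesis
  proof (induction p)
    case (pCons a p)
    have "pCons a p = [:a:] + [:0, 1:] * p"
      by simp
    then have "e (pCons a p) = e [:a:] + e [:0, 1:] * e p"
      by (metis e.add e.mult)
    then show ?case
      using pCons by simp
  qed auto
qed

lemma ring_map_eq_ev2:
  assumes "ring_map e"
  shows "e p = ev2 (\<lambda>a. e [:[:a:]:]) (e [:0, 1:]) (e [:[:0, 1:]:]) p"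
proof -
  have "ring_map (\<lambda>q. e [:q:])"
    using ring_map_comp[OF ring_map_const_poly assms] .
  then have "(\<lambda>q. e [:q:]) = pev (\<lambda>a. e [:[:a:]:]) (e [:[:0, 1:]:])"
    using ring_map_eq_pev by blast
  then show ?thesis
    unfolding ev2_def using ring_map_eq_pev[OF assms, of p] by simp
qed

lemma (in ring_map) ev2_preimage_poly:
  "ev2 \<phi> x c (preimage_poly N a) = (quad_map c ^^ N) x - \<phi> a"
proof -
  interpret e: ring_map "ev2 \<phi> x c" by (rule ring_map_ev2)
  show ?thesis
    by (simp add: preimage_poly_def)
qed

section \<open>Hensel's lemma for formal power series\<close>

text \<open>The factor r is the divided difference of p at f and g; at the common constant term it
  degenerates to the derivative.\<close>

lemma poly_fps_diff_factor:
  fixes p :: "'k::field fps poly"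
  assumes "fps_nth f 0 = a" "fps_nth g 0 = a"
  shows "\<exists>r. poly p f - poly p g = (f - g) * r \<and>
             fps_nth r 0 = poly (pderiv (map_poly (\<lambda>s. fps_nth s 0) p)) a"
proof (induction p)
  case 0
  show ?case by (intro exI[of _ 0]) auto
next
  case (pCons s p)
  then obtain r where r: "poly p f - poly p g = (f - g) * r"
    "fps_nth r 0 = poly (pderiv (map_poly (\<lambda>s. fps_nth s 0) p)) a"
    by blast
  have h: "fps_nth (poly q g) 0 = poly (map_poly (\<lambda>s. fps_nth s 0) q) a" for q
    by (induction q) (auto simp: map_poly_pCons assms)
  have "poly (pCons s p) f - poly (pCons s p) g = f * (poly p f - poly p g) + (f - g) * poly p g"
    by (simp add: algebra_simps)
  also have "\<dots> = (f - g) * (f * r + poly p g)"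
    unfolding r(1) by (simp add: algebra_simps)
  finally show ?case
    by (intro exI[of _ "f * r + poly p g"])
       (simp add: r(2) assms h map_poly_pCons pderiv_pCons add.commute)
qed

lemma fps_hensel:
  fixes p :: "'k::field fps poly"
  defines "p0 \<equiv> map_poly (\<lambda>s. fps_nth s 0) p"
  assumes root: "poly p0 a = 0" and simple: "poly (pderiv p0) a \<noteq> 0"
  shows "\<exists>f. fps_nth f 0 = a \<and> poly p f = 0"
proof -
  define u where "u = poly (pderiv p0) a"
  \<comment> \<open>Newton iteration with the slope frozen at its value u modulo X, so that no
    inverse of a varying power series occurs.\<close>
  define T where "T f = f - fps_const (inverse u) * poly p f" for f
  define s where "s n = (T ^^ n) (fps_const a)" for n
  have const: "fps_nth (poly p f) 0 = poly p0 a" if "fps_nth f 0 = a" for f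
    unfolding p0_def by (induction p) (auto simp: map_poly_pCons that)
  have T0: "fps_nth (T f) 0 = a" if "fps_nth f 0 = a" for f
    using const[OF that] that root by (simp add: T_def)
  \<comment> \<open>The cofactor of f - g in T f - T g has constant term 1 - u/u = 0, so each
    application of T gains one correct coefficient.\<close>
  have contract: "\<forall>k<Suc n. fps_nth (T f) k = fps_nth (T g) k"
    if fg0: "fps_nth f 0 = a" "fps_nth g 0 = a" and agree: "\<forall>k<n. fps_nth f k = fps_nth g k"
    for f g n
  proof -
    obtain r where r: "poly p f - poly p g = (f - g) * r" "fps_nth r 0 = u"
      using poly_fps_diff_factor[OF fg0, of p] unfolding u_def p0_def by metis
    define d where "d = 1 - fps_const (inverse u) * r"
    have d0: "fps_nth d 0 = 0"
      using simple by (simp add: d_def r(2) u_def)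
    have "T f - T g = f - g - fps_const (inverse u) * (poly p f - poly p g)"
      by (simp add: T_def algebra_simps)
    also have "\<dots> = (f - g) * d"
      unfolding r(1) d_def by (simp add: algebra_simps)
    finally have Td: "T f - T g = (f - g) * d" .
    have "fps_nth ((f - g) * d) k = 0" if "k < Suc n" for k
      unfolding fps_mult_nth
    proof (rule sum.neutral, intro ballI)
      fix i assume "i \<in> {0..k}"
      then consider "i < n" | "i = k"
        using \<open>k < Suc n\<close> by fastforce
      then show "fps_nth (f - g) i * fps_nth d (k - i) = 0"
      proof cases
        case 1
        then have "fps_nth (f - g) i = 0"
          using agree by simp
        then show ?thesis by simp
      next
        case 2
        then show ?thesis by (simp only: d0 diff_self_eq_0 mult_zero_right)
      qed
    qed
    then have "fps_nth (T f - T g) k = 0" if "k < Suc n" for k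
      unfolding Td using that by blast
    then show ?thesis
      by (metis eq_iff_diff_eq_0 fps_sub_nth)
  qed
  have s0: "fps_nth (s n) 0 = a" for n
    by (induction n) (auto simp: s_def T0)
  have step: "\<forall>k<Suc n. fps_nth (s (Suc n)) k = fps_nth (s n) k" for n
  proof (induction n)
    case 0
    then show ?case using s0 by simp
  next
    case (Suc n)
    have "s (Suc m) = T (s m)" for m
      by (simp add: s_def)
    then show ?case
      using contract[OF s0[of "Suc n"] s0[of n] Suc] by simp
  qed
  have stable: "k \<le> n \<Longrightarrow> fps_nth (s n) k = fps_nth (s k) k" for n k
  proof (induction n rule: dec_induct)
    case (step n)
    then show ?case
      using \<open>\<And>n. \<forall>k<Suc n. fps_nth (s (Suc n)) k = fps_nth (s n) k\<close> by (metis le_imp_less_Suc)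
  qed auto
  \<comment> \<open>Coefficient k no longer changes after k iterations, so the diagonal is the
    X-adic limit.\<close>
  define f where "f = Abs_fps (\<lambda>k. fps_nth (s k) k)"
  have f0: "fps_nth f 0 = a"
    by (simp add: f_def s0)
  have "T f = f"
  proof (rule fps_ext)
    fix n
    have "\<forall>k<Suc n. fps_nth f k = fps_nth (s n) k"
      unfolding f_def fps_nth_Abs_fps using stable by (metis less_Suc_eq_le)
    from contract[OF f0 s0 this] have "fps_nth (T f) n = fps_nth (s (Suc n)) n"
      by (simp add: s_def)
    then show "fps_nth (T f) n = fps_nth f n"
      using step[of n] by (simp add: f_def)
  qed
  then have "fps_const (inverse u) * poly p f = 0"
    by (simp add: T_def)
  then have "poly p f = 0"
    using simple by (simp add: u_def)
  then show ?thesis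
    using f0 by blast
qed

section \<open>Nonsingularity and the critical orbit\<close>

text \<open>The preimage polynomial at x = 0, as a polynomial in c: its roots are the branch
  parameters of the double cover from level M to level M - 1.\<close>

definition crit_poly :: "nat \<Rightarrow> 'k::field \<Rightarrow> 'k poly" where
  "crit_poly M a = (quad_map [:0, 1:] ^^ M) 0 - [:a:]"

text \<open>M starts at 1 because \<open>crit_poly 0 a\<close> is the constant -a, which for a = 0
  would vanish identically.\<close>

definition crit_simple :: "nat \<Rightarrow> 'k::field \<Rightarrow> bool" where
  "crit_simple N a \<longleftrightarrow> (\<forall>M\<in>{1..N}. \<forall>c.
     poly (crit_poly M a) c = 0 \<longrightarrow> poly (pderiv (crit_poly M a)) c \<noteq> 0)"

abbreviation quad_poly :: "'k::comm_ring_1 poly poly" where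
  "quad_poly \<equiv> [:[:0, 1:], 0, 1:]"

lemma preimage_poly_Suc: "preimage_poly (Suc N) a = pcompose (preimage_poly N a) quad_poly"
proof -
  interpret p: ring_map "\<lambda>p. pcompose p quad_poly" by (rule ring_map_pcompose)
  have "quad_map [:[:0, 1:]:] [:0, 1:] = (quad_poly :: 'a poly poly)"
    by (simp add: quad_map_def power2_eq_square)
  then show ?thesis
    by (simp add: preimage_poly_def funpow_Suc_right pcompose_pCons del: funpow.simps)
qed

lemma poly_preimage_poly_0: "poly (preimage_poly N a) 0 = crit_poly N a"
proof -
  interpret p: ring_map "\<lambda>p. poly p (0 :: 'a poly)" by (rule ring_map_poly)
  show ?thesis
    by (simp add: preimage_poly_def crit_poly_def)
qed

lemma map_poly_pderiv_add:
  "map_poly pderiv (p + q) = map_poly pderiv p + map_poly pderiv q"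
  by (rule poly_eqI) (simp add: coeff_map_poly pderiv_add)

lemma pderiv_sum: "pderiv (sum f A) = (\<Sum>i\<in>A. pderiv (f i))"
  by (induction A rule: infinite_finite_induct) (auto simp: pderiv_add)

lemma map_poly_pderiv_mult:
  "map_poly pderiv (p * q) = map_poly pderiv p * q + p * map_poly pderiv q"
  by (rule poly_eqI, simp add: coeff_map_poly coeff_mult pderiv_sum pderiv_mult sum.distrib)
     (simp add: algebra_simps)

lemma map_poly_pderiv_pcompose_quad_poly:
  "map_poly pderiv (pcompose p quad_poly) =
     pcompose (map_poly pderiv p) quad_poly + pcompose (pderiv p) quad_poly"
proof (induction p)
  case (pCons a p)
  have q: "map_poly pderiv quad_poly = (1 :: 'a poly poly)"
    by (simp add: map_poly_pCons pderiv_pCons one_pCons)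
  have "map_poly pderiv (pcompose (pCons a p) quad_poly) =
      map_poly pderiv [:a:] + pcompose p quad_poly +
      quad_poly * map_poly pderiv (pcompose p quad_poly)"
    unfolding pcompose_pCons map_poly_pderiv_add map_poly_pderiv_mult q by simp
  also have "\<dots> = pcompose (map_poly pderiv (pCons a p)) quad_poly +
      pcompose (pderiv (pCons a p)) quad_poly"
    unfolding pCons.IH
    by (simp add: map_poly_pCons pcompose_pCons pderiv_pCons pcompose_add algebra_simps)
  finally show ?case .
qed auto

lemma eval_xc_pcompose_quad_poly: "eval_xc (pcompose p quad_poly) x c = eval_xc p (x\<^sup>2 + c) c"
proof -
  have "poly quad_poly [:x:] = [:x\<^sup>2, 1:]"
    by (simp add: power2_eq_square)
  have "poly (poly p [:x\<^sup>2, 1:]) c = poly (poly p [:x\<^sup>2 + c:]) c"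
    by (induction p) (auto simp: algebra_simps)
  then show ?thesis
    unfolding eval_xc_def poly_pcompose by (simp add: power2_eq_square)
qed

lemma eval_xc_add: "eval_xc (p + q) x c = eval_xc p x c + eval_xc q x c"
  and eval_xc_mult: "eval_xc (p * q) x c = eval_xc p x c * eval_xc q x c"
  by (auto simp: eval_xc_def)

text \<open>A singular point (y, c) of the lower curve lifts to (x, c) with x^2 + c = y. By the
  chain rule the partial derivatives upstairs are 2x G_x and G_x + G_c, so both vanish
  there.\<close>

lemma preimage_curve_nonsingular_Suc:
  fixes a :: "'k::alg_closed_field"
  assumes "preimage_curve_nonsingular (Suc N) a"
  shows "preimage_curve_nonsingular N a"
  unfolding preimage_curve_nonsingular_def preimage_curve_def
proof (intro ballI, clarify)
  fix y c
  assume G: "eval_xc (preimage_poly N a) y c = 0" and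
    x: "eval_xc (pderiv (preimage_poly N a)) y c = 0" and
    c: "eval_xc (map_poly pderiv (preimage_poly N a)) y c = 0"
  obtain x where "x ^ 2 = y - c"
    using nth_root_exists[of 2 "y - c"] by auto
  then have y: "x\<^sup>2 + c = y"
    by simp
  have "(x, c) \<in> preimage_curve (Suc N) a"
    by (simp add: preimage_curve_def preimage_poly_Suc eval_xc_pcompose_quad_poly y G)
  moreover have "eval_xc (pderiv (preimage_poly (Suc N) a)) x c = 0"
    by (simp add: preimage_poly_Suc pderiv_pcompose eval_xc_mult eval_xc_pcompose_quad_poly y x)
  moreover have "eval_xc (map_poly pderiv (preimage_poly (Suc N) a)) x c = 0"
    by (simp add: preimage_poly_Suc map_poly_pderiv_pcompose_quad_poly eval_xc_add
        eval_xc_pcompose_quad_poly y x c)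
  ultimately show False
    using assms unfolding preimage_curve_nonsingular_def by blast
qed

text \<open>At a point with x = 0 the x-derivative vanishes because the polynomial is even in x. The
  c-derivative must then be nonzero, and at x = 0 it is the derivative of \<open>crit_poly\<close>.
  Descending from N covers every smaller level.\<close>

lemma crit_simple_if_nonsingular:
  fixes a :: "'k::alg_closed_field"
  assumes "preimage_curve_nonsingular N a"
  shows "crit_simple N a"
  unfolding crit_simple_def
proof (intro ballI allI impI)
  fix M c assume M: "M \<in> {1..N}" and root: "poly (crit_poly M a) c = 0"
  have "M \<le> N"
    using M by simp
  then have ns: "preimage_curve_nonsingular M a"
    using assms by (induction rule: inc_induct) (auto intro: preimage_curve_nonsingular_Suc)
  obtain M' where M': "M = Suc M'"
    using M by (cases M) auto
  have 0: "eval_xc p 0 c = poly (poly p 0) c" for p :: "'k poly poly"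
    by (simp add: eval_xc_def)
  have "(0, c) \<in> preimage_curve M a"
    by (simp add: preimage_curve_def 0 poly_preimage_poly_0 root)
  moreover have "eval_xc (pderiv (preimage_poly M a)) 0 c = 0"
    by (simp add: M' preimage_poly_Suc pderiv_pcompose eval_xc_mult 0 pderiv_pCons)
  moreover have "eval_xc (map_poly pderiv (preimage_poly M a)) 0 c = poly (pderiv (crit_poly M a)) c"
    by (simp add: 0 poly_0_coeff_0 coeff_map_poly flip: poly_preimage_poly_0)
  ultimately show "poly (pderiv (crit_poly M a)) c \<noteq> 0"
    using ns unfolding preimage_curve_nonsingular_def by force
qed

section \<open>Irreducibility\<close>

lemma monic_division:
  fixes p g :: "'r::idom poly"
  assumes "lead_coeff g = 1"
  obtains s r where "p = g * s + r" "r = 0 \<or> degree r < degree g"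
proof -
  have "g \<noteq> 0"
    using assms by auto
  obtain s r where "pseudo_divmod p g = (s, r)"
    by (cases "pseudo_divmod p g")
  from pseudo_divmod[OF \<open>g \<noteq> 0\<close> this] have "p = g * s + r" "r = 0 \<or> degree r < degree g"
    using assms by auto
  then show ?thesis
    by (rule that)
qed

text \<open>Let m be a nonzero relation of least degree. Pseudo-division, needed because the leading
  coefficient of m is no unit, shows that m divides a constant multiple of g. As g is prime, it
  divides m or the cofactor; in the latter case m would be a relation between constants, against
  \<open>inj\<close>. So g has least degree, and being monic it divides every relation.\<close>

lemma kernel_eq_dvd:
  fixes e :: "'k::field poly poly \<Rightarrow> 'g::idom"
  assumes e: "ring_map e" and prime: "prime_elem g" and monic: "lead_coeff g = 1" and g: "e g = 0"
    and inj: "\<And>r. e [:r:] = 0 \<Longrightarrow> r = 0"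
  shows "e p = 0 \<longleftrightarrow> g dvd p"
proof
  interpret e: ring_map e by fact
  have min: "degree g \<le> degree q" if q: "q \<noteq> 0" "e q = 0" for q
  proof -
    obtain m where m: "m \<noteq> 0" "e m = 0" and least: "\<And>q. q \<noteq> 0 \<and> e q = 0 \<Longrightarrow> degree m \<le> degree q"
      using ex_has_least_nat[of "\<lambda>q. q \<noteq> 0 \<and> e q = 0" q degree] q by blast
    define l where "l = coeff m (degree m) ^ (Suc (degree g) - degree m)"
    obtain s r where "pseudo_divmod g m = (s, r)"
      by (cases "pseudo_divmod g m")
    from pseudo_divmod[OF m(1) this] have d: "smult l g = m * s + r" "r = 0 \<or> degree r < degree m"
      unfolding l_def by auto
    have "l \<noteq> 0"
      using m(1) by (simp add: l_def)
    have "[:l:] * g = m * s + r"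
      using d(1) by simp
    from arg_cong[OF this, of e] have "e [:l:] * e g = e m * e s + e r"
      by (simp only: e.add e.mult)
    then have "e r = 0"
      by (simp add: g m(2))
    then have "r = 0"
      using d(2) least leD by blast
    then have ms: "[:l:] * g = m * s"
      using d(1) by simp
    from dvd_triv_right[of g "[:l:]", unfolded ms] have "g dvd m * s" .
    then consider "g dvd m" | "g dvd s"
      using prime by (meson prime_elem_dvd_mult_iff)
    then have "degree g \<le> degree m"
    proof cases
      case 1
      then show ?thesis
        using m(1) dvd_imp_degree_le by blast
    next
      case 2
      then obtain s' where "s = g * s'"
        by auto
      then have "g * [:l:] = g * (m * s')"
        using ms by (metis mult.commute mult.left_commute)
      then have "[:l:] = m * s'"
        using prime by (metis mult_cancel_left prime_elem_not_zeroI)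
      then have "m dvd [:l:]"
        by auto
      then have "degree m = 0"
        using \<open>l \<noteq> 0\<close> dvd_imp_degree_le[of m "[:l:]"] by simp
      then obtain m0 where "m = [:m0:]"
        using degree_0_id[of m] by metis
      then have "m0 = 0"
        using m(2) inj by blast
      then show ?thesis
        using m(1) \<open>m = [:m0:]\<close> by simp
    qed
    also have "degree m \<le> degree q"
      using least q by blast
    finally show ?thesis .
  qed
  assume p: "e p = 0"
  obtain s r where d: "p = g * s + r" "r = 0 \<or> degree r < degree g"
    by (rule monic_division[OF monic])
  then have "e r = 0"
    using p g by simp
  then have "r = 0"
    using d(2) min[of r] by (meson leD)
  then show "g dvd p"
    using d(1) by simp
next
  interpret e: ring_map e by fact
  assume "g dvd p"
  then show "e p = 0"
    using g by auto
qed

text \<open>A polynomial over an algebraically closed field splits into linear factors, and none of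
  them vanishes at z.\<close>

lemma pev_eq_0_iff_transcendental:
  fixes \<phi> :: "'k::alg_closed_field \<Rightarrow> 's::idom"
  assumes \<phi>: "ring_map \<phi>" and z: "\<And>a. z \<noteq> \<phi> a"
  shows "pev \<phi> z p = 0 \<longleftrightarrow> p = 0"
proof
  interpret \<phi>: ring_map \<phi> by fact
  interpret e: ring_map "pev \<phi> z" by (rule \<phi>.ring_map_pev)
  have inj: "\<phi> a \<noteq> 0" if "a \<noteq> 0" for a
    using that by (metis \<phi>.mult \<phi>.one mult_zero_left right_inverse zero_neq_one)
  show "pev \<phi> z p = 0 \<Longrightarrow> p = 0"
  proof (induction "degree p" arbitrary: p)
    case 0
    then obtain b where "p = [:b:]"
      by (metis degree_0_id)
    then have "\<phi> b = 0"
      using "0.prems" by simp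
    then show ?case
      using inj \<open>p = [:b:]\<close> by (metis pCons_0_0)
  next
    case (Suc n)
    then obtain a where "poly p a = 0"
      by (metis alg_closed_imp_poly_has_root zero_less_Suc)
    then obtain q where q: "p = [:- a, 1:] * q"
      by (auto simp: poly_eq_0_iff_dvd)
    show ?case
    proof (rule ccontr)
      assume "p \<noteq> 0"
      then have "q \<noteq> 0"
        using q by auto
      then have "degree p = Suc (degree q)"
        unfolding q by (subst degree_mult_eq) auto
      then have "n = degree q"
        using Suc.hyps(2) by linarith
      then have "pev \<phi> z q \<noteq> 0"
        using Suc.hyps(1) \<open>q \<noteq> 0\<close> by blast
      moreover have "pev \<phi> z [:- a, 1:] \<noteq> 0"
        using z[of a] by simp
      ultimately show False
        using Suc.prems unfolding q e.mult by simp
    qed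
  qed
qed auto

lemma degree_quad_funpow:
  fixes p c :: "'k::idom poly"
  assumes "degree p > 0" "degree c \<le> 1"
  shows "degree ((quad_map c ^^ n) p) = 2 ^ n * degree p"
proof (induction n)
  case (Suc n)
  let ?q = "(quad_map c ^^ n) p"
  have "degree ?q > 0"
    using Suc assms by simp
  then have "degree c < degree (?q ^ 2)"
    using assms by (subst degree_power_eq) auto
  then have "degree (?q ^ 2 + c) = degree (?q ^ 2)"
    by (rule degree_add_eq_left)
  also have "\<dots> = 2 * degree ?q"
    using \<open>degree ?q > 0\<close> by (subst degree_power_eq) auto
  finally show ?case
    using Suc by (simp add: quad_map_def[of c ?q])
qed auto

lemma crit_poly_Suc: "crit_poly (Suc M) a = (quad_map [:0, 1:] ^^ M) [:0, 1:] - [:a:]"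
  by (simp add: crit_poly_def funpow_Suc_right quad_map_def del: funpow.simps)

lemma degree_crit_poly_Suc: "degree (crit_poly (Suc M) a) = 2 ^ M"
proof -
  have "degree ((quad_map [:0, 1 :: 'a:] ^^ M) [:0, 1:]) = 2 ^ M"
    by (subst degree_quad_funpow) auto
  then show ?thesis
    unfolding crit_poly_Suc diff_conv_add_uminus by (subst degree_add_eq_left) auto
qed

lemma preimage_poly_monic:
  "degree (preimage_poly N (a :: 'k::idom)) = 2 ^ N \<and> lead_coeff (preimage_poly N a) = 1"
proof (induction N)
  case 0
  show ?case by (simp add: preimage_poly_def)
next
  case (Suc N)
  have "degree (quad_poly :: 'k poly poly) = 2"
    by simp
  moreover have "coeff (preimage_poly N a) (2 ^ N) = 1"
    using Suc by metis
  ultimately show ?case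
    using Suc unfolding preimage_poly_Suc
    by (subst (1) lead_coeff_comp) (simp_all add: degree_pcompose)
qed

lemmas degree_preimage_poly = preimage_poly_monic[THEN conjunct1]
  and lead_coeff_preimage_poly = preimage_poly_monic[THEN conjunct2]

text \<open>K[c][x] is spanned by 1 and x over the polynomials in y = x^2 + c. In the induction x
  times x becomes y - c, the polynomial \<open>[:- [:0, 1:], 1:]\<close> in y.\<close>

lemma even_odd_decomposition:
  fixes p :: "'k::comm_ring_1 poly poly"
  shows "\<exists>u v. p = pcompose u quad_poly + [:0, 1:] * pcompose v quad_poly"
proof (induction p)
  case 0
  show ?case by (intro exI[of _ 0]) auto
next
  case (pCons b p)
  then obtain u v where p: "p = pcompose u quad_poly + [:0, 1:] * pcompose v quad_poly"
    by blast
  have q: "pcompose [:- [:0, 1:], 1:] quad_poly = ([:0, 1:] * [:0, 1:] :: 'k poly poly)"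
    by (simp add: pcompose_pCons)
  have XX: "[:0, 1:] * ([:0, 1:] * pcompose v quad_poly) =
      pcompose ([:- [:0, 1:], 1:] * v) quad_poly"
    unfolding pcompose_mult q by (simp only: mult.assoc)
  have "pCons b p = [:b:] + [:0, 1:] * p"
    by simp
  also have "\<dots> = pcompose ([:b:] + [:- [:0, 1:], 1:] * v) quad_poly + [:0, 1:] * pcompose u quad_poly"
    unfolding p pcompose_add XX[symmetric] by (simp add: algebra_simps)
  finally show ?case by blast
qed

text \<open>The two summands have x-degrees of different parity and cannot cancel.\<close>

lemma even_odd_eq_0:
  fixes u v :: "'k::idom poly poly"
  assumes "pcompose u quad_poly + [:0, 1:] * pcompose v quad_poly = 0"
  shows "u = 0" "v = 0"
proof -
  have eq: "pcompose u quad_poly = - ([:0, 1:] * pcompose v quad_poly)"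
    using assms by (simp only: eq_neg_iff_add_eq_0)
  show "v = 0"
  proof (rule ccontr)
    assume "v \<noteq> 0"
    then have "pcompose v quad_poly \<noteq> 0"
      using pcompose_eq_0_iff[of quad_poly v] by simp
    then have "degree ([:0, 1:] * pcompose v quad_poly) = 1 + 2 * degree v"
      by (subst degree_mult_eq) (auto simp: degree_pcompose)
    moreover have "degree (pcompose u quad_poly) = 2 * degree u"
      by (simp add: degree_pcompose)
    ultimately have "2 * degree u = 1 + 2 * degree v"
      using eq by (metis degree_minus)
    then show False by presburger
  qed
  then show "u = 0"
    using eq pcompose_eq_0_iff[of quad_poly u] by simp
qed

text \<open>After reducing u and v modulo the monic g, the combination has x-degree below 2 deg g,
  the degree of g(x^2 + c). If divisible it is therefore 0, and uniqueness of the decomposition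
  kills both remainders.\<close>

lemma dvd_even_odd:
  fixes g u v :: "'k::idom poly poly"
  assumes monic: "lead_coeff g = 1" and deg: "degree g > 0"
  shows "pcompose g quad_poly dvd pcompose u quad_poly + [:0, 1:] * pcompose v quad_poly \<longleftrightarrow>
         g dvd u \<and> g dvd v"
proof
  let ?c = "\<lambda>p. pcompose p quad_poly"
  assume dvd: "?c g dvd ?c u + [:0, 1:] * ?c v"
  obtain s r where u: "u = g * s + r" "r = 0 \<or> degree r < degree g"
    by (rule monic_division[OF monic])
  obtain s' r' where v: "v = g * s' + r'" "r' = 0 \<or> degree r' < degree g"
    by (rule monic_division[OF monic])
  have r: "degree r < degree g" and r': "degree r' < degree g"
    using u v deg by auto
  have "?c u + [:0, 1:] * ?c v = ?c g * (?c s + [:0, 1:] * ?c s') + (?c r + [:0, 1:] * ?c r')"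
    unfolding u v by (simp only: pcompose_add pcompose_mult) (simp only: algebra_simps)
  then have dvd': "?c g dvd ?c r + [:0, 1:] * ?c r'"
    using dvd by (metis dvd_add_right_iff dvd_triv_left)
  have "?c r + [:0, 1:] * ?c r' = 0"
  proof (rule ccontr)
    assume "?c r + [:0, 1:] * ?c r' \<noteq> 0"
    then have "degree (?c g) \<le> degree (?c r + [:0, 1:] * ?c r')"
      using dvd' dvd_imp_degree_le by blast
    also have "\<dots> \<le> max (degree (?c r)) (degree ([:0, 1:] * ?c r'))"
      by (rule degree_add_le_max)
    also have "\<dots> \<le> max (2 * degree r) (1 + 2 * degree r')"
      using degree_mult_le[of "[:0, 1:]" "?c r'"] by (auto simp: degree_pcompose le_max_iff_disj)
    also have "\<dots> < 2 * degree g"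
      using r r' by auto
    finally show False
      by (simp add: degree_pcompose)
  qed
  from even_odd_eq_0[OF this] show "g dvd u \<and> g dvd v"
    using u v by simp
next
  assume "g dvd u \<and> g dvd v"
  then show "pcompose g quad_poly dvd pcompose u quad_poly + [:0, 1:] * pcompose v quad_poly"
    by (auto elim!: dvdE simp: pcompose_mult simp del: mult_pCons_left)
qed

lemma ring_map_map_poly:
  assumes "ring_map \<phi>"
  shows "ring_map (map_poly \<phi>)"
proof -
  interpret \<phi>: ring_map \<phi> by fact
  interpret c: ring_map "\<lambda>a. [:\<phi> a:]"
    using ring_map_comp[OF assms ring_map_const_poly] .
  have "map_poly \<phi> p = pev (\<lambda>a. [:\<phi> a:]) [:0, 1:] p" for p
    by (induction p) (auto simp: map_poly_pCons)
  then have "map_poly \<phi> = pev (\<lambda>a. [:\<phi> a:]) [:0, 1:]"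
    by blast
  then show ?thesis
    using c.ring_map_pev[of "[:0, 1:]"] by simp
qed

lemma ring_map_fps_const: "ring_map (fps_const :: 'k::comm_ring_1 \<Rightarrow> 'k fps)"
  by unfold_locales auto

lemma ring_map_fps_nth_0: "ring_map (\<lambda>f :: 'k::comm_ring_1 fps. fps_nth f 0)"
  by unfold_locales auto

text \<open>
  Near a point of the critical orbit the curve for \<open>M\<close> is parametrised by \<open>s = y - c\<close>.
\<close>

lemma crit_series:
  fixes a c0 :: "'k::alg_closed_field"
  assumes prime: "prime_elem (preimage_poly M a)"
    and root: "poly (crit_poly (Suc M) a) c0 = 0"
    and simple: "poly (pderiv (crit_poly (Suc M) a)) c0 \<noteq> 0"
  obtains \<gamma> where "fps_nth \<gamma> 0 = c0"
    and "\<And>p. ev2 fps_const (\<gamma> + fps_X) \<gamma> p = 0 \<longleftrightarrow> preimage_poly M a dvd p"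
    and "\<And>b. \<gamma> \<noteq> fps_const b"
proof -
  interpret const: ring_map "fps_const :: 'k \<Rightarrow> 'k fps" by (rule ring_map_fps_const)
  \<comment> \<open>The equation of the curve for M at y = c + s, read as a polynomial in c over
    K[[s]]. At s = 0 it is \<open>crit_poly (Suc M) a\<close>, because the critical orbit passes
    from 0 to c in one step.\<close>
  define P where "P = (quad_map [:0, 1:] ^^ M) [:fps_X, 1:] - [:fps_const a:]"
  interpret red: ring_map "map_poly (\<lambda>f :: 'k fps. fps_nth f 0)"
    by (rule ring_map_map_poly[OF ring_map_fps_nth_0])
  have red: "map_poly (\<lambda>f. fps_nth f 0) P = crit_poly (Suc M) a"
    unfolding P_def red.diff red.quad_map_funpow crit_poly_Suc by (simp add: map_poly_pCons)
  have "\<exists>f. fps_nth f 0 = c0 \<and> poly P f = 0"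
    by (rule fps_hensel) (simp_all only: red root simple not_False_eq_True)
  then obtain \<gamma> where \<gamma>0: "fps_nth \<gamma> 0 = c0" and "poly P \<gamma> = 0"
    by blast
  moreover have "poly P \<gamma> = (quad_map \<gamma> ^^ M) (\<gamma> + fps_X) - fps_const a"
  proof -
    interpret p: ring_map "\<lambda>p. poly p \<gamma>" by (rule ring_map_poly)
    show ?thesis by (simp add: P_def add.commute)
  qed
  ultimately have eq: "(quad_map \<gamma> ^^ M) (\<gamma> + fps_X) = fps_const a"
    by simp
  \<comment> \<open>For constant \<open>\<gamma>\<close> the series \<open>\<gamma> + fps_X\<close>
    would be transcendental over K and yet a root of the nonzero polynomial Q over K.\<close>
  have nonconst: "\<gamma> \<noteq> fps_const b" for b
  proof
    assume "\<gamma> = fps_const b"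
    define Q where "Q = (quad_map [:b:] ^^ M) [:0, 1:] - [:a:]"
    have "degree ((quad_map [:b:] ^^ M) [:0, 1:]) = 2 ^ M"
      by (subst degree_quad_funpow) auto
    then have "degree Q = 2 ^ M"
      unfolding Q_def diff_conv_add_uminus by (subst degree_add_eq_left) auto
    then have "Q \<noteq> 0"
      by auto
    interpret e: ring_map "pev fps_const (\<gamma> + fps_X)" by (rule const.ring_map_pev)
    have "pev fps_const (\<gamma> + fps_X) Q = (quad_map \<gamma> ^^ M) (\<gamma> + fps_X) - fps_const a"
      unfolding Q_def e.diff e.quad_map_funpow by (simp add: \<open>\<gamma> = fps_const b\<close>)
    then have "pev fps_const (\<gamma> + fps_X) Q = 0"
      using eq by simp
    moreover have "\<gamma> + fps_X \<noteq> fps_const d" for d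
      using arg_cong[of "\<gamma> + fps_X" "fps_const d" "\<lambda>f. fps_nth f 1"] \<open>\<gamma> = fps_const b\<close> by auto
    ultimately show False
      using pev_eq_0_iff_transcendental[OF ring_map_fps_const] \<open>Q \<noteq> 0\<close> by blast
  qed
  show ?thesis
  proof (rule that)
    show "ev2 fps_const (\<gamma> + fps_X) \<gamma> p = 0 \<longleftrightarrow> preimage_poly M a dvd p" for p
    proof (rule kernel_eq_dvd[OF const.ring_map_ev2 prime lead_coeff_preimage_poly])
      show "ev2 fps_const (\<gamma> + fps_X) \<gamma> (preimage_poly M a) = 0"
        by (simp add: const.ev2_preimage_poly eq)
      show "r = 0" if "ev2 fps_const (\<gamma> + fps_X) \<gamma> [:r:] = 0" for r
        using that pev_eq_0_iff_transcendental[OF ring_map_fps_const nonconst] by simp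
    qed
    show "fps_nth \<gamma> 0 = c0"
      by (fact \<gamma>0)
    show "\<gamma> \<noteq> fps_const b" for b
      by (fact nonconst)
  qed
qed

text \<open>
  Writing \<open>p = u(x\<^sup>2 + c) + x v(x\<^sup>2 + c)\<close>, the norm \<open>u\<^sup>2 - (y - c) v\<^sup>2\<close> of a zero divisor vanishes on
  the curve for \<open>M\<close>, which contradicts parity of the order of vanishing at a critical point.
\<close>

lemma prime_elem_preimage_poly_Suc:
  fixes a c0 :: "'k::alg_closed_field"
  assumes prime: "prime_elem (preimage_poly M a)"
    and root: "poly (crit_poly (Suc M) a) c0 = 0"
    and simple: "poly (pderiv (crit_poly (Suc M) a)) c0 \<noteq> 0"
  shows "prime_elem (preimage_poly (Suc M) a)"
proof (rule prime_elemI)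
  let ?g = "preimage_poly M a" and ?c = "\<lambda>p. pcompose p quad_poly" and ?X = "[:0, 1:]"
  let ?H = "preimage_poly (Suc M) a"
  show "?H \<noteq> 0"
    using lead_coeff_preimage_poly[of "Suc M" a] by auto
  show "\<not> ?H dvd 1"
    using degree_preimage_poly[of "Suc M" a] by (auto dest: dvd_imp_degree_le)
  have H: "?H dvd ?c u + ?X * ?c v \<longleftrightarrow> ?g dvd u \<and> ?g dvd v" for u v
    unfolding preimage_poly_Suc
    by (rule dvd_even_odd[OF lead_coeff_preimage_poly]) (simp add: degree_preimage_poly)
  obtain \<gamma> where ker: "\<And>p. ev2 fps_const (\<gamma> + fps_X) \<gamma> p = 0 \<longleftrightarrow> ?g dvd p"
    using crit_series[OF assms] by metis
  interpret const: ring_map "fps_const :: 'k \<Rightarrow> 'k fps" by (rule ring_map_fps_const)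
  interpret e: ring_map "ev2 fps_const (\<gamma> + fps_X) \<gamma>" by (rule const.ring_map_ev2)
  fix p q assume pq: "?H dvd p * q"
  show "?H dvd p \<or> ?H dvd q"
  proof (rule ccontr)
    assume not_dvd: "\<not> (?H dvd p \<or> ?H dvd q)"
    obtain u v where p: "p = ?c u + ?X * ?c v"
      using even_odd_decomposition by blast
    obtain u' v' where q: "q = ?c u' + ?X * ?c v'"
      using even_odd_decomposition by blast
    define n where "n = u\<^sup>2 - v\<^sup>2 * [:- [:0, 1:], 1:]"
    have XX: "?c [:- [:0, 1:], 1:] = (?X * ?X :: 'k poly poly)"
      by (simp add: pcompose_pCons)
    have "(?c u - ?X * ?c v) * p = ?c n"
      unfolding p n_def pcompose_diff pcompose_mult power2_eq_square XX
      by (simp only: algebra_simps)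
    \<comment> \<open>Multiplying by the conjugate of p turns the hypothesis into divisibility of n
      u' and n v' by the lower polynomial. This is prime and does not divide both u' and v', so it
      divides n.\<close>
    then have "?c n * q = (?c u - ?X * ?c v) * (p * q)"
      by (simp only: mult.assoc[symmetric])
    then have "?H dvd ?c n * q"
      using pq by (simp only: dvd_mult)
    also have "?c n * q = ?c (n * u') + ?X * ?c (n * v')"
      unfolding q pcompose_mult by (simp only: algebra_simps)
    finally have "?g dvd n * u'" "?g dvd n * v'"
      using H by blast+
    moreover have "\<not> (?g dvd u' \<and> ?g dvd v')"
      using not_dvd H q by blast
    ultimately have "?g dvd n"
      unfolding prime_elem_dvd_mult_iff[OF prime] by blast
    let ?e = "ev2 fps_const (\<gamma> + fps_X) \<gamma>"
    have "?e [:- [:0, 1:], 1:] = fps_X"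
      by (simp add: const.ev2_pCons one_pCons)
    then have "?e n = (?e u)\<^sup>2 - (?e v)\<^sup>2 * fps_X"
      unfolding n_def e.diff e.mult e.power by simp
    then have eq: "(?e u)\<^sup>2 = (?e v)\<^sup>2 * fps_X"
      using ker[of n] \<open>?g dvd n\<close> by simp
    have "?e v = 0"
    proof (rule ccontr)
      assume v: "?e v \<noteq> 0"
      then have "subdegree ((?e v)\<^sup>2 * fps_X) = 2 * subdegree (?e v) + 1"
        by (subst subdegree_mult) (auto simp: subdegree_power)
      moreover have "subdegree ((?e u)\<^sup>2) = 2 * subdegree (?e u)"
        by (simp add: subdegree_power)
      ultimately have "2 * subdegree (?e u) = 2 * subdegree (?e v) + 1"
        using eq by simp
      then show False by presburger
    qed
    moreover from this have "?e u = 0"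
      using eq by simp
    ultimately have "?g dvd u \<and> ?g dvd v"
      using ker by blast
    then show False
      using not_dvd H p by blast
  qed
qed

text \<open>The bottom of the tower is the line x = a. Each further step needs one root of
  \<open>crit_poly (Suc N) a\<close>, which exists since its degree 2^N is positive.\<close>

theorem prime_elem_preimage_poly:
  fixes a :: "'k::alg_closed_field"
  assumes "crit_simple N a"
  shows "prime_elem (preimage_poly N a)"
  using assms
proof (induction N)
  case 0
  have g: "preimage_poly 0 a = [:- [:a:], 1:]"
    by (simp add: preimage_poly_def)
  have dvd: "preimage_poly 0 a dvd p \<longleftrightarrow> poly p [:a:] = 0" for p
    unfolding g by (rule poly_eq_0_iff_dvd[symmetric])
  show ?case
  proof (rule prime_elemI)
    show "preimage_poly 0 a \<noteq> 0"
      by (simp add: g)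
    show "\<not> preimage_poly 0 a dvd 1"
      by (simp add: dvd)
  qed (auto simp: dvd)
next
  case (Suc N)
  obtain c0 where c0: "poly (crit_poly (Suc N) a) c0 = 0"
    using alg_closed_imp_poly_has_root[of "crit_poly (Suc N) a"] by (auto simp: degree_crit_poly_Suc)
  show ?case
  proof (rule prime_elem_preimage_poly_Suc[OF Suc.IH c0])
    show "crit_simple N a"
      using Suc.prems by (auto simp: crit_simple_def)
    show "poly (pderiv (crit_poly (Suc N) a)) c0 \<noteq> 0"
      using Suc.prems c0 by (auto simp: crit_simple_def)
  qed
qed

section \<open>Subfields and degrees\<close>

abbreviation type_ring :: "'f::field ring" where
  "type_ring \<equiv> ring_of_type_algebra"

lemma type_ring_simps [simp]:
  "carrier type_ring = UNIV" "x \<otimes>\<^bsub>type_ring\<^esub> y = x * y" "x \<oplus>\<^bsub>type_ring\<^esub> y = x + y"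
  "\<one>\<^bsub>type_ring\<^esub> = 1" "\<zero>\<^bsub>type_ring\<^esub> = 0"
  by (simp_all add: ring_of_type_algebra_def)

interpretation type_ring: domain "type_ring :: 'f::field ring"
  by (rule field.axioms(1)[OF field_from_type_algebra])

lemma type_ring_a_inv [simp]: "\<ominus>\<^bsub>type_ring\<^esub> (x :: 'f::field) = - x"
  using type_ring.minus_equality[of "- x" x] by simp

lemma type_ring_m_inv [simp]: "x \<noteq> 0 \<Longrightarrow> inv\<^bsub>type_ring\<^esub> (x :: 'f::field) = inverse x"
  using type_ring.inv_char[of x "inverse x"] by simp

lemma type_ring_pow [simp]: "x [^]\<^bsub>type_ring\<^esub> (n :: nat) = (x :: 'f::field) ^ n"
  by (induction n) (auto simp: mult.commute)

text \<open>\<open>subfld\<close> and \<open>vdim\<close> apply the HOL-Algebra theory of subfields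
  and dimensions to subsets of a field type, so that all fields of the lower bound live in one
  type.\<close>

definition subfld :: "'f::field set \<Rightarrow> bool" where
  "subfld S \<longleftrightarrow> subfield S type_ring"

definition vdim :: "nat \<Rightarrow> 'f::field set \<Rightarrow> 'f set \<Rightarrow> bool" where
  "vdim n S V \<longleftrightarrow> type_ring.dimension n S V"

lemma subfldI:
  assumes "1 \<in> S" "\<And>a. a \<in> S \<Longrightarrow> - a \<in> S" "\<And>a b. a \<in> S \<Longrightarrow> b \<in> S \<Longrightarrow> a + b \<in> S"
    "\<And>a b. a \<in> S \<Longrightarrow> b \<in> S \<Longrightarrow> a * b \<in> S" "\<And>a. a \<in> S \<Longrightarrow> a \<noteq> 0 \<Longrightarrow> inverse a \<in> S"
  shows "subfld S"
  unfolding subfld_def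
  by (rule field.subfieldI'[OF field_from_type_algebra], rule type_ring.subringI) (use assms in auto)

context
  fixes S :: "'f::field set"
  assumes S: "subfld S"
begin

lemmas subfld_subring = subfieldE(1)[OF S[unfolded subfld_def]]

lemma subfld_0: "0 \<in> S"
  using subringE(2)[OF subfld_subring] by simp

lemma subfld_1: "1 \<in> S"
  using subringE(3)[OF subfld_subring] by simp

lemma subfld_uminus: "a \<in> S \<Longrightarrow> - a \<in> S"
  using subringE(5)[OF subfld_subring, of a] by simp

lemma subfld_mult: "a \<in> S \<Longrightarrow> b \<in> S \<Longrightarrow> a * b \<in> S"
  using subringE(6)[OF subfld_subring, of a b] by simp

lemma subfld_add: "a \<in> S \<Longrightarrow> b \<in> S \<Longrightarrow> a + b \<in> S"
  using subringE(7)[OF subfld_subring, of a b] by simp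

lemma subfld_diff: "a \<in> S \<Longrightarrow> b \<in> S \<Longrightarrow> a - b \<in> S"
  using subfld_add[of a "- b"] subfld_uminus[of b] by simp

lemma subfld_inverse: "a \<in> S \<Longrightarrow> inverse a \<in> S"
  using type_ring.subfield_m_inv(1)[OF S[unfolded subfld_def], of a] subfld_0
  by (cases "a = 0") auto

lemma subfld_divide: "a \<in> S \<Longrightarrow> b \<in> S \<Longrightarrow> a / b \<in> S"
  by (simp add: field_class.field_divide_inverse subfld_mult subfld_inverse)

lemma subfld_power: "a \<in> S \<Longrightarrow> a ^ n \<in> S"
  by (induction n) (auto intro: subfld_mult subfld_1)

lemma subfld_sum: "(\<And>i. i \<in> A \<Longrightarrow> f i \<in> S) \<Longrightarrow> sum f A \<in> S"
  by (induction A rule: infinite_finite_induct) (auto intro: subfld_0 subfld_add)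

lemma subfld_quad_funpow: "c \<in> S \<Longrightarrow> z \<in> S \<Longrightarrow> (quad_map c ^^ n) z \<in> S"
  by (induction n) (auto simp: quad_map_def intro: subfld_add subfld_power)

end

lemmas subfld_closed = subfld_0 subfld_1 subfld_uminus subfld_mult subfld_add subfld_diff
  subfld_inverse subfld_divide subfld_power

lemma combine_eq_sum:
  "length Ks = length Us \<Longrightarrow>
     type_ring.combine Ks Us = (\<Sum>i<length Us. Ks ! i * (Us ! i :: 'f::field))"
  by (induction Ks Us rule: list_induct2)
     (simp_all add: sum.lessThan_Suc_shift del: sum.lessThan_Suc)

text \<open>A family indexed by 0..n, with repetitions allowed, serves equally for powers of one
  element and for separating functions.\<close>

lemma vdim_relation:
  fixes u :: "nat \<Rightarrow> 'f::field"
  assumes S: "subfld S" and dim: "vdim n S V" and u: "\<And>i. i \<le> n \<Longrightarrow> u i \<in> V"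
  obtains k i0 where "\<And>i. i \<le> n \<Longrightarrow> k i \<in> S" "i0 \<le> n" "k i0 \<noteq> 0" "(\<Sum>i\<le>n. k i * u i) = 0"
proof -
  let ?Us = "map u [0..<Suc n]"
  have "\<not> type_ring.independent S ?Us"
  proof
    assume "type_ring.independent S ?Us"
    moreover have "set ?Us \<subseteq> V"
      using u by auto
    ultimately have "length ?Us \<le> n"
      using type_ring.independent_length_le_dimension S dim
      unfolding subfld_def vdim_def by blast
    then show False by simp
  qed
  then obtain Ks where Ks: "length Ks = length ?Us" "type_ring.combine Ks ?Us = 0"
      "set Ks \<subseteq> S" "set Ks \<noteq> {0}"
    using type_ring.dependent_imp_non_trivial_combine[OF S[unfolded subfld_def], of ?Us] by auto
  have len: "length Ks = Suc n"
    using Ks(1) by simp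
  then have "Ks \<noteq> []"
    by auto
  then obtain b where "b \<in> set Ks" "b \<noteq> 0"
    using Ks(4) by (metis all_not_in_conv insertI1 set_empty singleton_iff subset_singletonD subsetI)
  then obtain i0 where i0: "i0 \<le> n" "Ks ! i0 \<noteq> 0"
    using len by (metis in_set_conv_nth less_Suc_eq_le)
  have "(\<Sum>i<Suc n. Ks ! i * (?Us ! i)) = 0"
    using Ks(2) combine_eq_sum[OF Ks(1)] by simp
  moreover have "(\<Sum>i<Suc n. Ks ! i * (?Us ! i)) = (\<Sum>i<Suc n. Ks ! i * u i)"
    by (rule sum.cong) (auto simp: nth_append less_Suc_eq)
  ultimately have rel: "(\<Sum>i\<le>n. Ks ! i * u i) = 0"
    by (simp only: lessThan_Suc_atMost)
  have mem: "Ks ! i \<in> S" if "i \<le> n" for i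
    using Ks(3) len that by (metis le_imp_less_Suc nth_mem subsetD)
  show ?thesis
    by (rule that[of "\<lambda>i. Ks ! i" i0]) (fact mem i0 rel)+
qed

lemma vdim_pos:
  assumes "subfld S" "vdim n S V" "1 \<in> V"
  shows "n > 0"
proof (rule ccontr)
  assume "\<not> n > 0"
  then have "n = 0"
    by simp
  obtain k i0 where "\<And>i. i \<le> n \<Longrightarrow> k i \<in> S" "i0 \<le> n" "k i0 \<noteq> 0" "(\<Sum>i\<le>n. k i * 1) = 0"
    by (rule vdim_relation[OF assms(1,2), of "\<lambda>_. 1"]) (use assms(3) in auto)
  then show False
    using \<open>n = 0\<close> by simp
qed

lemma vdim_1_eq:
  assumes S: "subfld S" and dim: "vdim 1 S V" and "1 \<in> V"
  shows "V \<subseteq> S"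
proof
  fix x assume "x \<in> V"
  define u where "u i = (if i = 0 then 1 else x)" for i :: nat
  obtain k i0 where k: "\<And>i. i \<le> 1 \<Longrightarrow> k i \<in> S" "i0 \<le> 1" "k i0 \<noteq> 0" "(\<Sum>i\<le>1. k i * u i) = 0"
    by (rule vdim_relation[OF S dim, of u]) (use \<open>x \<in> V\<close> \<open>1 \<in> V\<close> in \<open>auto simp: u_def\<close>)
  have eq: "k 0 + k 1 * x = 0"
    using k(4) by (simp add: u_def)
  have "k 1 \<noteq> 0"
    using eq k(2,3) by (metis add_cancel_left_right le_neq_implies_less less_one mult_zero_left)
  then have "x = - k 0 / k 1"
    using eq by (simp add: field_simps eq_neg_iff_add_eq_0)
  then show "x \<in> S"
    using k(1) S by (auto intro!: subfld_closed)
qed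

lemma subalgebra_subfld:
  assumes "subfld S" "subfld V" "S \<subseteq> V"
  shows "subalgebra S V type_ring"
proof (intro subalgebra.intro subalgebra_axioms.intro)
  show "subgroup V (add_monoid type_ring)"
    using subring.axioms(1)[OF subfld_subring[OF assms(2)]] .
qed (use assms in \<open>auto intro: subfld_mult\<close>)

text \<open>Finiteness of L over S passes to the subspace E, and a basis of L over S still spans L
  over E. The product formula and uniqueness of dimension then give n = e m.\<close>

lemma vdim_tower_split:
  fixes S E L :: "'f::field set"
  assumes S: "subfld S" and E: "subfld E" and L: "subfld L" and "S \<subseteq> E" "E \<subseteq> L" and dim: "vdim n S L"
  obtains e m where "vdim e S E" "vdim m E L" "n = e * m"
proof -
  note sf = S[unfolded subfld_def] E[unfolded subfld_def]
  have fin: "type_ring.finite_dimension S L"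
    using dim type_ring.finite_dimensionI unfolding vdim_def by blast
  have 1: "type_ring.finite_dimension S E"
    by (rule type_ring.subalbegra_incl_imp_finite_dimension[OF sf(1) fin])
       (use subalgebra_subfld S E \<open>S \<subseteq> E\<close> \<open>E \<subseteq> L\<close> in auto)
  obtain Us where Us: "set Us \<subseteq> carrier type_ring" "type_ring.Span S Us = L"
    using type_ring.exists_base[OF sf(1) dim[unfolded vdim_def]] by blast
  have "set Us \<subseteq> L"
    using type_ring.Span_base_incl[OF sf(1) Us(1)] Us(2) by simp
  then have "type_ring.Span E Us \<subseteq> L"
    by (intro type_ring.subalgebra_Span_incl[OF sf(2)] subalgebra_subfld E L \<open>E \<subseteq> L\<close>)
  moreover have "type_ring.Span S Us \<subseteq> type_ring.Span E Us"
  proof (rule type_ring.subalgebra_Span_incl[OF sf(1)])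
    have "subalgebra E (type_ring.Span E Us) type_ring"
      by (rule type_ring.Span_is_subalgebra[OF sf(2) Us(1)])
    then show "subalgebra S (type_ring.Span E Us) type_ring"
      using \<open>S \<subseteq> E\<close> unfolding subalgebra_def subalgebra_axioms_def by blast
    show "set Us \<subseteq> type_ring.Span E Us"
      by (rule type_ring.Span_base_incl[OF sf(2) Us(1)])
  qed
  ultimately have "type_ring.Span E Us = L"
    using Us(2) by blast
  then have 2: "type_ring.finite_dimension E L"
    using type_ring.Span_finite_dimension[OF sf(2) Us(1)] by simp
  obtain e m where "type_ring.dimension e S E" "type_ring.dimension m E L"
    using 1 2 unfolding type_ring.finite_dimension_def by blast
  moreover from type_ring.telescopic_base[OF sf this]
  have "n = e * m"
    using type_ring.dimension_is_inj[OF sf(1)] dim unfolding vdim_def by blast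
  ultimately show ?thesis
    using that unfolding vdim_def by blast
qed

lemma vdim_tower:
  assumes "subfld S" "subfld E" "vdim e S E" "vdim m E L"
  shows "vdim (e * m) S L"
  using type_ring.telescopic_base[of S E e m L] assms unfolding subfld_def vdim_def by blast

text \<open>The condition \<open>min\<close> expresses V = S(y). The minimal polynomial of y divides
  the given equation, which may be reducible, so d is an upper bound for the dimension.\<close>

lemma vdim_simple:
  fixes y :: "'f::field"
  assumes S: "subfld S" and V: "subfld V" "S \<subseteq> V" "y \<in> V"
    and min: "\<And>T. subfld T \<Longrightarrow> S \<subseteq> T \<Longrightarrow> y \<in> T \<Longrightarrow> V \<subseteq> T"
    and k: "\<And>i. i \<le> d \<Longrightarrow> k i \<in> S" "k d \<noteq> 0" and root: "(\<Sum>i\<le>d. k i * y ^ i) = 0"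
  shows "\<exists>n\<le>d. vdim n S V"
proof -
  note sf = S[unfolded subfld_def]
  \<comment> \<open>HOL-Algebra lists coefficients from the top degree downwards;
    \<open>?p m\<close> collects those of index below m.\<close>
  let ?p = "\<lambda>m. map k (rev [0..<m])"
  have ev: "type_ring.eval (?p m) y = (\<Sum>i<m. k i * y ^ i)" for m
    by (induction m) (simp_all add: add.commute)
  have p: "?p (Suc d) \<in> carrier (univ_poly type_ring S)"
    using k by (auto simp: univ_poly_def polynomial_def)
  have eval0: "type_ring.eval (?p (Suc d)) y = \<zero>\<^bsub>type_ring\<^esub>"
    using root unfolding ev lessThan_Suc_atMost by simp
  have alg: "(type_ring.algebraic over S) y"
    by (rule type_ring.algebraicI[OF p _ eval0]) simp
  let ?n = "length (type_ring.Irr S y) - 1"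
  have dim: "vdim ?n S (type_ring.simple_extension S y)"
    unfolding vdim_def by (rule type_ring.dimension_simple_extension[OF sf _ alg]) simp
  have "?n \<le> length (?p (Suc d)) - 1"
  proof (rule type_ring.pdivides_imp_degree_le[OF subfieldE(1)[OF sf]])
    show "type_ring.Irr S y \<in> carrier (univ_poly type_ring S)"
      by (rule type_ring.IrrE(1)[OF sf _ alg]) simp
    show "type_ring.Irr S y pdivides\<^bsub>type_ring\<^esub> ?p (Suc d)"
      by (rule type_ring.Irr_minimal[OF sf _ alg p eval0]) simp
  qed (use p in auto)
  then have "?n \<le> d"
    by simp
  moreover have "type_ring.simple_extension S y = V"
  proof
    show "type_ring.simple_extension S y \<subseteq> V"
      by (rule type_ring.simple_extension_subring_incl[OF subfld_subring[OF V(1)]]) (use V in auto)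
    have "subfld (type_ring.simple_extension S y)"
      unfolding subfld_def using type_ring.simple_extension_is_subfield[OF sf, of y] alg by simp
    then show "V \<subseteq> type_ring.simple_extension S y"
      by (rule min) (use type_ring.simple_extension_incl[of S y]
          type_ring.simple_extension_mem[OF subfld_subring[OF S], of y] in auto)
  qed
  ultimately show ?thesis
    using dim by metis
qed

section \<open>Subfields generated over K by one or two elements\<close>

definition fractions :: "('r::comm_ring_1 \<Rightarrow> 'f::field) \<Rightarrow> 'f set" where
  "fractions e = {e p / e q | p q. e q \<noteq> 0}"

lemma fractionsI: "e q \<noteq> 0 \<Longrightarrow> e p / e q \<in> fractions e"
  by (auto simp: fractions_def)

lemma fractionsE:
  assumes "z \<in> fractions e"
  obtains p q where "z = e p / e q" "e q \<noteq> 0"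
  using assms by (auto simp: fractions_def)

lemma ring_map_in_fractions:
  assumes "ring_map e"
  shows "e p \<in> fractions e"
  using fractionsI[of e 1 p] ring_map.one[OF assms] by simp

lemma subfld_fractions:
  assumes "ring_map e"
  shows "subfld (fractions e)"
proof (rule subfldI)
  interpret ring_map e by fact
  show "1 \<in> fractions e"
    using fractionsI[of e 1 1] by simp
  fix a assume a: "a \<in> fractions e"
  then obtain p q where pq: "a = e p / e q" "e q \<noteq> 0"
    by (rule fractionsE)
  show "- a \<in> fractions e"
    using fractionsI[of e q "- p"] pq by simp
  show "inverse a \<in> fractions e" if "a \<noteq> 0"
    using fractionsI[of e p q] pq that by simp
  fix b assume "b \<in> fractions e"
  then obtain p' q' where pq': "b = e p' / e q'" "e q' \<noteq> 0"
    by (rule fractionsE)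
  show "a * b \<in> fractions e"
    using fractionsI[of e "q * q'" "p * p'"] pq pq' by simp
  have "a + b = e (p * q' + p' * q) / e (q * q')"
    using pq pq' by (simp add: field_simps)
  also have "\<dots> \<in> fractions e"
    by (rule fractionsI) (use pq pq' in simp)
  finally show "a + b \<in> fractions e" .
qed

lemma fractions_subset:
  assumes "subfld T" "\<And>p. e p \<in> T"
  shows "fractions e \<subseteq> T"
  using assms by (auto simp: fractions_def intro: subfld_divide)

definition gen :: "('k::field \<Rightarrow> 'f::field) \<Rightarrow> 'f \<Rightarrow> 'f set" where
  "gen j h = fractions (pev j h)"

definition gen2 :: "('k::field \<Rightarrow> 'f::field) \<Rightarrow> 'f \<Rightarrow> 'f \<Rightarrow> 'f set" where
  "gen2 j x c = fractions (ev2 j x c)"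

context field_map
begin

lemma subfld_gen: "subfld (gen \<phi> h)"
  unfolding gen_def by (intro subfld_fractions ring_map_pev)

lemma subfld_gen2: "subfld (gen2 \<phi> x c)"
  unfolding gen2_def by (intro subfld_fractions ring_map_ev2)

lemma pev_in_gen: "pev \<phi> h p \<in> gen \<phi> h"
  unfolding gen_def by (rule ring_map_in_fractions[OF ring_map_pev])

lemma ev2_in_gen2: "ev2 \<phi> x c p \<in> gen2 \<phi> x c"
  unfolding gen2_def by (rule ring_map_in_fractions[OF ring_map_ev2])

lemma const_in_gen: "\<phi> a \<in> gen \<phi> h"
  using pev_in_gen[of h "[:a:]"] by simp

lemma gen_mem: "h \<in> gen \<phi> h"
  using pev_in_gen[of h "[:0, 1:]"] by simp

lemma const_in_gen2: "\<phi> a \<in> gen2 \<phi> x c"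
  using ev2_in_gen2[of x c "[:[:a:]:]"] by simp

lemma gen2_mem: "x \<in> gen2 \<phi> x c" "c \<in> gen2 \<phi> x c"
  using ev2_in_gen2[of x c "[:0, 1:]"] ev2_in_gen2[of x c "[:[:0, 1:]:]"] by simp_all

lemma pev_in_subfld: "subfld T \<Longrightarrow> range \<phi> \<subseteq> T \<Longrightarrow> h \<in> T \<Longrightarrow> pev \<phi> h p \<in> T"
  by (induction p) (auto intro!: subfld_closed)

lemma ev2_in_subfld:
  assumes "subfld T" "range \<phi> \<subseteq> T" "x \<in> T" "c \<in> T"
  shows "ev2 \<phi> x c p \<in> T"
  by (induction p) (use assms in \<open>auto simp: ev2_pCons intro!: subfld_closed pev_in_subfld\<close>)

lemma gen_subset: "subfld T \<Longrightarrow> range \<phi> \<subseteq> T \<Longrightarrow> h \<in> T \<Longrightarrow> gen \<phi> h \<subseteq> T"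
  unfolding gen_def by (intro fractions_subset pev_in_subfld)

lemma gen2_subset: "subfld T \<Longrightarrow> range \<phi> \<subseteq> T \<Longrightarrow> x \<in> T \<Longrightarrow> c \<in> T \<Longrightarrow> gen2 \<phi> x c \<subseteq> T"
  unfolding gen2_def by (intro fractions_subset ev2_in_subfld)

lemma range_subset_gen: "range \<phi> \<subseteq> gen \<phi> h"
  using const_in_gen by auto

lemma range_subset_gen2: "range \<phi> \<subseteq> gen2 \<phi> x c"
  using const_in_gen2 by auto

lemma gen_eqI: "h \<in> gen \<phi> g \<Longrightarrow> g \<in> gen \<phi> h \<Longrightarrow> gen \<phi> h = gen \<phi> g"
  by (intro equalityI gen_subset subfld_gen range_subset_gen)

lemma gen_diff: "gen \<phi> (h - \<phi> s) = gen \<phi> h"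
proof (rule gen_eqI)
  show "h - \<phi> s \<in> gen \<phi> h"
    by (intro subfld_diff subfld_gen gen_mem const_in_gen)
  have "(h - \<phi> s) + \<phi> s \<in> gen \<phi> (h - \<phi> s)"
    by (intro subfld_add subfld_gen gen_mem const_in_gen)
  then show "h \<in> gen \<phi> (h - \<phi> s)" by simp
qed

lemma gen_inverse: "gen \<phi> (inverse h) = gen \<phi> h"
proof (rule gen_eqI)
  show "inverse h \<in> gen \<phi> h"
    by (intro subfld_inverse subfld_gen gen_mem)
  have "inverse (inverse h) \<in> gen \<phi> (inverse h)"
    by (intro subfld_inverse subfld_gen gen_mem)
  then show "h \<in> gen \<phi> (inverse h)" by simp
qed

end

locale alg_closed_embedding = field_map j for j :: "'k::alg_closed_field \<Rightarrow> 'f::field"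
begin

lemma pev_eq_0_iff: "z \<notin> range j \<Longrightarrow> pev j z p = 0 \<longleftrightarrow> p = 0"
  by (rule pev_eq_0_iff_transcendental[OF ring_map_axioms]) auto

text \<open>If all coefficients vanish at 0, a factor w can be cancelled from the relation. This
  lowers the degree of one nonzero coefficient, so it stops.\<close>

lemma relation_not_all_vanishing:
  assumes "i0 \<in> I" "p i0 \<noteq> 0" "w \<noteq> 0" "(\<Sum>i\<in>I. pev j w (p i) * u i) = 0"
  shows "\<exists>q. (\<exists>i\<in>I. poly (q i) 0 \<noteq> 0) \<and> (\<Sum>i\<in>I. pev j w (q i) * u i) = 0"
  using assms
proof (induction "degree (p i0)" arbitrary: p rule: less_induct)
  case less
  show ?case
  proof (cases "\<exists>i\<in>I. poly (p i) 0 \<noteq> 0")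
    case True
    then show ?thesis
      using less.prems(4) by blast
  next
    case False
    define p' where "p' i = poly_shift 1 (p i)" for i
    have p': "p i = pCons 0 (p' i)" if "i \<in> I" for i
      using False that
      by (intro poly_eqI) (auto simp: p'_def coeff_poly_shift coeff_pCons poly_0_coeff_0 split: nat.split)
    have ne: "p' i0 \<noteq> 0"
      using p'[OF less.prems(1)] less.prems(2) by auto
    have deg: "degree (p' i0) < degree (p i0)"
      unfolding p'[OF less.prems(1)] using ne by simp
    have "(\<Sum>i\<in>I. pev j w (p i) * u i) = w * (\<Sum>i\<in>I. pev j w (p' i) * u i)"
      unfolding sum_distrib_left by (rule sum.cong) (auto simp: p')
    then have "(\<Sum>i\<in>I. pev j w (p' i) * u i) = 0"
      using less.prems by simp
    from less.hyps[OF deg less.prems(1) ne less.prems(3) this] show ?thesis .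
  qed
qed

text \<open>Clear denominators, then remove common factors w. The normalisation that not all
  coefficients vanish at 0 makes the relation survive reduction at a zero of w.\<close>

lemma gen_relation:
  assumes w: "w \<notin> range j" and dim: "vdim n (gen j w) V" and u: "\<And>i. i \<le> n \<Longrightarrow> u i \<in> V"
  shows "\<exists>q. (\<exists>i\<in>{..n}. poly (q i) 0 \<noteq> 0) \<and> (\<Sum>i\<le>n. pev j w (q i) * u i) = 0"
proof -
  interpret e: ring_map "pev j w" by (rule ring_map_pev)
  obtain k i0 where k: "\<And>i. i \<le> n \<Longrightarrow> k i \<in> gen j w" and i0: "i0 \<le> n" "k i0 \<noteq> 0"
    and rel: "(\<Sum>i\<le>n. k i * u i) = 0"
    by (rule vdim_relation[OF subfld_gen dim, of u]) (use u in auto)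
  have "\<forall>i\<in>{..n}. \<exists>a b. k i = pev j w a / pev j w b \<and> pev j w b \<noteq> 0"
    using k unfolding gen_def by (auto elim!: fractionsE)
  then obtain a b where ab: "\<And>i. i \<le> n \<Longrightarrow> k i = pev j w (a i) / pev j w (b i)"
      "\<And>i. i \<le> n \<Longrightarrow> pev j w (b i) \<noteq> 0"
    by (metis atMost_iff)
  define B where "B = (\<Prod>l\<le>n. pev j w (b l))"
  have "B \<noteq> 0"
    using ab(2) by (simp add: B_def)
  define p where "p i = a i * (\<Prod>l\<in>{..n} - {i}. b l)" for i
  have p: "pev j w (p i) = B * k i" if "i \<le> n" for i
  proof -
    have "B = pev j w (b i) * (\<Prod>l\<in>{..n} - {i}. pev j w (b l))"
      unfolding B_def using that by (subst prod.remove[of _ i]) auto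
    then show ?thesis
      using ab[OF that] by (simp add: p_def e.prod)
  qed
  have "p i0 \<noteq> 0"
    using p[OF i0(1)] i0(2) \<open>B \<noteq> 0\<close> by auto
  moreover have "(\<Sum>i\<le>n. pev j w (p i) * u i) = B * (\<Sum>i\<le>n. k i * u i)"
    unfolding sum_distrib_left by (rule sum.cong) (auto simp: p)
  moreover have "w \<noteq> 0"
    using w zero by (metis rangeI)
  ultimately show ?thesis
    using relation_not_all_vanishing[of i0 "{..n}" p w u] i0(1) rel by simp
qed

end

section \<open>Valuation rings\<close>

lemma infinite_alg_closed_UNIV: "infinite (UNIV :: 'k::alg_closed_field set)"
proof
  assume fin: "finite (UNIV :: 'k set)"
  define p where "p = (\<Prod>a\<in>UNIV. [:- a, 1 :: 'k:])"
  have "degree p = card (UNIV :: 'k set)"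
    unfolding p_def by (subst degree_prod_eq_sum_degree) auto
  then have "degree p > 0"
    using fin by (simp add: card_gt_0_iff)
  then have "degree (p + 1) > 0"
    by (subst degree_add_eq_left) auto
  then obtain x where x: "poly (p + 1) x = 0"
    using alg_closed_imp_poly_has_root by blast
  have "poly p x = 0"
    unfolding p_def poly_prod using fin by (intro prod_zero) auto
  then show False
    using x by simp
qed

text \<open>The counterpart of \<open>curve_points\<close> for a subset L of a field type;
  \<open>range j \<noteq> P\<close> excludes the trivial case P = K. For such P,
  \<open>nonunits P\<close> is the maximal ideal and \<open>val j P z s\<close> says that z has
  residue s.\<close>

definition places :: "('k::field \<Rightarrow> 'f::field) \<Rightarrow> 'f set \<Rightarrow> 'f set set" where
  "places j L = {P. P \<subseteq> L \<and> P \<noteq> L \<and> range j \<subseteq> P \<and> range j \<noteq> P \<and>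
     (\<forall>a\<in>P. \<forall>b\<in>P. a + b \<in> P \<and> a * b \<in> P) \<and> (\<forall>a\<in>P. - a \<in> P) \<and>
     (\<forall>z\<in>L - {0}. z \<in> P \<or> inverse z \<in> P)}"

definition nonunits :: "'f::field set \<Rightarrow> 'f set" where
  "nonunits P = {z \<in> P. z = 0 \<or> inverse z \<notin> P}"

definition val :: "('k::field \<Rightarrow> 'f::field) \<Rightarrow> 'f set \<Rightarrow> 'f \<Rightarrow> 'k \<Rightarrow> bool" where
  "val j P z s \<longleftrightarrow> z \<in> P \<and> z - j s \<in> nonunits P"

lemma (in field_map) subfld_range: "subfld (range \<phi>)"
proof (rule subfldI)
  show "1 \<in> range \<phi>"
    using one by (metis rangeI)
qed (auto simp flip: add mult uminus inverse)

locale place = field_map j for j :: "'k::field \<Rightarrow> 'f::field" +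
  fixes L P
  assumes L: "subfld L" and P: "P \<in> places j L"
begin

lemma sub: "z \<in> P \<Longrightarrow> z \<in> L"
  using P by (auto simp: places_def)

lemma const_mem: "j s \<in> P"
  using P unfolding places_def by blast

lemma zero_mem: "0 \<in> P"
  using const_mem[of 0] by simp

lemma one_mem: "1 \<in> P"
  using const_mem[of 1] by simp

lemma add_mem: "a \<in> P \<Longrightarrow> b \<in> P \<Longrightarrow> a + b \<in> P"
  using P by (auto simp: places_def)

lemma mult_mem: "a \<in> P \<Longrightarrow> b \<in> P \<Longrightarrow> a * b \<in> P"
  using P by (auto simp: places_def)

lemma uminus_mem: "a \<in> P \<Longrightarrow> - a \<in> P"
  using P by (auto simp: places_def)

lemma diff_mem: "a \<in> P \<Longrightarrow> b \<in> P \<Longrightarrow> a - b \<in> P"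
  using add_mem[of a "- b"] uminus_mem[of b] by simp

lemma power_mem: "a \<in> P \<Longrightarrow> a ^ n \<in> P"
  by (induction n) (auto intro: one_mem mult_mem)

lemma cases: "z \<in> L \<Longrightarrow> z \<noteq> 0 \<Longrightarrow> z \<in> P \<or> inverse z \<in> P"
  using P by (auto simp: places_def)

lemma m_sub: "z \<in> nonunits P \<Longrightarrow> z \<in> P"
  by (auto simp: nonunits_def)

lemma zero_m: "0 \<in> nonunits P"
  by (auto simp: nonunits_def zero_mem)

lemma unit: "z \<in> P \<Longrightarrow> z \<notin> nonunits P \<Longrightarrow> z \<noteq> 0 \<and> inverse z \<in> P"
  by (auto simp: nonunits_def)

lemma inverse_m: "z \<in> L \<Longrightarrow> z \<notin> P \<Longrightarrow> inverse z \<in> nonunits P"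
  using cases[of z] zero_mem by (auto simp: nonunits_def)

lemma m_mult:
  assumes a: "a \<in> nonunits P" and b: "b \<in> P"
  shows "a * b \<in> nonunits P"
proof (cases "a * b = 0")
  case True
  show ?thesis
    unfolding True by (rule zero_m)
next
  case False
  have "inverse (a * b) \<notin> P"
  proof
    assume "inverse (a * b) \<in> P"
    then have "b * inverse (a * b) \<in> P"
      using b mult_mem by blast
    moreover have "b * inverse (a * b) = inverse a"
      using False by (simp add: field_simps)
    ultimately have "inverse a \<in> P"
      by metis
    then show False
      using a False by (auto simp: nonunits_def)
  qed
  then show ?thesis
    using a b by (auto simp: nonunits_def mult_mem)
qed

lemma m_mult': "a \<in> P \<Longrightarrow> b \<in> nonunits P \<Longrightarrow> a * b \<in> nonunits P"
  using m_mult[of b a] by (simp add: mult.commute)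

lemma one_notin_m: "1 \<notin> nonunits P"
  using one_mem by (simp add: nonunits_def)

lemma m_prime:
  assumes "a \<in> P" "b \<in> P" "a * b \<in> nonunits P"
  shows "a \<in> nonunits P \<or> b \<in> nonunits P"
proof (rule ccontr)
  assume "\<not> ?thesis"
  then have "a \<noteq> 0" "inverse a \<in> P" "b \<noteq> 0" "inverse b \<in> P"
    using unit assms by blast+
  then have "a * b * (inverse a * inverse b) \<in> nonunits P"
    using assms m_mult mult_mem by blast
  moreover have "a * b * (inverse a * inverse b) = 1"
    using \<open>a \<noteq> 0\<close> \<open>b \<noteq> 0\<close> by (simp add: field_simps)
  ultimately show False
    using one_notin_m by simp
qed

lemma m_add:
  assumes a: "a \<in> nonunits P" and b: "b \<in> nonunits P"
  shows "a + b \<in> nonunits P"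
proof (cases "a = 0 \<or> b = 0")
  case True
  then show ?thesis using a b by auto
next
  case False
  have "a \<in> L" "b \<in> L"
    using a b m_sub sub by blast+
  then have "a / b \<in> L" "a / b \<noteq> 0"
    using False subfld_divide[OF L] by auto
  then consider "a / b \<in> P" | "inverse (a / b) \<in> P"
    using cases by blast
  then show ?thesis
  proof cases
    case 1
    then have "b * (a / b + 1) \<in> nonunits P"
      using b by (intro m_mult add_mem one_mem)
    moreover have "b * (a / b + 1) = a + b"
      using False by (simp add: field_simps)
    ultimately show ?thesis by simp
  next
    case 2
    then have "a * (1 + inverse (a / b)) \<in> nonunits P"
      using a by (intro m_mult add_mem one_mem)
    moreover have "a * (1 + inverse (a / b)) = a + b"
      using False by (simp add: field_simps)
    ultimately show ?thesis by simp
  qed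
qed

lemma m_uminus: "a \<in> nonunits P \<Longrightarrow> - a \<in> nonunits P"
  using m_mult[of a "- 1"] uminus_mem[OF one_mem] by simp

lemma m_diff: "a \<in> nonunits P \<Longrightarrow> b \<in> nonunits P \<Longrightarrow> a - b \<in> nonunits P"
  using m_add[of a "- b"] m_uminus[of b] by simp

lemma m_sum: "(\<And>i. i \<in> A \<Longrightarrow> f i \<in> nonunits P) \<Longrightarrow> sum f A \<in> nonunits P"
  by (induction A rule: infinite_finite_induct) (auto intro: zero_m m_add)

lemma const_m_iff [simp]: "j s \<in> nonunits P \<longleftrightarrow> s = 0"
  using const_mem[of "inverse s"] const_mem[of s] by (auto simp: nonunits_def zero_mem)

lemma val_mem: "val j P z s \<Longrightarrow> z \<in> P"
  by (simp add: val_def)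

lemma val_m_iff: "val j P z s \<Longrightarrow> z \<in> nonunits P \<longleftrightarrow> s = 0"
proof
  assume v: "val j P z s"
  show "s = 0" if "z \<in> nonunits P"
  proof -
    have "z - (z - j s) \<in> nonunits P"
      by (rule m_diff) (use v that in \<open>auto simp: val_def\<close>)
    then show ?thesis by simp
  qed
  show "z \<in> nonunits P" if "s = 0"
    using v that by (simp add: val_def)
qed

lemma val_0_iff: "val j P z 0 \<longleftrightarrow> z \<in> nonunits P"
  by (auto simp: val_def m_sub)

lemma val_const: "val j P (j s) s"
  by (simp add: val_def const_mem zero_m)

lemma val_add:
  assumes "val j P z s" "val j P z' s'"
  shows "val j P (z + z') (s + s')"
proof -
  have "(z - j s) + (z' - j s') \<in> nonunits P"
    using assms by (intro m_add) (auto simp: val_def)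
  then show ?thesis
    using assms by (simp add: val_def add_mem algebra_simps)
qed

lemma val_mult:
  assumes "val j P z s" "val j P z' s'"
  shows "val j P (z * z') (s * s')"
proof -
  have "(z - j s) * z' + j s * (z' - j s') \<in> nonunits P"
    using assms const_mem by (intro m_add m_mult m_mult') (auto simp: val_def)
  then show ?thesis
    using assms by (simp add: val_def mult_mem algebra_simps)
qed

lemma val_uminus: "val j P z s \<Longrightarrow> val j P (- z) (- s)"
  using val_mult[OF val_const[of "- 1"]] by simp

lemma val_diff: "val j P z s \<Longrightarrow> val j P z' s' \<Longrightarrow> val j P (z - z') (s - s')"
  using val_add[of z s "- z'" "- s'"] val_uminus by simp

lemma val_unique: "val j P z s \<Longrightarrow> val j P z s' \<Longrightarrow> s = s'"
  using val_diff[of z s z s'] val_m_iff[of 0 "s - s'"] zero_m by simp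

lemma val_pev: "val j P z s \<Longrightarrow> val j P (pev j z p) (poly p s)"
proof (induction p)
  case 0
  show ?case using val_const[of 0] by simp
next
  case (pCons a p)
  then show ?case
    by (simp add: val_add val_mult val_const)
qed

lemma val_inverse:
  assumes v: "val j P z s" and s: "s \<noteq> 0"
  shows "val j P (inverse z) (inverse s)"
proof -
  have z: "z \<noteq> 0" "inverse z \<in> P"
    using unit[OF val_mem[OF v]] val_m_iff[OF v] s by auto
  have "(z - j s) * (- (inverse z * j (inverse s))) \<in> nonunits P"
    by (intro m_mult uminus_mem mult_mem const_mem) (use v z in \<open>auto simp: val_def\<close>)
  moreover have "(z - j s) * (- (inverse z * j (inverse s))) = inverse z - j (inverse s)"
    using z s by (simp add: field_simps)
  ultimately show ?thesis
    using z by (simp add: val_def)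
qed

lemma val_divide: "val j P z s \<Longrightarrow> val j P z' s' \<Longrightarrow> s' \<noteq> 0 \<Longrightarrow> val j P (z / z') (s / s')"
  using val_mult[OF _ val_inverse] by (simp add: field_class.field_divide_inverse)

end

text \<open>Up to a nonzero constant, p(z) is a product of factors z - b, and each is a unit of P
  when z has no residue in K.\<close>

lemma place_pev_unit:
  fixes j :: "'k::alg_closed_field \<Rightarrow> 'f::field"
  assumes "place j L P" and z: "z \<in> P" "\<And>s. z - j s \<notin> nonunits P" and "p \<noteq> 0"
  shows "pev j z p \<in> P - nonunits P"
proof -
  interpret place j L P by fact
  interpret e: ring_map "pev j z" by (rule ring_map_pev)
  show ?thesis
    using \<open>p \<noteq> 0\<close>
  proof (induction "degree p" arbitrary: p)
    case 0
    then obtain b where p: "p = [:b:]"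
      by (metis degree_0_id)
    then have "b \<noteq> 0"
      using "0.prems" by simp
    then show ?case
      by (simp add: p const_mem)
  next
    case (Suc n)
    then obtain a where "poly p a = 0"
      by (metis alg_closed_imp_poly_has_root zero_less_Suc)
    then obtain q where q: "p = [:- a, 1:] * q"
      by (auto simp: poly_eq_0_iff_dvd)
    then have "q \<noteq> 0"
      using Suc.prems by auto
    then have "degree p = Suc (degree q)"
      unfolding q by (subst degree_mult_eq) auto
    then have "n = degree q"
      using Suc.hyps(2) by linarith
    then have IH: "pev j z q \<in> P - nonunits P"
      using Suc.hyps(1) \<open>q \<noteq> 0\<close> by blast
    have "pev j z [:- a, 1:] = z - j a"
      by simp
    then have "pev j z p = (z - j a) * pev j z q"
      unfolding q e.mult by simp
    moreover have "z - j a \<in> P"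
      using z const_mem diff_mem by blast
    ultimately show ?case
      using IH z(2)[of a] m_prime[of "z - j a" "pev j z q"] mult_mem by auto
  qed
qed

locale function_field_in_one_variable = alg_closed_embedding j for j :: "'k::alg_closed_field \<Rightarrow> 'f::field" +
  fixes L t n
  assumes subfld_L: "subfld L" and range_L: "range j \<subseteq> L" and t: "t \<in> L" "t \<notin> range j"
    and dim: "vdim n (gen j t) L"
begin

lemma placeI: "P \<in> places j L \<Longrightarrow> place j L P"
  by unfold_locales (auto simp: subfld_L)

text \<open>Otherwise every nonzero polynomial in t would be a unit of P. For z outside P, multiply
  an equation of z over K[t] by the power d of y = 1/z: its top coefficient becomes a combination of
  positive powers of y, hence a nonunit, a contradiction.\<close>

lemma generator_value:
  assumes P: "P \<in> places j L" and tP: "t \<in> P"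
  shows "\<exists>s. val j P t s"
proof (rule ccontr)
  interpret place j L P using placeI[OF P] .
  assume "\<not> ?thesis"
  then have no: "t - j s \<notin> nonunits P" for s
    using tP by (auto simp: val_def)
  obtain z where z: "z \<in> L" "z \<notin> P"
    using P unfolding places_def by blast
  define y where "y = inverse z"
  have y: "y \<in> nonunits P"
    using inverse_m z by (simp add: y_def)
  have "z \<noteq> 0"
    using z zero_mem by auto
  obtain q where q: "\<exists>i\<in>{..n}. poly (q i) 0 \<noteq> 0" and rel: "(\<Sum>i\<le>n. pev j t (q i) * z ^ i) = 0"
    using gen_relation[OF t(2) dim, of "\<lambda>i. z ^ i"] z(1) subfld_L subfld_power by blast
  define I where "I = {i \<in> {..n}. q i \<noteq> 0}"
  define d where "d = Max I"
  have "finite I" "I \<noteq> {}"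
    using q by (auto simp: I_def)
  then have d: "d \<in> I" "\<And>i. i \<in> I \<Longrightarrow> i \<le> d"
    by (auto simp: d_def)
  have "(\<Sum>i\<le>n. pev j t (q i) * z ^ i) = (\<Sum>i\<le>d. pev j t (q i) * z ^ i)"
  proof (rule sum.mono_neutral_right)
    show "\<forall>i\<in>{..n} - {..d}. pev j t (q i) * z ^ i = 0"
      using d(2) by (force simp: I_def)
  qed (use d(1) in \<open>auto simp: I_def\<close>)
  then have "y ^ d * (\<Sum>i\<le>d. pev j t (q i) * z ^ i) = 0"
    using rel by simp
  also have "y ^ d * (\<Sum>i\<le>d. pev j t (q i) * z ^ i) = (\<Sum>i\<le>d. pev j t (q i) * y ^ (d - i))"
    unfolding sum_distrib_left
  proof (rule sum.cong)
    fix i assume "i \<in> {..d}"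
    then have "y ^ d = y ^ (d - i) * y ^ i"
      by (simp flip: power_add)
    then show "y ^ d * (pev j t (q i) * z ^ i) = pev j t (q i) * y ^ (d - i)"
      using \<open>z \<noteq> 0\<close> by (simp add: y_def field_simps)
  qed auto
  also have "\<dots> = (\<Sum>i<d. pev j t (q i) * y ^ (d - i)) + pev j t (q d)"
    by (simp flip: lessThan_Suc_atMost)
  finally have eq: "pev j t (q d) = - (\<Sum>i<d. pev j t (q i) * y ^ (d - i))"
    by (simp add: eq_neg_iff_add_eq_0 add.commute)
  have mem: "pev j t p \<in> P" for p
    using place_pev_unit[OF placeI[OF P] tP no, of p] zero_mem by (cases "p = 0") auto
  have "y ^ (d - i) \<in> nonunits P" if "i < d" for i
  proof -
    have "y * y ^ (d - i - 1) \<in> nonunits P"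
      using y m_sub by (intro m_mult power_mem) auto
    moreover have "d - i = Suc (d - i - 1)"
      using that by simp
    ultimately show ?thesis
      by (metis power_Suc)
  qed
  then have "pev j t (q d) \<in> nonunits P"
    unfolding eq using mem by (intro m_uminus m_sum m_mult') auto
  then show False
    using place_pev_unit[OF placeI[OF P] tP no, of "q d"] d(1) by (simp add: I_def)
qed

text \<open>Replace t by a generator t' of the same field that vanishes at P. A normalised relation
  between the powers of z over K[t'] reduces at P to a nonzero polynomial over K with a nonunit
  value at z, which \<open>place_pev_unit\<close> forbids if z has no residue.\<close>

lemma residue_field:
  assumes P: "P \<in> places j L" and z: "z \<in> P"
  shows "\<exists>s. val j P z s"
proof (rule ccontr)
  interpret place j L P using placeI[OF P] .
  assume "\<not> ?thesis"
  then have no: "z - j s \<notin> nonunits P" for s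
    using z by (auto simp: val_def)
  obtain t' where t': "t' \<in> nonunits P" "gen j t' = gen j t"
  proof (cases "t \<in> P")
    case True
    then obtain s where "val j P t s"
      using generator_value[OF P] by blast
    then show ?thesis
      using that[of "t - j s"] gen_diff by (simp add: val_def)
  next
    case False
    then show ?thesis
      using that[of "inverse t"] gen_inverse inverse_m t(1) by simp
  qed
  have "t' \<notin> range j"
  proof
    assume "t' \<in> range j"
    then have "gen j t' \<subseteq> range j"
      by (intro gen_subset subfld_range) auto
    then show False
      using t'(2) gen_mem[of t] t(2) by auto
  qed
  then obtain q where q: "\<exists>i\<in>{..n}. poly (q i) 0 \<noteq> 0" and rel: "(\<Sum>i\<le>n. pev j t' (q i) * z ^ i) = 0"
    using gen_relation[of t' n L "\<lambda>i. z ^ i"] t'(2) dim sub[OF z] subfld_L subfld_power by metis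
  define \<rho> where "\<rho> = (\<Sum>i\<le>n. monom (poly (q i) 0) i)"
  have coeff_\<rho>: "coeff \<rho> i = (if i \<le> n then poly (q i) 0 else 0)" for i
    unfolding \<rho>_def coeff_sum by (simp add: coeff_monom)
  have "\<rho> \<noteq> 0"
    using q coeff_\<rho> by (metis atMost_iff coeff_0)
  have "degree \<rho> \<le> n"
    by (rule degree_le) (simp add: coeff_\<rho>)
  have "pev j z \<rho> = (\<Sum>i\<le>n. j (poly (q i) 0) * z ^ i)"
    unfolding pev_eq_sum[OF \<open>degree \<rho> \<le> n\<close>] by (rule sum.cong) (auto simp: coeff_\<rho>)
  also have "\<dots> = - (\<Sum>i\<le>n. (pev j t' (q i) - j (poly (q i) 0)) * z ^ i)"
    using rel by (simp add: algebra_simps sum_subtractf)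
  also have "\<dots> \<in> nonunits P"
  proof (intro m_uminus m_sum m_mult power_mem z)
    fix i
    have "val j P (pev j t' (q i)) (poly (q i) 0)"
      using t'(1) by (intro val_pev) (simp add: val_0_iff)
    then show "pev j t' (q i) - j (poly (q i) 0) \<in> nonunits P"
      by (simp add: val_def)
  qed
  finally show False
    using place_pev_unit[OF placeI[OF P] z no \<open>\<rho> \<noteq> 0\<close>] by simp
qed

text \<open>K is infinite, so some s differs from the finitely many residues of z on Z. Then 1/(z -
  s) is regular on Z and its zeros there are the poles of z.\<close>

lemma regular_moebius:
  assumes Z: "finite Z" "Z \<subseteq> places j L" and z: "z \<in> L"
  obtains s where "z \<noteq> j s" "\<And>P. P \<in> Z \<Longrightarrow> inverse (z - j s) \<in> P"
    "\<And>P. P \<in> Z \<Longrightarrow> inverse (z - j s) \<in> nonunits P \<longleftrightarrow> z \<notin> P"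
proof -
  \<comment> \<open>At a pole of z the choice operator returns an arbitrary value, which does no
    harm since any s works there. The second set has at most one element and keeps z - s
    nonzero.\<close>
  define B where "B = (\<lambda>P. SOME s. val j P z s) ` Z \<union> {s. z = j s}"
  have "{s. z = j s} \<subseteq> {THE s. z = j s}"
    by auto
  then have "finite B"
    unfolding B_def using Z(1) finite_subset by blast
  then obtain s where s: "s \<notin> B"
    using infinite_alg_closed_UNIV[where 'k = 'k] ex_new_if_finite by blast
  have ne: "z \<noteq> j s"
    using s by (auto simp: B_def)
  have "inverse (z - j s) \<in> P \<and> (inverse (z - j s) \<in> nonunits P \<longleftrightarrow> z \<notin> P)" if PZ: "P \<in> Z" for P
  proof -
    have P: "P \<in> places j L"
      using PZ Z by blast
    interpret place j L P using placeI[OF P] .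
    show ?thesis
    proof (cases "z \<in> P")
      case True
      define r where "r = (SOME s. val j P z s)"
      have r: "val j P z r"
        unfolding r_def using residue_field[OF P True] by (rule someI_ex)
      have "r \<noteq> s"
        using s PZ by (auto simp: B_def r_def)
      have v: "val j P (inverse (z - j s)) (inverse (r - s))"
        using \<open>r \<noteq> s\<close> by (intro val_inverse val_diff r val_const) auto
      then show ?thesis
        using val_mem[OF v] val_m_iff[OF v] True \<open>r \<noteq> s\<close> by simp
    next
      case False
      then have "z - j s \<notin> P"
        using add_mem[of "z - j s" "j s"] const_mem by auto
      then have "inverse (z - j s) \<in> nonunits P"
        using z range_L subfld_L by (intro inverse_m subfld_diff) auto
      then show ?thesis
        using False m_sub by blast
    qed
  qed
  then show ?thesis
    using that ne by blast
qed

text \<open>Shift z in Q by its residue into the maximal ideal of Q. If the result were outside P,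
  its inverse would lie in P and hence in Q, which is impossible for a nonunit.\<close>

lemma places_incomparable:
  assumes P: "P \<in> places j L" and Q: "Q \<in> places j L" and "P \<subseteq> Q"
  shows "P = Q"
proof -
  interpret P: place j L P using placeI[OF P] .
  interpret Q: place j L Q using placeI[OF Q] .
  have "z \<in> P" if zQ: "z \<in> Q" for z
  proof -
    obtain s where s: "z - j s \<in> nonunits Q"
      using residue_field[OF Q zQ] by (auto simp: val_def)
    have "z - j s \<in> P"
    proof (rule ccontr)
      assume n: "z - j s \<notin> P"
      have "z - j s \<noteq> 0"
        using n P.zero_mem by metis
      moreover have "inverse (z - j s) \<in> P"
        using n P.cases[of "z - j s"] Q.sub[OF Q.m_sub[OF s]] calculation by blast
      ultimately show False
        using s \<open>P \<subseteq> Q\<close> unfolding nonunits_def by blast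
    qed
    then show ?thesis
      using P.add_mem[OF _ P.const_mem[of s]] by fastforce
  qed
  then show ?thesis
    using \<open>P \<subseteq> Q\<close> by blast
qed

text \<open>For each Q other than P take z in P but not in Q: its Moebius transform vanishes at Q,
  does not vanish at P, and is regular on Z. The product over all such Q separates P.\<close>

lemma separating_function:
  assumes Z: "finite Z" "Z \<subseteq> places j L" and P: "P \<in> Z"
  shows "\<exists>e\<in>L. \<forall>Q\<in>Z. e \<in> Q \<and> (e \<in> nonunits Q \<longleftrightarrow> Q \<noteq> P)"
proof -
  have "\<exists>e\<in>L. (\<forall>R\<in>Z. e \<in> R) \<and> e \<notin> nonunits P \<and> e \<in> nonunits Q" if Q: "Q \<in> Z - {P}" for Q
  proof -
    have "\<not> P \<subseteq> Q"
      using places_incomparable[of P Q] Z P Q by blast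
    then obtain z where z: "z \<in> P" "z \<notin> Q"
      by blast
    have "z \<in> L"
      using place.sub[OF placeI, of P z] Z P z by blast
    obtain s where s: "z \<noteq> j s" "\<And>P. P \<in> Z \<Longrightarrow> inverse (z - j s) \<in> P"
        "\<And>P. P \<in> Z \<Longrightarrow> inverse (z - j s) \<in> nonunits P \<longleftrightarrow> z \<notin> P"
      using regular_moebius[OF Z \<open>z \<in> L\<close>] by blast
    have "inverse (z - j s) \<in> L"
      using \<open>z \<in> L\<close> range_L subfld_L by (intro subfld_inverse subfld_diff) auto
    then show ?thesis
      using s z P Q by blast
  qed
  then obtain e where e: "\<And>Q. Q \<in> Z - {P} \<Longrightarrow> e Q \<in> L" "\<And>Q R. Q \<in> Z - {P} \<Longrightarrow> R \<in> Z \<Longrightarrow> e Q \<in> R"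
      "\<And>Q. Q \<in> Z - {P} \<Longrightarrow> e Q \<notin> nonunits P" "\<And>Q. Q \<in> Z - {P} \<Longrightarrow> e Q \<in> nonunits Q"
    by metis
  have prod_mem: "(\<Prod>Q\<in>A. e Q) \<in> R" if "R \<in> Z" "A \<subseteq> Z - {P}" for A R
  proof -
    interpret R: place j L R using placeI Z that by blast
    have "finite A"
      using that Z(1) finite_subset by blast
    then show ?thesis
      using that(2) by (induction A) (auto intro: R.one_mem R.mult_mem e(2)[OF _ that(1)])
  qed
  have P': "P \<in> places j L"
    using P Z by blast
  interpret P: place j L P using placeI[OF P'] .
  let ?e = "\<Prod>Q\<in>Z - {P}. e Q"
  have "?e \<in> nonunits Q \<longleftrightarrow> Q \<noteq> P" if "Q \<in> Z" for Q
  proof (cases "Q = P")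
    case True
    have "(\<Prod>Q\<in>A. e Q) \<notin> nonunits P" if "A \<subseteq> Z - {P}" for A
    proof -
      have "finite A"
        using that Z(1) finite_subset by blast
      then show ?thesis
        using that
      proof (induction A)
        case (insert Q A)
        then have "e Q \<in> P" "(\<Prod>Q\<in>A. e Q) \<in> P" "e Q \<notin> nonunits P"
          using e P prod_mem[OF P, of A] by auto
        then show ?case
          using insert P.m_prime by auto
      qed (simp add: P.one_notin_m)
    qed
    then show ?thesis
      using True by blast
  next
    case False
    then have Q: "Q \<in> Z - {P}"
      using \<open>Q \<in> Z\<close> by simp
    interpret Q: place j L Q using placeI Z Q by blast
    have "?e = e Q * (\<Prod>Q\<in>Z - {P} - {Q}. e Q)"
      using Q Z(1) by (subst prod.remove[of _ Q]) auto
    then have "?e \<in> nonunits Q"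
      using Q.m_mult[OF e(4)[OF Q] prod_mem[OF \<open>Q \<in> Z\<close>, of "Z - {P} - {Q}"]] by auto
    then show ?thesis
      using False by blast
  qed
  moreover have "?e \<in> Q" if "Q \<in> Z" for Q
    using prod_mem[OF that] by blast
  moreover have "?e \<in> L"
    using prod_mem[OF P] P.sub by blast
  ultimately show ?thesis by blast
qed

text \<open>A relation between separating functions with coefficients in \<open>K[w]\<close>, not all vanishing at
  \<open>w = 0\<close>, fails at one of the zeros of \<open>w\<close>.\<close>

lemma card_zeros_le_degree:
  assumes w: "w \<in> L" "w \<notin> range j" and dim: "vdim m (gen j w) L"
    and Z: "finite Z" "Z \<subseteq> places j L" "\<And>P. P \<in> Z \<Longrightarrow> w \<in> nonunits P"
  shows "card Z \<le> m"
proof (rule ccontr)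
  assume "\<not> ?thesis"
  then have "card {..m} \<le> card Z"
    by simp
  \<comment> \<open>There are m + 1 distinct zeros of w. The functions e i, each nonzero at exactly
    one of them, satisfy a relation over K(w) because the dimension is m.\<close>
  then obtain f where f: "f ` {..m} \<subseteq> Z" "inj_on f {..m}"
    using card_le_inj[of "{..m}" Z] Z(1) by auto
  have fZ: "finite (f ` {..m})" "f ` {..m} \<subseteq> places j L"
    using f Z by auto
  have "\<forall>i\<in>{..m}. \<exists>e\<in>L. \<forall>Q\<in>f ` {..m}. e \<in> Q \<and> (e \<in> nonunits Q \<longleftrightarrow> Q \<noteq> f i)"
    using separating_function[OF fZ] by blast
  then obtain e where e: "\<And>i. i \<le> m \<Longrightarrow> e i \<in> L"
    "\<And>i k. i \<le> m \<Longrightarrow> k \<le> m \<Longrightarrow> e i \<in> f k \<and> (e i \<in> nonunits (f k) \<longleftrightarrow> f k \<noteq> f i)"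
    by (metis atMost_iff imageI)
  obtain q i0 where i0: "i0 \<le> m" "poly (q i0) 0 \<noteq> 0" and rel: "(\<Sum>i\<le>m. pev j w (q i) * e i) = 0"
    using gen_relation[OF w(2) dim, of e] e(1) by auto
  have P: "f i0 \<in> places j L" and wP: "w \<in> nonunits (f i0)"
    using fZ f i0 Z by auto
  interpret place j L "f i0" using placeI[OF P] .
  have v: "val j (f i0) (pev j w (q i)) (poly (q i) 0)" for i
    using wP by (intro val_pev) (simp add: val_0_iff)
  have "(\<Sum>i\<le>m. pev j w (q i) * e i) = pev j w (q i0) * e i0 + (\<Sum>i\<in>{..m} - {i0}. pev j w (q i) * e i)"
    using i0 by (subst sum.remove[of _ i0]) auto
  then have "pev j w (q i0) * e i0 = - (\<Sum>i\<in>{..m} - {i0}. pev j w (q i) * e i)"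
    using rel by (simp add: eq_neg_iff_add_eq_0)
  also have "\<dots> \<in> nonunits (f i0)"
  proof (intro m_uminus m_sum m_mult' val_mem[OF v])
    fix i assume "i \<in> {..m} - {i0}"
    then show "e i \<in> nonunits (f i0)"
      using e(2)[of i i0] f(2) i0(1) by (auto dest: inj_onD)
  qed
  finally have "pev j w (q i0) \<in> nonunits (f i0) \<or> e i0 \<in> nonunits (f i0)"
    using m_prime val_mem[OF v] e(2)[OF i0(1) i0(1)] by blast
  then show False
    using val_m_iff[OF v] i0 e(2)[OF i0(1) i0(1)] by blast
qed

text \<open>Meant for 1/t and t - s, which generate the same field as t, so that n bounds their
  numbers of zeros.\<close>

lemma finite_zeros_generator:
  assumes "w \<in> L" "gen j w = gen j t"
  shows "finite {P \<in> places j L. w \<in> nonunits P}"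
proof (rule finite_if_finite_subsets_card_bdd[of _ n, THEN conjunct1])
  fix Z assume Z: "Z \<subseteq> {P \<in> places j L. w \<in> nonunits P}" "finite Z"
  have "w \<notin> range j"
  proof
    assume "w \<in> range j"
    then have "gen j w \<subseteq> range j"
      by (intro gen_subset subfld_range) auto
    then show False
      using assms(2) gen_mem[of t] t(2) by auto
  qed
  then show "card Z \<le> n"
    using card_zeros_le_degree[OF assms(1) _ _ Z(2)] assms(2) dim Z(1) by auto
qed

text \<open>Divide an equation of z over K[t] by the lowest power of z that occurs. Its constant
  term q_d(t) then vanishes wherever z does and t is regular; so at a zero of z, t has a pole or
  takes one of the finitely many roots of q_d as value.\<close>

lemma finite_zeros:
  assumes z: "z \<in> L" "z \<noteq> 0"
  shows "finite {P \<in> places j L. z \<in> nonunits P}"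
proof -
  obtain q where q: "\<exists>i\<in>{..n}. poly (q i) 0 \<noteq> 0" and rel: "(\<Sum>i\<le>n. pev j t (q i) * z ^ i) = 0"
    using gen_relation[OF t(2) dim, of "\<lambda>i. z ^ i"] z(1) subfld_L subfld_power by blast
  define I where "I = {i \<in> {..n}. q i \<noteq> 0}"
  define d where "d = Min I"
  have "finite I" "I \<noteq> {}"
    using q by (auto simp: I_def)
  then have d: "d \<in> I" "\<And>i. i \<in> I \<Longrightarrow> d \<le> i"
    by (auto simp: d_def)
  have "(\<Sum>i\<le>n. pev j t (q i) * z ^ i) = (\<Sum>i\<in>I. pev j t (q i) * z ^ i)"
    by (rule sum.mono_neutral_right) (auto simp: I_def)
  also have "\<dots> = z ^ d * (\<Sum>i\<in>I. pev j t (q i) * z ^ (i - d))"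
    unfolding sum_distrib_left
  proof (rule sum.cong)
    fix i assume "i \<in> I"
    then have "z ^ i = z ^ d * z ^ (i - d)"
      using d(2) by (simp flip: power_add)
    then show "pev j t (q i) * z ^ i = z ^ d * (pev j t (q i) * z ^ (i - d))"
      by (simp add: mult.left_commute)
  qed auto
  finally have "(\<Sum>i\<in>I. pev j t (q i) * z ^ (i - d)) = 0"
    using rel z by simp
  then have "pev j t (q d) + (\<Sum>i\<in>I - {d}. pev j t (q i) * z ^ (i - d)) = 0"
    using d(1) \<open>finite I\<close> by (subst (asm) sum.remove[of _ d]) auto
  then have eq: "pev j t (q d) = - (\<Sum>i\<in>I - {d}. pev j t (q i) * z ^ (i - d))"
    by (simp add: eq_neg_iff_add_eq_0)
  let ?R = "{s. poly (q d) s = 0}"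
  have "{P \<in> places j L. z \<in> nonunits P} \<subseteq>
      {P \<in> places j L. inverse t \<in> nonunits P} \<union>
      (\<Union>s\<in>?R. {P \<in> places j L. t - j s \<in> nonunits P})"
  proof
    fix P assume "P \<in> {P \<in> places j L. z \<in> nonunits P}"
    then have P: "P \<in> places j L" and zP: "z \<in> nonunits P"
      by auto
    interpret place j L P using placeI[OF P] .
    show "P \<in> {P \<in> places j L. inverse t \<in> nonunits P} \<union>
      (\<Union>s\<in>?R. {P \<in> places j L. t - j s \<in> nonunits P})"
    proof (cases "t \<in> P")
      case False
      then show ?thesis
        using P inverse_m t(1) by blast
    next
      case True
      then obtain s where s: "val j P t s"
        using residue_field P by blast
      have "z ^ (i - d) \<in> nonunits P" if "i \<in> I - {d}" for i
      proof -
        have "d < i"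
          using d(2)[of i] that by auto
        then have "i - d = Suc (i - d - 1)"
          by simp
        moreover have "z * z ^ (i - d - 1) \<in> nonunits P"
          using zP m_sub by (intro m_mult power_mem) auto
        ultimately show ?thesis
          by (metis power_Suc)
      qed
      then have "pev j t (q d) \<in> nonunits P"
        unfolding eq using val_mem[OF val_pev[OF s]] by (intro m_uminus m_sum m_mult') auto
      then have "poly (q d) s = 0"
        using val_m_iff[OF val_pev[OF s]] by blast
      then show ?thesis
        using P s by (auto simp: val_def)
    qed
  qed
  moreover have "finite {P \<in> places j L. inverse t \<in> nonunits P}"
    by (rule finite_zeros_generator) (use t subfld_L in \<open>auto intro: subfld_inverse simp: gen_inverse\<close>)
  moreover have "finite {P \<in> places j L. t - j s \<in> nonunits P}" for s
    by (rule finite_zeros_generator)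
       (use t subfld_L range_L in \<open>auto intro!: subfld_diff simp: gen_diff\<close>)
  moreover have "finite ?R"
    using d(1) by (intro poly_roots_finite) (simp add: I_def)
  ultimately show ?thesis
    by (meson finite_UN_I finite_UnI finite_subset)
qed

end

section \<open>The degree of a difference of conjugate functions\<close>

definition swap_vars :: "'k::comm_ring_1 poly poly \<Rightarrow> 'k poly poly" where
  "swap_vars = ev2 (\<lambda>a. [:[:a:]:]) [:[:0, 1:]:] [:0, 1:]"

lemma ring_map_const2: "ring_map (\<lambda>a. [:[:a:]:])"
  using ring_map_comp[OF ring_map_const_poly ring_map_const_poly] .

lemma ring_map_swap_vars: "ring_map swap_vars"
  unfolding swap_vars_def by (rule ring_map.ring_map_ev2[OF ring_map_const2])

lemma coeff_swap_vars: "coeff (coeff (swap_vars p) m) i = coeff (coeff p i) m"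
proof (induction p arbitrary: i)
  case 0
  show ?case by (simp add: swap_vars_def)
next
  case (pCons q p)
  interpret c: ring_map "\<lambda>a :: 'a. [:[:a:]:]" by (rule ring_map_const2)
  have "pev (\<lambda>a. [:[:a:]:]) [:0, 1:] q = map_poly (\<lambda>a. [:a:]) q"
    by (induction q) (auto simp: map_poly_pCons)
  then have "swap_vars (pCons q p) = map_poly (\<lambda>a. [:a:]) q + [:[:0, 1:]:] * swap_vars p"
    by (simp add: swap_vars_def c.ev2_pCons)
  then have "coeff (swap_vars (pCons q p)) m = pCons (coeff q m) (coeff (swap_vars p) m)"
    by (simp add: coeff_map_poly)
  then show ?case
    using pCons.IH by (simp add: coeff_pCons split: nat.split)
qed

lemma swap_vars_swap_vars [simp]: "swap_vars (swap_vars p) = p"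
  by (intro poly_eqI) (simp add: coeff_swap_vars)

lemma degree_coeff_le_swap_vars: "degree (coeff p i) \<le> degree (swap_vars p)"
proof (rule degree_le, intro allI impI)
  fix m assume "degree (swap_vars p) < m"
  then have "coeff (coeff (swap_vars p) m) i = 0"
    by (simp add: coeff_eq_0)
  then show "coeff (coeff p i) m = 0"
    by (simp add: coeff_swap_vars)
qed

lemma (in ring_map) ev2_swap_vars: "ev2 \<phi> x c (swap_vars p) = ev2 \<phi> c x p"
proof -
  interpret e: ring_map "ev2 \<phi> x c" by (rule ring_map_ev2)
  show ?thesis
    unfolding swap_vars_def
    by (subst ring_map.comp_ev2[OF ring_map_const2 ring_map_ev2]) simp
qed

text \<open>A form of Gauss's lemma. By \<open>prim\<close>, R is nonzero modulo every linear
  polynomial in the inner variable, so each linear factor of l divides all coefficients of Q and can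
  be cancelled.\<close>

lemma primitive_dvd:
  fixes R S Q :: "'k::alg_closed_field poly poly"
  assumes prim: "\<And>\<alpha>. map_poly (\<lambda>r. poly r \<alpha>) R \<noteq> 0" and "[:l:] * S = R * Q" "l \<noteq> 0"
  shows "R dvd S"
  using assms(2,3)
proof (induction "degree l" arbitrary: l Q)
  case 0
  then obtain b where b: "l = [:b:]"
    by (metis degree_0_id)
  then have "b \<noteq> 0"
    using 0 by auto
  then have "[:[:inverse b:]:] * [:l:] = 1"
    by (simp add: b one_pCons)
  then have "S = [:[:inverse b:]:] * ([:l:] * S)"
    by (metis mult.assoc mult_1)
  then have "S = R * ([:[:inverse b:]:] * Q)"
    unfolding "0.prems"(1) by (metis mult.left_commute)
  then show ?case
    by (rule dvdI)
next
  case (Suc n)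
  then obtain \<alpha> where "poly l \<alpha> = 0"
    by (metis alg_closed_imp_poly_has_root zero_less_Suc)
  then obtain l' where l': "l = [:- \<alpha>, 1:] * l'"
    by (auto simp: poly_eq_0_iff_dvd)
  then have "l' \<noteq> 0"
    using Suc.prems by auto
  then have "degree l = Suc (degree l')"
    unfolding l' by (subst degree_mult_eq) auto
  then have n: "n = degree l'"
    using Suc.hyps(2) by linarith
  interpret r: ring_map "map_poly (\<lambda>r. poly r \<alpha>)"
    by (rule ring_map_map_poly[OF ring_map_poly])
  have "map_poly (\<lambda>r. poly r \<alpha>) [:l:] = 0"
    using \<open>poly l \<alpha> = 0\<close> by (simp add: map_poly_pCons)
  then have "map_poly (\<lambda>r. poly r \<alpha>) R * map_poly (\<lambda>r. poly r \<alpha>) Q = 0"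
    using arg_cong[OF Suc.prems(1), of "map_poly (\<lambda>r. poly r \<alpha>)"] unfolding r.mult by simp
  then have Q0: "map_poly (\<lambda>r. poly r \<alpha>) Q = 0"
    using prim by simp
  have "[:- \<alpha>, 1:] dvd coeff Q i" for i
    using arg_cong[OF Q0, of "\<lambda>p. coeff p i"] by (simp add: coeff_map_poly poly_eq_0_iff_dvd)
  then have "[:[:- \<alpha>, 1:]:] dvd Q"
    by (simp add: const_poly_dvd_iff)
  then obtain Q' where Q': "Q = [:[:- \<alpha>, 1:]:] * Q'"
    by (rule dvdE)
  have "[:[:- \<alpha>, 1:]:] * ([:l':] * S) = [:l:] * S"
    unfolding l' by (simp add: smult_smult)
  also have "\<dots> = [:[:- \<alpha>, 1:]:] * (R * Q')"
    unfolding Suc.prems(1) Q' by (simp only: mult.left_commute)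
  finally have "[:l':] * S = R * Q'"
    by (subst (asm) mult_cancel_left) auto
  then show ?case
    using Suc.hyps(1)[OF n _ \<open>l' \<noteq> 0\<close>] by blast
qed

context alg_closed_embedding
begin

text \<open>
  The relations between \<open>h\<close> and \<open>g\<close> form a principal ideal; the generator has the least degree in
  each of the two variables, hence bidegree at most \<open>(e, e)\<close> when the relations are symmetric.
\<close>

lemma symmetric_relation:
  assumes h: "h \<notin> range j" and dim: "vdim e (gen j h) E" and E: "\<And>i. g ^ i \<in> E"
    and sym: "\<And>p. ev2 j g h p = 0 \<Longrightarrow> ev2 j h g p = 0"
  obtains R where "R \<noteq> 0" "ev2 j g h R = 0" "degree R \<le> e" "degree (swap_vars R) \<le> e"
proof -
  interpret ev: ring_map "ev2 j g h" by (rule ring_map_ev2)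
  interpret sw: ring_map "swap_vars :: 'k poly poly \<Rightarrow> _" by (rule ring_map_swap_vars)
  define I where "I = {p. p \<noteq> 0 \<and> ev2 j g h p = 0}"
  obtain q i0 where i0: "i0 \<le> e" "poly (q i0) 0 \<noteq> 0" and rel: "(\<Sum>i\<le>e. pev j h (q i) * g ^ i) = 0"
    using gen_relation[OF h dim, of "\<lambda>i. g ^ i"] E by auto
  define S where "S = (\<Sum>i\<le>e. monom (q i) i)"
  have coeff_S: "coeff S i = (if i \<le> e then q i else 0)" for i
    unfolding S_def coeff_sum by (simp add: coeff_monom)
  have "degree S \<le> e"
    by (rule degree_le) (simp add: coeff_S)
  have "S \<noteq> 0"
    using coeff_S[of i0] i0 by auto
  have "ev2 j g h S = (\<Sum>i\<le>e. pev j h (q i) * g ^ i)"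
    unfolding ev2_def ring_map.pev_eq_sum[OF ring_map_pev \<open>degree S \<le> e\<close>]
    by (rule sum.cong) (auto simp: coeff_S)
  then have S: "S \<in> I"
    using rel \<open>S \<noteq> 0\<close> by (simp add: I_def)
  obtain R0 where R0: "R0 \<in> I" "\<And>p. p \<in> I \<Longrightarrow> degree R0 \<le> degree p"
    using ex_has_least_nat[of "\<lambda>p. p \<in> I" S degree] S by blast
  \<comment> \<open>Least outer degree first, then least inner degree. A common factor of the
    coefficients could be cancelled, against the second choice, so R is primitive.\<close>
  obtain R where R: "R \<in> I" "degree R = degree R0"
    and Rmin: "\<And>p. p \<in> I \<Longrightarrow> degree p = degree R0 \<Longrightarrow> degree (swap_vars R) \<le> degree (swap_vars p)"
    using ex_has_least_nat[of "\<lambda>p. p \<in> I \<and> degree p = degree R0" R0 "\<lambda>p. degree (swap_vars p)"] R0 by blast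
  have prim: "map_poly (\<lambda>r. poly r \<alpha>) R \<noteq> 0" for \<alpha>
  proof
    assume 0: "map_poly (\<lambda>r. poly r \<alpha>) R = 0"
    have "[:- \<alpha>, 1:] dvd coeff R i" for i
      using arg_cong[OF 0, of "\<lambda>p. coeff p i"] by (simp add: coeff_map_poly poly_eq_0_iff_dvd)
    then have "[:[:- \<alpha>, 1:]:] dvd R"
      by (simp add: const_poly_dvd_iff)
    then obtain R' where R': "R = [:[:- \<alpha>, 1:]:] * R'"
      by (rule dvdE)
    have "R' \<noteq> 0"
      using R' R(1) by (auto simp: I_def)
    have "ev2 j g h R = (h - j \<alpha>) * ev2 j g h R'"
      unfolding R' ev.mult by simp
    moreover have "h - j \<alpha> \<noteq> 0"
      using h by auto
    ultimately have "R' \<in> I"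
      using R(1) \<open>R' \<noteq> 0\<close> by (simp add: I_def)
    moreover have "degree R' = degree R0"
      using R(2) unfolding R' by (simp add: degree_mult_eq)
    ultimately have "degree (swap_vars R) \<le> degree (swap_vars R')"
      using Rmin by blast
    moreover have "swap_vars [:[:- \<alpha>, 1:]:] = ([:[:- \<alpha>:], 1:] :: 'k poly poly)"
      by (intro poly_eqI) (auto simp: coeff_swap_vars coeff_pCons split: nat.split)
    then have "swap_vars R = [:[:- \<alpha>:], 1:] * swap_vars R'"
      unfolding R' sw.mult by simp
    moreover have "swap_vars R' \<noteq> 0"
      using \<open>R' \<noteq> 0\<close> swap_vars_swap_vars[of R'] by (metis sw.zero)
    ultimately show False
      by (simp add: degree_mult_eq del: mult_pCons_left)
  qed
  have dvd: "R dvd p" if p: "ev2 j g h p = 0" for p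
  proof -
    have "R \<noteq> 0"
      using R(1) by (simp add: I_def)
    define l where "l = coeff R (degree R) ^ (Suc (degree p) - degree R)"
    obtain s r where "pseudo_divmod p R = (s, r)"
      by (cases "pseudo_divmod p R")
    from pseudo_divmod[OF \<open>R \<noteq> 0\<close> this]
    have d: "smult l p = R * s + r" "r = 0 \<or> degree r < degree R"
      unfolding l_def by auto
    have "[:l:] * p = R * s + r"
      using d(1) by simp
    from arg_cong[OF this, of "ev2 j g h"] have "ev2 j g h r = 0"
      unfolding ev.mult ev.add using p R(1) by (simp add: I_def)
    then have "r = 0"
      using d(2) R0(2)[of r] R(2) unfolding I_def by (metis (mono_tags, lifting) leD mem_Collect_eq)
    then have "[:l:] * p = R * s"
      using d(1) by simp
    moreover have "l \<noteq> 0"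
      using \<open>R \<noteq> 0\<close> by (simp add: l_def)
    ultimately show ?thesis
      using primitive_dvd[OF prim] by blast
  qed
  \<comment> \<open>S bounds the outer degree of R by e. By \<open>sym\<close> its mirror image is a
    relation too, hence a multiple of R, and this bounds the inner degree by e as well.\<close>
  have "ev2 j g h (swap_vars S) = 0"
    using sym[of S] S by (simp add: ev2_swap_vars I_def)
  then obtain Q where Q: "swap_vars S = R * Q"
    using dvd by blast
  have "S = swap_vars R * swap_vars Q"
    using arg_cong[OF Q, of swap_vars] by simp
  then have "degree (swap_vars R) \<le> degree S"
    using \<open>S \<noteq> 0\<close> by (metis dvd_imp_degree_le dvd_triv_left)
  moreover have "degree R \<le> degree S"
    using R(2) R0(2)[OF S] by simp
  ultimately show ?thesis
    using that[of R] R(1) \<open>degree S \<le> e\<close> by (simp add: I_def)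
qed

text \<open>The substitution is R(X - W, X) with X outer and W inner, coming from g = h - w. A
  monomial of degrees i and k contributes at most i + k to the degree in X.\<close>

lemma degree_shift_le:
  fixes R :: "'k poly poly"
  shows "degree (ev2 (\<lambda>a. [:[:a:]:]) [:[:0, - 1:], 1:] [:0, 1:] R) \<le> degree R + degree (swap_vars R)"
proof -
  interpret c: ring_map "\<lambda>a :: 'k. [:[:a:]:]" by (rule ring_map_const2)
  have deg: "degree (pev (\<lambda>a. [:[:a:]:]) [:0, 1:] q) \<le> degree q" for q :: "'k poly"
  proof -
    have "pev (\<lambda>a. [:[:a:]:]) [:0, 1:] q = map_poly (\<lambda>a. [:a:]) q"
      by (induction q) (auto simp: map_poly_pCons)
    then show ?thesis
      by (auto intro!: degree_le simp: coeff_map_poly coeff_eq_0)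
  qed
  have "ev2 (\<lambda>a. [:[:a:]:]) [:[:0, - 1:], 1:] [:0, 1:] R =
     (\<Sum>i\<le>degree R. pev (\<lambda>a. [:[:a:]:]) [:0, 1:] (coeff R i) * [:[:0, - 1:], 1:] ^ i)"
    unfolding ev2_def by (rule ring_map.pev_eq_sum[OF c.ring_map_pev order.refl])
  also have "degree \<dots> \<le> degree R + degree (swap_vars R)"
  proof (rule degree_sum_le)
    fix i assume "i \<in> {..degree R}"
    have "degree ([:[:0, - 1:], 1:] ^ i :: 'k poly poly) = i"
      by (simp add: degree_power_eq)
    then have "degree (pev (\<lambda>a. [:[:a:]:]) [:0, 1:] (coeff R i) * [:[:0, - 1:], 1:] ^ i) \<le>
        degree (coeff R i) + i"
      using degree_mult_le[of "pev (\<lambda>a. [:[:a:]:]) [:0, 1:] (coeff R i)" "[:[:0, - 1:], 1:] ^ i"]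
        deg[of "coeff R i"] by simp
    also have "\<dots> \<le> degree R + degree (swap_vars R)"
      using degree_coeff_le_swap_vars[of R i] \<open>i \<in> {..degree R}\<close> by simp
    finally show "degree (pev (\<lambda>a. [:[:a:]:]) [:0, 1:] (coeff R i) * [:[:0, - 1:], 1:] ^ i) \<le>
        degree R + degree (swap_vars R)" .
  qed auto
  finally show ?thesis .
qed

text \<open>The algebraic form of the fact that poles of h - g are poles of h or of g. The relation
  R of bidegree at most (e, e) becomes, after g = h - w, an equation for h over K(w) of degree at
  most 2e.\<close>

lemma degree_difference:
  assumes h: "h \<notin> range j" and w: "h - g \<notin> range j" and dim: "vdim e (gen j h) (gen2 j h (h - g))"
    and sym: "\<And>p. ev2 j g h p = 0 \<Longrightarrow> ev2 j h g p = 0"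
  shows "\<exists>m \<le> 2 * e. vdim m (gen j (h - g)) (gen2 j h (h - g))"
proof -
  define w where "w = h - g"
  note w = w[folded w_def] and dim = dim[folded w_def]
  have "h - w \<in> gen2 j h w"
    by (intro subfld_diff subfld_gen2 gen2_mem)
  then have "g ^ i \<in> gen2 j h w" for i
    using subfld_power[OF subfld_gen2] by (simp add: w_def)
  then obtain R where R: "R \<noteq> 0" "ev2 j g h R = 0" "degree R \<le> e" "degree (swap_vars R) \<le> e"
    by (rule symmetric_relation[OF h dim _ sym])
  interpret c: ring_map "\<lambda>a :: 'k. [:[:a:]:]" by (rule ring_map_const2)
  define T where "T = ev2 (\<lambda>a. [:[:a:]:]) [:[:0, - 1:], 1:] [:0, 1:] R"
  have "degree T \<le> 2 * e"
    using degree_shift_le[of R] R unfolding T_def by linarith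
  have T0: "ev2 j h w T = 0"
  proof -
    interpret p: ring_map "pev j w" by (rule ring_map_pev)
    have "ev2 j h w T = ev2 j (h - w) h R"
      unfolding T_def by (subst c.comp_ev2[OF ring_map_ev2]) (simp add: ev2_pCons)
    then show ?thesis
      using R(2) by (simp add: w_def)
  qed
  have "T \<noteq> 0"
  proof
    assume "T = 0"
    \<comment> \<open>the substitution \<open>(X, W) \<mapsto> (X, X - Y)\<close> recovers \<open>R\<close> from \<open>T\<close>\<close>
    have "ev2 (\<lambda>a. [:[:a:]:]) [:[:0, 1:]:] [:[:0, 1:], - 1:] T = R"
    proof -
      interpret p: ring_map "pev (\<lambda>a :: 'k. [:[:a:]:]) [:[:0, 1:], - 1:]"
        by (rule c.ring_map_pev)
      have "ev2 (\<lambda>a. [:[:a:]:]) [:[:0, 1:]:] [:[:0, 1:], - 1:] T =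
          ev2 (\<lambda>a. [:[:a:]:]) [:0, 1:] [:[:0, 1:]:] R"
        unfolding T_def by (subst c.comp_ev2[OF c.ring_map_ev2]) (simp add: c.ev2_pCons)
      also have "\<dots> = R"
        using ring_map_eq_ev2[OF ring_map_ident, of R] by simp
      finally show ?thesis .
    qed
    then show False
      using \<open>T = 0\<close> R(1) by simp
  qed
  have "\<exists>m \<le> degree T. vdim m (gen j w) (gen2 j h w)"
  proof (rule vdim_simple[where y = h and k = "\<lambda>i. pev j w (coeff T i)"])
    show "subfld (gen j w)" "subfld (gen2 j h w)"
      by (rule subfld_gen subfld_gen2)+
    show "gen j w \<subseteq> gen2 j h w"
      by (intro gen_subset subfld_gen2 range_subset_gen2 gen2_mem)
    show "h \<in> gen2 j h w"
      by (rule gen2_mem)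
    show "gen2 j h w \<subseteq> T" if "subfld T" "gen j w \<subseteq> T" "h \<in> T" for T
      using that gen_mem[of w] range_subset_gen[of w] by (intro gen2_subset) auto
    show "pev j w (coeff T i) \<in> gen j w" for i
      by (rule pev_in_gen)
    show "pev j w (coeff T (degree T)) \<noteq> 0"
      using pev_eq_0_iff[OF w] \<open>T \<noteq> 0\<close> by simp
    show "(\<Sum>i\<le>degree T. pev j w (coeff T i) * h ^ i) = 0"
      using T0 unfolding ev2_def ring_map.pev_eq_sum[OF ring_map_pev order.refl] .
  qed
  then show ?thesis
    using \<open>degree T \<le> 2 * e\<close> unfolding w_def by (meson le_trans)
qed

end

section \<open>Homomorphisms between fields of fractions\<close>

text \<open>Extends e p |-> e' p to fractions through a chosen representation; equality of the
  kernels makes the choice irrelevant. It provides both the Laurent expansions and the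
  conjugation.\<close>

definition transfer :: "('r \<Rightarrow> 'f::field) \<Rightarrow> ('r \<Rightarrow> 'g::field) \<Rightarrow> 'f \<Rightarrow> 'g" where
  "transfer e e' z = (case SOME (p, q). e q \<noteq> 0 \<and> z = e p / e q of (p, q) \<Rightarrow> e' p / e' q)"

locale same_kernel = e: ring_map e + e': ring_map e'
  for e :: "'r::comm_ring_1 \<Rightarrow> 'f::field" and e' :: "'r \<Rightarrow> 'g::field" +
  assumes kernel: "e p = 0 \<longleftrightarrow> e' p = 0"
begin

lemma transfer_fraction:
  assumes q: "e q \<noteq> 0"
  shows "transfer e e' (e p / e q) = e' p / e' q"
proof -
  obtain p1 q1 where pq1: "(SOME (p1, q1). e q1 \<noteq> 0 \<and> e p / e q = e p1 / e q1) = (p1, q1)"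
    by fastforce
  have "\<exists>r. case r of (p1, q1) \<Rightarrow> e q1 \<noteq> 0 \<and> e p / e q = e p1 / e q1"
    using q by (intro exI[of _ "(p, q)"]) auto
  from someI_ex[OF this] have "e q1 \<noteq> 0" and eq: "e p / e q = e p1 / e q1"
    unfolding pq1 by auto
  then have "e (p * q1 - p1 * q) = 0"
    using q by (simp add: field_simps)
  then have "e' p * e' q1 = e' p1 * e' q"
    unfolding kernel by simp
  moreover have "e' q1 \<noteq> 0" "e' q \<noteq> 0"
    using \<open>e q1 \<noteq> 0\<close> q kernel by auto
  ultimately have "e' p1 / e' q1 = e' p / e' q"
    by (simp add: field_simps)
  then show ?thesis
    unfolding transfer_def pq1 by simp
qed

lemma transfer_eval: "transfer e e' (e p) = e' p"
  using transfer_fraction[of 1 p] by simp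

lemma transfer_mult:
  assumes "z \<in> fractions e" "z' \<in> fractions e"
  shows "transfer e e' (z * z') = transfer e e' z * transfer e e' z'"
proof -
  obtain p q p' q' where "z = e p / e q" "e q \<noteq> 0" "z' = e p' / e q'" "e q' \<noteq> 0"
    using assms by (auto elim!: fractionsE)
  then show ?thesis
    using transfer_fraction[of "q * q'" "p * p'"] transfer_fraction by simp
qed

lemma transfer_add:
  assumes "z \<in> fractions e" "z' \<in> fractions e"
  shows "transfer e e' (z + z') = transfer e e' z + transfer e e' z'"
proof -
  obtain p q p' q' where z: "z = e p / e q" "e q \<noteq> 0" and z': "z' = e p' / e q'" "e q' \<noteq> 0"
    using assms by (auto elim!: fractionsE)
  have "e' q \<noteq> 0" "e' q' \<noteq> 0"
    using z z' kernel by auto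
  have "z + z' = e (p * q' + p' * q) / e (q * q')"
    using z z' by (simp add: field_simps)
  then have "transfer e e' (z + z') = e' (p * q' + p' * q) / e' (q * q')"
    using transfer_fraction[of "q * q'"] z z' by (metis e.mult mult_eq_0_iff)
  also have "\<dots> = e' p / e' q + e' p' / e' q'"
    using \<open>e' q \<noteq> 0\<close> \<open>e' q' \<noteq> 0\<close> by (simp add: field_simps)
  finally show ?thesis
    using transfer_fraction z z' by simp
qed

lemma transfer_eq_0_iff:
  assumes "z \<in> fractions e"
  shows "transfer e e' z = 0 \<longleftrightarrow> z = 0"
proof -
  obtain p q where "z = e p / e q" "e q \<noteq> 0"
    using assms by (rule fractionsE)
  then show ?thesis
    using transfer_fraction[of q p] kernel by auto
qed

lemma transfer_uminus:
  assumes "z \<in> fractions e"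
  shows "transfer e e' (- z) = - transfer e e' z"
proof -
  have "transfer e e' (z + - z) = transfer e e' z + transfer e e' (- z)"
    by (intro transfer_add assms subfld_uminus[OF subfld_fractions[OF e.ring_map_axioms]])
  then show ?thesis
    using transfer_eval[of 0] by (simp add: eq_neg_iff_add_eq_0 add.commute)
qed

lemma transfer_diff:
  assumes "z \<in> fractions e" "z' \<in> fractions e"
  shows "transfer e e' (z - z') = transfer e e' z - transfer e e' z'"
  using transfer_add[of z "- z'"] transfer_uminus assms
    subfld_uminus[OF subfld_fractions[OF e.ring_map_axioms]] by simp

lemma transfer_inverse:
  assumes "z \<in> fractions e"
  shows "transfer e e' (inverse z) = inverse (transfer e e' z)"
proof (cases "z = 0")
  case True
  then show ?thesis
    using transfer_eval[of 0] by simp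
next
  case False
  have "transfer e e' (z * inverse z) = transfer e e' z * transfer e e' (inverse z)"
    by (intro transfer_mult assms subfld_inverse[OF subfld_fractions[OF e.ring_map_axioms]])
  then have "transfer e e' z * transfer e e' (inverse z) = 1"
    using transfer_eval[of 1] False by simp
  then show ?thesis
    by (metis inverse_unique)
qed

end

lemma ring_map_fps_to_fls: "ring_map (fps_to_fls :: 'k::comm_ring_1 fps \<Rightarrow> 'k fls)"
  by unfold_locales (auto simp: fls_times_fps_to_fls)

lemma fls_cases_fps:
  fixes f :: "'k::field fls"
  assumes "f \<noteq> 0"
  shows "f \<in> range fps_to_fls \<or> inverse f \<in> range fps_to_fls"
proof -
  have *: "g \<in> range fps_to_fls" if "fls_subdegree g \<ge> 0" for g :: "'k fls"
    using fls_regpart_to_fls_trivial[OF that] by (metis rangeI)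
  show ?thesis
    using *[of f] *[of "inverse f"] assms by (cases "fls_subdegree f \<ge> 0") auto
qed

section \<open>The function field of the preimage curve\<close>

text \<open>By \<open>ker\<close>, x and c satisfy precisely the multiples of the preimage
  polynomial, so L is a copy of the function field inside an arbitrary field.\<close>

locale preimage_field = alg_closed_embedding j for j :: "'k::alg_closed_field \<Rightarrow> 'f::field" +
  fixes x c :: 'f and N :: nat and a :: 'k
  assumes ker: "ev2 j x c p = 0 \<longleftrightarrow> preimage_poly N a dvd p"
    and two: "(2 :: 'k) \<noteq> 0" and simple: "crit_simple N a"
begin

abbreviation L where "L \<equiv> gen2 j x c"

sublocale ev: ring_map "ev2 j x c"
  by (rule ring_map_ev2)

lemma orbit_eq: "(quad_map c ^^ N) x = j a"
  using ker[of "preimage_poly N a"] by (simp add: ev2_preimage_poly)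

lemma dvd_degree: "preimage_poly N a dvd p \<Longrightarrow> p \<noteq> 0 \<Longrightarrow> 2 ^ N \<le> degree p"
  using dvd_imp_degree_le[of "preimage_poly N a" p] by (simp add: degree_preimage_poly)

lemma c_transcendental: "c \<notin> range j"
proof
  assume "c \<in> range j"
  then obtain b where "c = j b" by auto
  then have "ev2 j x c [:[:- b, 1:]:] = 0"
    by simp
  then have "preimage_poly N a dvd [:[:- b, 1:]:]"
    by (simp only: ker)
  then show False
    using dvd_degree[of "[:[:- b, 1:]:]"] by simp
qed

lemma L_mem: "j b \<in> L" "x \<in> L" "c \<in> L"
  by (simp_all add: const_in_gen2 gen2_mem)

subsection \<open>Places given by power series\<close>

definition series_eval :: "'k fps \<Rightarrow> 'k fps \<Rightarrow> 'k poly poly \<Rightarrow> 'k fls" where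
  "series_eval \<xi> \<eta> p = fps_to_fls (ev2 fps_const \<xi> \<eta> p)"

definition expansion :: "'k fps \<Rightarrow> 'k fps \<Rightarrow> 'f \<Rightarrow> 'k fls" where
  "expansion \<xi> \<eta> = transfer (ev2 j x c) (series_eval \<xi> \<eta>)"

text \<open>The ring K[[s]] pulled back along the embedding of L into K((s)) with x =
  \<open>\<xi>\<close>, c = \<open>\<eta>\<close>. The assumption \<open>series\<close> below makes
  this embedding well defined.\<close>

definition series_place :: "'k fps \<Rightarrow> 'k fps \<Rightarrow> 'f set" where
  "series_place \<xi> \<eta> = {z \<in> L. expansion \<xi> \<eta> z \<in> range fps_to_fls}"

context
  fixes \<xi> \<eta> :: "'k fps"
  assumes series: "\<And>p. ev2 fps_const \<xi> \<eta> p = 0 \<longleftrightarrow> preimage_poly N a dvd p"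
begin

lemma ring_map_series: "ring_map (series_eval \<xi> \<eta>)"
  unfolding series_eval_def
  by (rule ring_map_comp[OF ring_map.ring_map_ev2[OF ring_map_fps_const] ring_map_fps_to_fls])

lemma same_kernel_series: "same_kernel (ev2 j x c) (series_eval \<xi> \<eta>)"
  by (intro same_kernel.intro ring_map_ev2 ring_map_series same_kernel_axioms.intro)
     (simp add: ker series series_eval_def)

lemmas expansion_simps =
  same_kernel.transfer_add[OF same_kernel_series, folded gen2_def expansion_def]
  same_kernel.transfer_mult[OF same_kernel_series, folded gen2_def expansion_def]
  same_kernel.transfer_uminus[OF same_kernel_series, folded gen2_def expansion_def]
  same_kernel.transfer_diff[OF same_kernel_series, folded gen2_def expansion_def]
  same_kernel.transfer_inverse[OF same_kernel_series, folded gen2_def expansion_def]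
  same_kernel.transfer_eq_0_iff[OF same_kernel_series, folded gen2_def expansion_def]

lemma expansion_eval: "expansion \<xi> \<eta> (ev2 j x c p) = fps_to_fls (ev2 fps_const \<xi> \<eta> p)"
  unfolding expansion_def by (simp add: same_kernel.transfer_eval[OF same_kernel_series] series_eval_def)

lemma expansion_const: "expansion \<xi> \<eta> (j b) = fps_to_fls (fps_const b)"
proof -
  interpret const: ring_map "fps_const :: 'k \<Rightarrow> 'k fps" by (rule ring_map_fps_const)
  show ?thesis
    using expansion_eval[of "[:[:b:]:]"] by simp
qed

lemma expansion_c: "expansion \<xi> \<eta> c = fps_to_fls \<eta>"
proof -
  interpret const: ring_map "fps_const :: 'k \<Rightarrow> 'k fps" by (rule ring_map_fps_const)
  show ?thesis
    using expansion_eval[of "[:[:0, 1:]:]"] by simp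
qed

lemma nonunit_if_expansion:
  assumes z: "z \<in> L" "expansion \<xi> \<eta> z = fps_to_fls f" "fps_nth f 0 = 0"
  shows "z \<in> nonunits (series_place \<xi> \<eta>)"
proof -
  have "inverse z \<notin> series_place \<xi> \<eta>" if "z \<noteq> 0"
  proof
    assume "inverse z \<in> series_place \<xi> \<eta>"
    then obtain g where g: "expansion \<xi> \<eta> (inverse z) = fps_to_fls g"
      by (auto simp: series_place_def)
    have "fps_to_fls f \<noteq> 0"
      using that expansion_simps(6)[OF z(1)] z(2) by metis
    moreover have "fps_to_fls g = inverse (fps_to_fls f)"
      using expansion_simps(5)[OF z(1)] z(2) g by metis
    ultimately have "fps_to_fls f * fps_to_fls g = 1"
      by (metis right_inverse)
    then have "f * g = 1"
      by (simp flip: fls_times_fps_to_fls)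
    then have "fps_nth f 0 * fps_nth g 0 = 1"
      by (metis fps_mult_nth_0 fps_one_nth)
    then show False
      using z by simp
  qed
  then show ?thesis
    using z by (auto simp: nonunits_def series_place_def)
qed

lemma series_place_in_places: "series_place \<xi> \<eta> \<in> places j L"
proof -
  interpret f: ring_map "fps_to_fls :: 'k fps \<Rightarrow> 'k fls" by (rule ring_map_fps_to_fls)
  \<comment> \<open>\<open>\<pi>\<close> vanishes at the place without being constant. It witnesses
    both strict inclusions: its inverse is missing from the place, and it lies outside K.\<close>
  define \<pi> where "\<pi> = c - j (fps_nth \<eta> 0)"
  have \<pi>: "\<pi> \<in> L" "\<pi> \<noteq> 0" "\<pi> \<notin> range j"
  proof -
    show "\<pi> \<in> L"
      unfolding \<pi>_def by (intro subfld_diff subfld_gen2 L_mem)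
    show "\<pi> \<notin> range j"
    proof
      assume "\<pi> \<in> range j"
      then obtain b where "c = j (b + fps_nth \<eta> 0)"
        by (auto simp: \<pi>_def diff_eq_eq)
      then show False
        using c_transcendental by blast
    qed
    then show "\<pi> \<noteq> 0"
      using zero by (metis rangeI)
  qed
  have "expansion \<xi> \<eta> \<pi> = fps_to_fls (\<eta> - fps_const (fps_nth \<eta> 0))"
    unfolding \<pi>_def using expansion_simps(4)[OF L_mem(3) L_mem(1)]
    by (simp add: expansion_c expansion_const)
  then have nu: "\<pi> \<in> nonunits (series_place \<xi> \<eta>)"
    by (rule nonunit_if_expansion[rotated]) (simp_all add: \<pi>(1))
  then have "\<pi> \<in> series_place \<xi> \<eta>" "inverse \<pi> \<notin> series_place \<xi> \<eta>"
    using \<pi> by (auto simp: nonunits_def)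
  moreover have "inverse \<pi> \<in> L"
    by (intro subfld_inverse subfld_gen2 \<pi>)
  ultimately have ne: "series_place \<xi> \<eta> \<noteq> L" "range j \<noteq> series_place \<xi> \<eta>"
    using \<pi>(3) by auto
  have "z \<in> series_place \<xi> \<eta> \<or> inverse z \<in> series_place \<xi> \<eta>" if z: "z \<in> L - {0}" for z
  proof -
    have "expansion \<xi> \<eta> z \<noteq> 0"
      using z expansion_simps by simp
    then have "expansion \<xi> \<eta> z \<in> range fps_to_fls \<or> inverse (expansion \<xi> \<eta> z) \<in> range fps_to_fls"
      by (rule fls_cases_fps)
    then show ?thesis
      using z expansion_simps subfld_inverse[OF subfld_gen2] by (auto simp: series_place_def)
  qed
  moreover have "z + w \<in> series_place \<xi> \<eta> \<and> z * w \<in> series_place \<xi> \<eta>"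
    if "z \<in> series_place \<xi> \<eta>" "w \<in> series_place \<xi> \<eta>" for z w
  proof -
    obtain f g where "expansion \<xi> \<eta> z = fps_to_fls f" "expansion \<xi> \<eta> w = fps_to_fls g" "z \<in> L" "w \<in> L"
      using \<open>z \<in> _\<close> \<open>w \<in> _\<close> by (auto simp: series_place_def)
    then have "expansion \<xi> \<eta> (z + w) = fps_to_fls (f + g)" "expansion \<xi> \<eta> (z * w) = fps_to_fls (f * g)"
      using expansion_simps by simp_all
    then show ?thesis
      using \<open>z \<in> L\<close> \<open>w \<in> L\<close> subfld_add[OF subfld_gen2] subfld_mult[OF subfld_gen2]
      unfolding series_place_def by blast
  qed
  moreover have "- z \<in> series_place \<xi> \<eta>" if "z \<in> series_place \<xi> \<eta>" for z
  proof -
    obtain f where "expansion \<xi> \<eta> z = fps_to_fls f" "z \<in> L"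
      using \<open>z \<in> _\<close> by (auto simp: series_place_def)
    then have "expansion \<xi> \<eta> (- z) = fps_to_fls (- f)"
      using expansion_simps by simp
    then show ?thesis
      using \<open>z \<in> L\<close> subfld_uminus[OF subfld_gen2] unfolding series_place_def by blast
  qed
  moreover have "range j \<subseteq> series_place \<xi> \<eta>"
    using expansion_const L_mem unfolding series_place_def by blast
  moreover have "series_place \<xi> \<eta> \<subseteq> L"
    by (auto simp: series_place_def)
  ultimately show ?thesis
    unfolding places_def using ne by blast
qed

lemma val_series_place:
  assumes z: "z \<in> L" "expansion \<xi> \<eta> z = fps_to_fls f"
  shows "val j (series_place \<xi> \<eta>) z (fps_nth f 0)"
proof -
  have "expansion \<xi> \<eta> (z - j (fps_nth f 0)) = fps_to_fls (f - fps_const (fps_nth f 0))"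
    using expansion_simps(4)[OF z(1) L_mem(1)] z(2) by (simp add: expansion_const)
  then have "z - j (fps_nth f 0) \<in> nonunits (series_place \<xi> \<eta>)"
    by (rule nonunit_if_expansion[rotated]) (simp_all add: z(1) L_mem(1) subfld_diff subfld_gen2)
  then show ?thesis
    using z by (auto simp: val_def series_place_def)
qed

end

subsection \<open>Infinitely many places\<close>

text \<open>
  At a point \<open>(x\<^sub>0, c\<^sub>0)\<close> for which no \<open>f\<^sub>c\<^sup>M(0) - a\<close> vanishes the curve is parametrised by \<open>c - c\<^sub>0\<close>.
\<close>

lemma place_over_c:
  assumes c0: "\<And>M. M \<in> {1..N} \<Longrightarrow> poly (crit_poly M a) c0 \<noteq> 0"
  shows "\<exists>P\<in>places j L. val j P c c0"
proof -
  interpret const: ring_map "fps_const :: 'k \<Rightarrow> 'k fps" by (rule ring_map_fps_const)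
  interpret red: ring_map "map_poly (\<lambda>f :: 'k fps. fps_nth f 0)"
    by (rule ring_map_map_poly[OF ring_map_fps_nth_0])
  define \<eta> where "\<eta> = fps_const c0 + fps_X"
  define Q where "Q n = (quad_map [:c0:] ^^ n) [:0, 1:]" for n
  define T where "T = (quad_map [:\<eta>:] ^^ N) [:0, 1:] - [:fps_const a:]"
  have red: "map_poly (\<lambda>f. fps_nth f 0) T = Q N - [:a:]"
    unfolding T_def red.diff red.quad_map_funpow Q_def by (simp add: map_poly_pCons \<eta>_def)
  have "degree (Q N) = 2 ^ N"
    unfolding Q_def by (subst degree_quad_funpow) auto
  then have "degree (Q N - [:a:]) = 2 ^ N"
    unfolding diff_conv_add_uminus by (subst degree_add_eq_left) auto
  then obtain x0 where x0: "poly (Q N - [:a:]) x0 = 0"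
    using alg_closed_imp_poly_has_root[of "Q N - [:a:]"] by auto
  have poly_Q: "poly (Q n) x0 = (quad_map c0 ^^ n) x0" for n
  proof -
    interpret p: ring_map "\<lambda>p. poly p x0" by (rule ring_map_poly)
    show ?thesis by (simp add: Q_def)
  qed
  \<comment> \<open>If iterate n were 0, the remaining N - n steps would lead from 0 to a, which
    \<open>c0\<close> excludes.\<close>
  have nz: "(quad_map c0 ^^ n) x0 \<noteq> 0" if "n < N" for n
  proof
    assume 0: "(quad_map c0 ^^ n) x0 = 0"
    have "(quad_map c0 ^^ N) x0 = (quad_map c0 ^^ (N - n)) ((quad_map c0 ^^ n) x0)"
      using that by (metis comp_apply funpow_add le_add_diff_inverse2 less_imp_le)
    then have "(quad_map c0 ^^ (N - n)) 0 = a"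
      using x0 0 poly_Q by simp
    moreover have "poly (crit_poly (N - n) a) c0 = (quad_map c0 ^^ (N - n)) 0 - a"
    proof -
      interpret p: ring_map "\<lambda>p. poly p c0" by (rule ring_map_poly)
      show ?thesis by (simp add: crit_poly_def)
    qed
    ultimately show False
      using c0[of "N - n"] that by simp
  qed
  \<comment> \<open>By the chain rule this derivative is 2^n times the product of the iterates with
    index below n; characteristic different from 2 matters here.\<close>
  have "poly (pderiv (Q n)) x0 \<noteq> 0" if "n \<le> N" for n
    using that
  proof (induction n)
    case 0
    show ?case by (simp add: Q_def pderiv_pCons)
  next
    case (Suc n)
    have "Q (Suc n) = Q n * Q n + [:c0:]"
      by (simp add: Q_def quad_map_def power2_eq_square)
    then have "pderiv (Q (Suc n)) = Q n * pderiv (Q n) + Q n * pderiv (Q n)"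
      by (simp add: pderiv_add pderiv_mult pderiv_pCons)
    then have "poly (pderiv (Q (Suc n))) x0 = 2 * (poly (Q n) x0 * poly (pderiv (Q n)) x0)"
      by simp
    then show ?case
      using Suc nz[of n] poly_Q two by simp
  qed
  then have "poly (pderiv (Q N - [:a:])) x0 \<noteq> 0"
    by (simp add: pderiv_diff pderiv_pCons)
  then have "\<exists>f. fps_nth f 0 = x0 \<and> poly T f = 0"
    using x0 by (intro fps_hensel) (simp_all only: red not_False_eq_True)
  then obtain \<xi> where "poly T \<xi> = 0"
    by blast
  moreover have "poly T \<xi> = (quad_map \<eta> ^^ N) \<xi> - fps_const a"
  proof -
    interpret p: ring_map "\<lambda>p. poly p \<xi>" by (rule ring_map_poly)
    show ?thesis by (simp add: T_def)
  qed
  ultimately have eq: "(quad_map \<eta> ^^ N) \<xi> = fps_const a"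
    by simp
  have nonconst: "\<eta> \<noteq> fps_const b" for b
    using arg_cong[of \<eta> "fps_const b" "\<lambda>f. fps_nth f 1"] by (auto simp: \<eta>_def)
  have series: "ev2 fps_const \<xi> \<eta> p = 0 \<longleftrightarrow> preimage_poly N a dvd p" for p
  proof (rule kernel_eq_dvd[OF const.ring_map_ev2 prime_elem_preimage_poly[OF simple]
        lead_coeff_preimage_poly])
    show "ev2 fps_const \<xi> \<eta> (preimage_poly N a) = 0"
      by (simp add: const.ev2_preimage_poly eq)
    show "r = 0" if "ev2 fps_const \<xi> \<eta> [:r:] = 0" for r
      using that pev_eq_0_iff_transcendental[OF ring_map_fps_const nonconst] by simp
  qed
  have "val j (series_place \<xi> \<eta>) c (fps_nth \<eta> 0)"
    by (rule val_series_place[OF series L_mem(3) expansion_c[OF series]])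
  then have "val j (series_place \<xi> \<eta>) c c0"
    by (simp add: \<eta>_def)
  then show ?thesis
    using series_place_in_places[OF series] by blast
qed

lemma val_c_unique: "P \<in> places j L \<Longrightarrow> val j P c s \<Longrightarrow> val j P c s' \<Longrightarrow> s = s'"
  by (rule place.val_unique[of j L P]) (unfold_locales, auto simp: subfld_gen2)

text \<open>All but finitely many elements of K occur as values of c, and a place determines the
  value of c.\<close>

lemma infinite_places: "infinite (places j L)"
proof
  assume fin: "finite (places j L)"
  define B where "B = (\<Union>M\<in>{1..N}. {s. poly (crit_poly M a) s = 0})"
  have "crit_poly M a \<noteq> 0" if "M \<in> {1..N}" for M
    using degree_crit_poly_Suc[of "M - 1" a] that by auto
  then have "finite B"
    unfolding B_def by (intro finite_UN_I poly_roots_finite) auto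
  have "\<forall>s\<in>- B. \<exists>P\<in>places j L. val j P c s"
    using place_over_c by (auto simp: B_def)
  then obtain f where f: "\<And>s. s \<in> - B \<Longrightarrow> f s \<in> places j L \<and> val j (f s) c s"
    by metis
  have "inj_on f (- B)"
    using f val_c_unique by (metis inj_onI)
  then have "finite (- B)"
    using f fin by (meson finite_imageD finite_subset image_subsetI)
  then show False
    using \<open>finite B\<close> infinite_alg_closed_UNIV[where 'k = 'k] by (metis Compl_partition finite_UnI)
qed

subsection \<open>A function of small degree\<close>

lemma small_degree_function:
  assumes N: "N \<ge> 2"
  shows "\<exists>t n. t \<in> L \<and> t \<notin> range j \<and> n \<le> 2 ^ (N - 2) \<and> vdim n (gen j t) L"
proof -
  define u where "u = (quad_map c ^^ (N - 2)) x"
  define v where "v = u\<^sup>2 + c"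
  define t where "t = u - v"
  obtain M where M: "N = Suc (Suc M)"
    using N by (metis add_2_eq_Suc le_Suc_ex)
  have "v\<^sup>2 + c = j a"
    using orbit_eq by (simp add: M u_def v_def quad_map_def)
  then have c_eq: "c = j a - v\<^sup>2"
    by (simp add: eq_diff_eq add.commute)
  \<comment> \<open>Insert u = t + v into u^2 = v^2 + v - a: the terms v^2 cancel and v becomes
    rational in t. Geometrically, the lines t = const pass through one point of the conic at
    infinity.\<close>
  have key: "v * (1 - 2 * t) = t\<^sup>2 + j a"
  proof -
    have uu: "u * u = v - c" and cc: "c = j a - v * v"
      using c_eq by (simp_all add: v_def power2_eq_square)
    have "t\<^sup>2 + j a = u * u - 2 * (u * v) + v * v + j a"
      by (simp add: t_def power2_eq_square algebra_simps)
    also have "\<dots> = v * (1 - 2 * t)"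
      unfolding uu unfolding cc t_def by (simp add: algebra_simps)
    finally show ?thesis by simp
  qed
  \<comment> \<open>Otherwise 1 + 4a = 0 and the conic degenerates. But 1 + 4a is also the
    discriminant of \<open>crit_poly 2 a\<close>, i.e. of c^2 + c - a, so b = -1/2 would be a double
    root.\<close>
  have "1 - 2 * t \<noteq> 0"
  proof
    assume 0: "1 - 2 * t = 0"
    then have "t\<^sup>2 + j a = 0"
      using key by simp
    moreover have "4 * (t\<^sup>2 + j a) = (2 * t) * (2 * t) + 4 * j a"
      by (simp add: power2_eq_square algebra_simps)
    moreover have "2 * t = 1"
      using 0 by simp
    ultimately have "1 + 4 * j a = 0"
      by simp
    then have "j (1 + 4 * a) = 0"
      by simp
    then have disc: "1 + 4 * a = 0"
      by (simp only: eq_0_iff)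
    have cr: "crit_poly 2 a = [:- a, 1, 1:]"
      by (simp add: crit_poly_def numeral_2_eq_2 quad_map_def power2_eq_square)
    define b where "b = - inverse (2 :: 'k)"
    have b: "2 * b = -1"
      using two by (simp add: b_def)
    have "4 * (b * b + b - a) = (2 * b) * (2 * b) + 2 * (2 * b) - 4 * a"
      by (simp add: algebra_simps)
    also have "\<dots> = - (1 + 4 * a)"
      unfolding b by simp
    finally have "4 * (b * b + b - a) = 0"
      using disc by simp
    moreover have "(4 :: 'k) \<noteq> 0"
      using two by (metis mult_2 mult_eq_0_iff numeral_Bit0)
    ultimately have "b * b + b - a = 0"
      by (metis mult_eq_0_iff)
    then have "poly (crit_poly 2 a) b = 0"
      by (simp add: cr algebra_simps)
    moreover have "poly (pderiv (crit_poly 2 a)) b = 0"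
      using b by (simp add: cr pderiv_pCons mult.commute)
    ultimately show False
      using simple N by (auto simp: crit_simple_def)
  qed
  then have v_eq: "v = (t\<^sup>2 + j a) / (1 - 2 * t)"
    using key by (simp add: eq_divide_eq)
  note S = subfld_gen[of t]
  have "2 \<in> gen j t"
    using const_in_gen[of 2 t] by simp
  then have vS: "v \<in> gen j t"
    unfolding v_eq using gen_mem[of t] const_in_gen[of a t] S by (auto intro!: subfld_closed)
  have "t + v \<in> gen j t" "j a - v\<^sup>2 \<in> gen j t"
    using vS gen_mem[of t] const_in_gen[of a t] S by (auto intro!: subfld_closed)
  then have uS: "u \<in> gen j t" and cS: "c \<in> gen j t"
    using c_eq by (auto simp: t_def)
  have "u \<in> L"
    unfolding u_def by (intro subfld_quad_funpow subfld_gen2 L_mem)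
  then have tL: "t \<in> L"
    unfolding t_def v_def by (intro subfld_diff subfld_add subfld_power subfld_gen2 L_mem)
  have t: "t \<notin> range j"
  proof
    assume "t \<in> range j"
    then have "gen j t \<subseteq> range j"
      by (intro gen_subset subfld_range) auto
    then show False
      using cS c_transcendental by blast
  qed
  define Q where "Q = (quad_map [:c:] ^^ M) [:0, 1:] - [:u:]"
  have "degree ((quad_map [:c:] ^^ M) [:0, 1:]) = 2 ^ M"
    by (subst degree_quad_funpow) auto
  then have degQ: "degree Q = 2 ^ M"
    unfolding Q_def diff_conv_add_uminus by (subst degree_add_eq_left) auto
  have coeffs: "coeff Q i \<in> gen j t" for i
  proof -
    have "coeff ((quad_map [:c:] ^^ m) [:0, 1:]) i \<in> gen j t" for m i
    proof (induction m arbitrary: i)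
      case 0
      show ?case
        by (auto simp: coeff_pCons S subfld_0 subfld_1 split: nat.split)
    next
      case (Suc m)
      then show ?case
        using cS S by (auto simp: quad_map_def power2_eq_square coeff_mult coeff_pCons
            intro!: subfld_add subfld_sum subfld_mult subfld_0 split: nat.split)
    qed
    then show ?thesis
      unfolding Q_def using uS S
      by (auto simp: coeff_pCons intro!: subfld_diff subfld_0 split: nat.split)
  qed
  have root: "poly Q x = 0"
  proof -
    interpret p: ring_map "\<lambda>p. poly p x" by (rule ring_map_poly)
    show ?thesis by (simp add: Q_def u_def M)
  qed
  have "\<exists>n\<le>degree Q. vdim n (gen j t) L"
  proof (rule vdim_simple[where y = x and k = "coeff Q"])
    show "gen j t \<subseteq> L"
      by (intro gen_subset subfld_gen2 range_subset_gen2 tL)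
    show "L \<subseteq> T" if "subfld T" "gen j t \<subseteq> T" "x \<in> T" for T
      using that cS range_subset_gen[of t] by (intro gen2_subset) auto
    show "coeff Q (degree Q) \<noteq> 0"
      using degQ by (metis leading_coeff_0_iff degree_0 power_not_zero zero_neq_numeral)
    show "(\<Sum>i\<le>degree Q. coeff Q i * x ^ i) = 0"
      using root by (simp add: poly_altdef)
  qed (auto simp: S subfld_gen2 L_mem coeffs)
  then show ?thesis
    using tL t degQ M by auto
qed

end

section \<open>The lower bound\<close>

lemma card_simple_roots:
  fixes p :: "'k::alg_closed_field poly"
  assumes "p \<noteq> 0" "\<And>b. poly p b = 0 \<Longrightarrow> poly (pderiv p) b \<noteq> 0"
  shows "card {b. poly p b = 0} = degree p"
  using assms
proof (induction "degree p" arbitrary: p)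
  case 0
  then obtain b where "p = [:b:]"
    by (metis degree_0_id)
  then show ?case
    using "0.prems" by auto
next
  case (Suc n)
  then obtain b where b: "poly p b = 0"
    by (metis alg_closed_imp_poly_has_root zero_less_Suc)
  then obtain q where q: "p = [:- b, 1:] * q"
    by (auto simp: poly_eq_0_iff_dvd)
  then have "q \<noteq> 0"
    using Suc.prems by auto
  then have deg: "degree p = Suc (degree q)"
    unfolding q by (subst degree_mult_eq) auto
  have pd: "poly (pderiv p) s = (s - b) * poly (pderiv q) s + poly q s" for s
    unfolding q pderiv_mult by (simp add: pderiv_pCons algebra_simps)
  have "poly q b \<noteq> 0"
    using Suc.prems(2)[OF b] pd[of b] by simp
  have "poly (pderiv q) s \<noteq> 0" if "poly q s = 0" for s
    using Suc.prems(2)[of s] pd[of s] that by (auto simp: q)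
  then have "card {s. poly q s = 0} = degree q"
    using Suc.hyps deg \<open>q \<noteq> 0\<close> by auto
  moreover have "{s. poly p s = 0} = insert b {s. poly q s = 0}"
    by (auto simp: q)
  ultimately show ?case
    using \<open>poly q b \<noteq> 0\<close> deg by (simp add: poly_roots_finite[OF \<open>q \<noteq> 0\<close>])
qed

lemma ring_map_fps_compose: "fps_nth g 0 = 0 \<Longrightarrow> ring_map (\<lambda>f :: 'k::idom fps. f oo g)"
  by unfold_locales (auto simp: fps_compose_add_distrib fps_compose_mult_distrib)

lemma (in ring_map) ev2_neg: "ev2 \<phi> (- x) c p = ev2 \<phi> x c (pcompose p [:0, - 1:])"
proof -
  interpret e: ring_map "ev2 \<phi> x c" by (rule ring_map_ev2)
  interpret p: ring_map "pev \<phi> c" by (rule ring_map_pev)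
  have "ring_map (\<lambda>p. ev2 \<phi> x c (pcompose p [:0, - 1:]))"
    by (rule ring_map_comp[OF ring_map_pcompose ring_map_ev2])
  from ring_map_eq_ev2[OF this, of p] show ?thesis
    by (simp add: pcompose_pCons ev2_pCons)
qed

lemma pcompose_neg_neg: "pcompose (pcompose p [:0, - 1:]) [:0, - 1:] = (p :: 'k::comm_ring_1 poly poly)"
proof -
  have "pcompose [:0, - 1:] [:0, - 1:] = ([:0, 1:] :: 'k poly poly)"
    by (simp add: pcompose_pCons)
  then show ?thesis
    unfolding pcompose_assoc[symmetric] by simp
qed

lemma preimage_poly_even: "pcompose (preimage_poly (Suc M) a) [:0, - 1:] = preimage_poly (Suc M) a"
proof -
  have "pcompose quad_poly [:0, - 1:] = (quad_poly :: 'a poly poly)"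
    by (simp add: pcompose_pCons)
  then show ?thesis
    unfolding preimage_poly_Suc pcompose_assoc[symmetric] by simp
qed

text \<open>Substituting \<open>s = x\<^sup>2\<close> in the series of the curve for \<open>M\<close> gives an even series in \<open>x\<close>.\<close>

lemma even_series:
  fixes a c0 :: "'k::alg_closed_field"
  assumes simple: "crit_simple (Suc M) a" and c0: "poly (crit_poly (Suc M) a) c0 = 0"
  obtains \<eta> where "fps_nth \<eta> 0 = c0" "\<eta> oo - fps_X = \<eta>"
    "\<And>p. ev2 fps_const fps_X \<eta> p = 0 \<longleftrightarrow> preimage_poly (Suc M) a dvd p"
proof -
  interpret const: ring_map "fps_const :: 'k \<Rightarrow> 'k fps" by (rule ring_map_fps_const)
  have prime: "prime_elem (preimage_poly M a)"
    using simple by (intro prime_elem_preimage_poly) (auto simp: crit_simple_def)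
  have crit: "poly (pderiv (crit_poly (Suc M) a)) c0 \<noteq> 0"
    using simple c0 by (auto simp: crit_simple_def)
  obtain \<gamma> where \<gamma>: "fps_nth \<gamma> 0 = c0"
      "\<And>p. ev2 fps_const (\<gamma> + fps_X) \<gamma> p = 0 \<longleftrightarrow> preimage_poly M a dvd p"
      "\<And>b. \<gamma> \<noteq> fps_const b"
    using crit_series[OF prime c0 crit] by metis
  define sq where "sq f = f oo (fps_X ^ 2)" for f :: "'k fps"
  have sq0: "fps_nth (fps_X ^ 2 :: 'k fps) 0 = 0"
    by (simp add: fps_X_power_nth)
  have sq_map: "ring_map sq"
    unfolding sq_def[abs_def] by (rule ring_map_fps_compose[OF sq0])
  interpret sq: ring_map sq by fact
  define \<eta> where "\<eta> = sq \<gamma>"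
  have sq_const: "sq (fps_const b) = fps_const b" for b
    by (simp add: sq_def)
  have sq_X: "sq fps_X = fps_X ^ 2"
    by (simp add: sq_def sq0)
  have even: "\<eta> oo - fps_X = \<eta>"
  proof -
    have "\<eta> oo - fps_X = \<gamma> oo (fps_X ^ 2 oo - fps_X)"
      unfolding \<eta>_def sq_def by (rule fps_compose_assoc[symmetric]) (simp_all add: sq0)
    also have "fps_X ^ 2 oo - fps_X = (fps_X ^ 2 :: 'k fps)"
      by (simp add: fps_X_power_compose)
    finally show ?thesis
      by (simp add: \<eta>_def sq_def)
  qed
  have "(quad_map \<gamma> ^^ M) (\<gamma> + fps_X) = fps_const a"
    using \<gamma>(2)[of "preimage_poly M a"] by (simp add: const.ev2_preimage_poly)
  \<comment> \<open>The first iterate of x is x^2 + \<open>\<eta>\<close>, the image of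
    \<open>\<gamma> + fps_X\<close> under \<open>sq\<close>; this accounts for the additional step
    of the orbit.\<close>
  from arg_cong[OF this, of sq] have eq: "(quad_map \<eta> ^^ Suc M) fps_X = fps_const a"
    by (simp add: sq_const sq_X \<eta>_def funpow_Suc_right quad_map_def[of "sq \<gamma>" fps_X] add.commute del: funpow.simps)
  have series: "ev2 fps_const fps_X \<eta> p = 0 \<longleftrightarrow> preimage_poly (Suc M) a dvd p" for p
  proof (rule kernel_eq_dvd[OF const.ring_map_ev2 prime_elem_preimage_poly[OF simple]
        lead_coeff_preimage_poly])
    show "ev2 fps_const fps_X \<eta> (preimage_poly (Suc M) a) = 0"
      using eq by (simp add: const.ev2_preimage_poly del: funpow.simps)
    \<comment> \<open>Composition with X^2 is injective, so \<open>\<eta>\<close> inherits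
      transcendence from \<open>\<gamma>\<close>.\<close>
    fix r assume "ev2 fps_const fps_X \<eta> [:r:] = 0"
    then have "pev fps_const \<eta> r = 0"
      by simp
    moreover have "sq (pev fps_const \<gamma> r) = pev fps_const \<eta> r"
      by (simp add: const.comp_pev[OF sq_map] sq_const \<eta>_def)
    ultimately have "pev fps_const \<gamma> r oo fps_X ^ 2 = 0"
      by (simp add: sq_def)
    then have "pev fps_const \<gamma> r = 0"
      using fps_compose_eq_0_iff[OF sq0, of "pev fps_const \<gamma> r"] by simp
    then show "r = 0"
      using pev_eq_0_iff_transcendental[OF ring_map_fps_const \<gamma>(3)] by blast
  qed
  show ?thesis
    by (rule that[OF _ even series]) (simp add: \<eta>_def sq_def \<gamma>(1))
qed

section \<open>The quadratic extension over the lower level and its conjugation\<close>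

locale preimage_field_Suc = preimage_field j x c "Suc M" a for j :: "'k::alg_closed_field \<Rightarrow> 'f::field" and x c M a
begin

abbreviation lower_field where "lower_field \<equiv> gen2 j (x\<^sup>2 + c) c"

definition conj :: "'f \<Rightarrow> 'f" where
  "conj = transfer (ev2 j x c) (ev2 j (- x) c)"

lemma same_kernel_conj: "same_kernel (ev2 j x c) (ev2 j (- x) c)"
proof (intro same_kernel.intro ring_map_ev2 same_kernel_axioms.intro)
  fix p
  have "preimage_poly (Suc M) a dvd pcompose p [:0, - 1:] \<longleftrightarrow> preimage_poly (Suc M) a dvd p" (is "?l \<longleftrightarrow> ?r")
  proof
    assume ?l
    then obtain q where "pcompose p [:0, - 1:] = preimage_poly (Suc M) a * q" ..
    from arg_cong[OF this, of "\<lambda>p. pcompose p [:0, - 1:]"]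
    have "p = preimage_poly (Suc M) a * pcompose q [:0, - 1:]"
      by (simp only: pcompose_mult pcompose_neg_neg preimage_poly_even)
    then show ?r by (rule dvdI)
  next
    assume ?r
    then obtain q where "p = preimage_poly (Suc M) a * q" ..
    then have "pcompose p [:0, - 1:] = preimage_poly (Suc M) a * pcompose q [:0, - 1:]"
      by (simp only: pcompose_mult preimage_poly_even)
    then show ?l by (rule dvdI)
  qed
  then show "ev2 j x c p = 0 \<longleftrightarrow> ev2 j (- x) c p = 0"
    by (simp only: ev2_neg ker)
qed

lemmas conj_simps =
  same_kernel.transfer_add[OF same_kernel_conj, folded gen2_def conj_def]
  same_kernel.transfer_mult[OF same_kernel_conj, folded gen2_def conj_def]
  same_kernel.transfer_uminus[OF same_kernel_conj, folded gen2_def conj_def]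
  same_kernel.transfer_diff[OF same_kernel_conj, folded gen2_def conj_def]
  same_kernel.transfer_inverse[OF same_kernel_conj, folded gen2_def conj_def]
  same_kernel.transfer_eq_0_iff[OF same_kernel_conj, folded gen2_def conj_def]

lemma conj_eval: "conj (ev2 j x c p) = ev2 j (- x) c p"
  unfolding conj_def by (rule same_kernel.transfer_eval[OF same_kernel_conj])

lemma conj_fraction:
  "ev2 j x c q \<noteq> 0 \<Longrightarrow> conj (ev2 j x c p / ev2 j x c q) = ev2 j (- x) c p / ev2 j (- x) c q"
  unfolding conj_def by (rule same_kernel.transfer_fraction[OF same_kernel_conj])

lemma conj_const [simp]: "conj (j b) = j b"
  using conj_eval[of "[:[:b:]:]"] by simp

lemma conj_x [simp]: "conj x = - x"
  using conj_eval[of "[:0, 1:]"] by simp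

lemma conj_c [simp]: "conj c = c"
  using conj_eval[of "[:[:0, 1:]:]"] by simp

lemma conj_mem_conj:
  assumes "z \<in> L"
  shows "conj z \<in> L \<and> conj (conj z) = z"
proof -
  obtain p q where z: "z = ev2 j x c p / ev2 j x c q" "ev2 j x c q \<noteq> 0"
    using assms unfolding gen2_def by (rule fractionsE)
  let ?n = "\<lambda>p. pcompose p [:0, - 1:]"
  have q: "ev2 j x c (?n q) \<noteq> 0"
    using z(2) same_kernel.kernel[OF same_kernel_conj, of q] by (simp add: ev2_neg)
  have "conj z = ev2 j x c (?n p) / ev2 j x c (?n q)"
    unfolding z(1) conj_fraction[OF z(2)] by (simp only: ev2_neg)
  moreover from this have "conj (conj z) = z"
    using conj_fraction[OF q, of "?n p"] by (simp only: ev2_neg pcompose_neg_neg z(1))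
  ultimately show ?thesis
    using q unfolding gen2_def by (simp add: fractionsI)
qed

lemma conj_mem: "z \<in> L \<Longrightarrow> conj z \<in> L"
  and conj_conj: "z \<in> L \<Longrightarrow> conj (conj z) = z"
  using conj_mem_conj by blast+

lemma conj_pev: "z \<in> L \<Longrightarrow> conj (pev j z q) = pev j (conj z) q"
proof (induction q)
  case 0
  show ?case using conj_const[of 0] by simp
next
  case (pCons b q)
  have "pev j z q \<in> L"
    by (intro pev_in_subfld subfld_gen2 range_subset_gen2 pCons.prems)
  then have "conj (j b + z * pev j z q) = j b + conj z * conj (pev j z q)"
    using pCons.prems L_mem(1)[of b] conj_simps(1,2) subfld_mult[OF subfld_gen2] by simp
  then show ?case
    using pCons by simp
qed

lemma conj_ev2: "z \<in> L \<Longrightarrow> w \<in> L \<Longrightarrow> conj (ev2 j z w p) = ev2 j (conj z) (conj w) p"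
proof (induction p)
  case 0
  show ?case using conj_const[of 0] by simp
next
  case (pCons q p)
  have "ev2 j z w p \<in> L" "pev j w q \<in> L"
    by (intro ev2_in_subfld pev_in_subfld subfld_gen2 range_subset_gen2 pCons.prems)+
  then have "conj (pev j w q + z * ev2 j z w p) = conj (pev j w q) + conj z * conj (ev2 j z w p)"
    using pCons.prems conj_simps(1,2) subfld_mult[OF subfld_gen2] by simp
  then show ?case
    using pCons conj_pev by (simp add: ev2_pCons)
qed

lemma two_ne_0: "(2 :: 'f) \<noteq> 0"
  using two eq_0_iff[of 2] by simp

lemma x_ne_0: "x \<noteq> 0"
proof
  assume "x = 0"
  then have "ev2 j x c [:0, 1:] = 0"
    by simp
  then have "preimage_poly (Suc M) a dvd [:0, 1:]"
    by (simp only: ker)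
  then have "2 ^ Suc M \<le> (1 :: nat)"
    using dvd_degree[of "[:0, 1:]"] by simp
  moreover have "(1 :: nat) \<le> 2 ^ M"
    by simp
  ultimately show False
    unfolding power_Suc by linarith
qed

lemma lower_field_subset_L: "lower_field \<subseteq> L"
  by (intro gen2_subset subfld_gen2 range_subset_gen2 subfld_add subfld_power L_mem)

lemma conj_lower_field:
  assumes "z \<in> lower_field"
  shows "conj z = z"
proof -
  define T where "T = {z \<in> L. conj z = z}"
  have "subfld T"
    unfolding T_def
    by (rule subfldI) (use conj_simps subfld_closed[OF subfld_gen2] conj_const[of 1] in auto)
  moreover have "range j \<subseteq> T"
    by (auto simp: T_def L_mem)
  moreover have "x\<^sup>2 + c \<in> T"
  proof -
    have "x * x \<in> L" "conj (x * x) = x * x"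
      using conj_simps(2)[of x x] subfld_mult[OF subfld_gen2] L_mem by auto
    then show ?thesis
      using conj_simps(1)[of "x * x" c] subfld_add[OF subfld_gen2] L_mem
      by (simp add: T_def power2_eq_square)
  qed
  moreover have "c \<in> T"
    by (simp add: T_def L_mem)
  ultimately have "lower_field \<subseteq> T"
    by (rule gen2_subset)
  then show ?thesis
    using assms by (auto simp: T_def)
qed

lemma ev2_pcompose_quad_poly: "ev2 j x c (pcompose p quad_poly) = ev2 j (x\<^sup>2 + c) c p"
proof -
  interpret p: ring_map "pev j c" by (rule ring_map_pev)
  have "ring_map (\<lambda>p. ev2 j x c (pcompose p quad_poly))"
    by (rule ring_map_comp[OF ring_map_pcompose ring_map_ev2])
  from ring_map_eq_ev2[OF this, of p] show ?thesis
    by (simp add: pcompose_pCons ev2_pCons power2_eq_square add.commute)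
qed

text \<open>L has the spanning set 1, x over the lower field: split numerator and denominator into
  even and odd parts, then rationalise the denominator A + x B with its conjugate A - x B.\<close>

lemma L_decomposition:
  assumes "z \<in> L"
  shows "\<exists>u\<in>lower_field. \<exists>v\<in>lower_field. z = u + x * v"
proof -
  let ?f = "ev2 j (x\<^sup>2 + c) c"
  have ev: "\<exists>A\<in>lower_field. \<exists>B\<in>lower_field. ev2 j x c p = A + x * B \<and> ev2 j (- x) c p = A - x * B" for p
  proof -
    obtain u v where p: "p = pcompose u quad_poly + [:0, 1:] * pcompose v quad_poly"
      using even_odd_decomposition by blast
    have "ev2 j x c p = ?f u + x * ?f v"
      unfolding p ev.add ev.mult ev2_pcompose_quad_poly by simp
    moreover have "ev2 j (- x) c p = conj (ev2 j x c p)"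
      by (simp add: conj_eval)
    moreover have mem: "?f u \<in> lower_field" "?f v \<in> lower_field"
      by (rule ev2_in_gen2)+
    moreover have "conj (?f u + x * ?f v) = ?f u - x * ?f v"
    proof -
      have "?f u \<in> L" "?f v \<in> L" "x * ?f v \<in> L"
        using mem lower_field_subset_L subfld_mult[OF subfld_gen2] L_mem(2) by blast+
      then show ?thesis
        using conj_simps(1)[of "?f u" "x * ?f v"] conj_simps(2)[of x "?f v"] L_mem(2)
          conj_lower_field mem by simp
    qed
    ultimately show ?thesis
      by metis
  qed
  obtain p q where z: "z = ev2 j x c p / ev2 j x c q" "ev2 j x c q \<noteq> 0"
    using assms unfolding gen2_def by (rule fractionsE)
  obtain A B where q: "A \<in> lower_field" "B \<in> lower_field" "ev2 j x c q = A + x * B" "ev2 j (- x) c q = A - x * B"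
    using ev by blast
  obtain C D where p: "C \<in> lower_field" "D \<in> lower_field" "ev2 j x c p = C + x * D"
    using ev by blast
  have ne: "A + x * B \<noteq> 0" "A - x * B \<noteq> 0"
    using z(2) q same_kernel.kernel[OF same_kernel_conj, of q] by auto
  define y where "y = x\<^sup>2 + c - c"
  have y: "y \<in> lower_field" "y = x * x"
    unfolding y_def by (intro subfld_diff subfld_gen2 gen2_mem) (simp add: power2_eq_square)
  define d where "d = A * A - y * (B * B)"
  have d: "d = (A + x * B) * (A - x * B)"
    unfolding d_def y(2) by (simp add: algebra_simps)
  then have "d \<noteq> 0"
    using ne by simp
  have "z * d = (C * A - y * (D * B)) + x * (D * A - C * B)"
    unfolding z(1) p(3) q(3) d y(2) using ne by (simp add: field_simps)
  then have "z * d / d = (C * A - y * (D * B)) / d + x * ((D * A - C * B) / d)"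
    by (simp only: add_divide_distrib times_divide_eq_right)
  then have "z = (C * A - y * (D * B)) / d + x * ((D * A - C * B) / d)"
    using \<open>d \<noteq> 0\<close> by simp
  moreover have "(C * A - y * (D * B)) / d \<in> lower_field" "(D * A - C * B) / d \<in> lower_field"
    unfolding d_def using p q y subfld_gen2 by (auto intro!: subfld_divide subfld_diff subfld_mult)
  ultimately show ?thesis by blast
qed

text \<open>For z = u + x v, being fixed means 2 x v = 0, so v = 0.\<close>

lemma lower_field_if_fixed:
  assumes "z \<in> L" "conj z = z"
  shows "z \<in> lower_field"
proof -
  obtain u v where uv: "u \<in> lower_field" "v \<in> lower_field" "z = u + x * v"
    using L_decomposition[OF assms(1)] by blast
  have "u \<in> L" "v \<in> L" "x * v \<in> L"
    using uv lower_field_subset_L subfld_mult[OF subfld_gen2] L_mem(2) by blast+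
  then have "conj z = u - x * v"
    using conj_simps(1)[of u "x * v"] conj_simps(2)[of x v] L_mem(2) conj_lower_field uv by simp
  then have "2 * (x * v) = 0"
    using assms(2) uv(3) by (simp add: algebra_simps)
  then have "v = 0"
    using two_ne_0 x_ne_0 by simp
  then show ?thesis
    using uv by simp
qed

text \<open>Substituting x^2 + c pulls the relations at level Suc M back to those at level M; this
  is \<open>dvd_even_odd\<close> with odd part 0. It makes the induction hypothesis applicable to
  the lower field.\<close>

lemma lower_preimage_field: "preimage_field j (x\<^sup>2 + c) c M a"
proof unfold_locales
  fix p
  have "ev2 j (x\<^sup>2 + c) c p = 0 \<longleftrightarrow> preimage_poly (Suc M) a dvd pcompose p quad_poly + [:0, 1:] * pcompose 0 quad_poly"
    using ker[of "pcompose p quad_poly"] by (simp add: ev2_pcompose_quad_poly)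
  also have "\<dots> \<longleftrightarrow> preimage_poly M a dvd p \<and> preimage_poly M a dvd 0"
    unfolding preimage_poly_Suc
    by (rule dvd_even_odd[OF lead_coeff_preimage_poly]) (simp add: degree_preimage_poly)
  finally show "ev2 j (x\<^sup>2 + c) c p = 0 \<longleftrightarrow> preimage_poly M a dvd p"
    by simp
qed (use two simple in \<open>auto simp: crit_simple_def\<close>)

text \<open>The fixed points of the conjugation lie over the critical point \<open>x = 0\<close>.\<close>

lemma fixed_place:
  assumes c0: "poly (crit_poly (Suc M) a) c0 = 0"
  shows "\<exists>P\<in>places j L. val j P c c0 \<and> (\<forall>z\<in>P. \<forall>s. val j P z s \<longrightarrow> val j P (conj z) s)"
proof -
  interpret const: ring_map "fps_const :: 'k \<Rightarrow> 'k fps" by (rule ring_map_fps_const)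
  obtain \<eta> where \<eta>0: "fps_nth \<eta> 0 = c0" and even: "\<eta> oo - fps_X = \<eta>"
    and series: "\<And>p. ev2 fps_const fps_X \<eta> p = 0 \<longleftrightarrow> preimage_poly (Suc M) a dvd p"
    using even_series[OF simple c0] by metis
  define neg where "neg f = f oo (- fps_X)" for f :: "'k fps"
  have neg_map: "ring_map neg"
    unfolding neg_def[abs_def] by (rule ring_map_fps_compose) simp
  interpret neg: ring_map neg by fact
  have neg_const: "neg (fps_const b) = fps_const b" for b
    by (simp add: neg_def)
  have neg_X: "neg fps_X = - fps_X"
    by (simp add: neg_def)
  have neg_\<eta>: "neg \<eta> = \<eta>"
    by (simp add: neg_def even)
  let ?P = "series_place fps_X \<eta>"
  have P: "?P \<in> places j L"
    by (rule series_place_in_places[OF series])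
  interpret P: place j L ?P
    by unfold_locales (simp_all add: P subfld_gen2)
  have "val j ?P c (fps_nth \<eta> 0)"
    by (rule val_series_place[OF series L_mem(3) expansion_c[OF series]])
  then have vc: "val j ?P c c0"
    by (simp add: \<eta>0)
  \<comment> \<open>On expansions the conjugation acts as s |-> -s, because x = s changes sign and
    \<open>\<eta>\<close> is even. The constant term, which is the residue, stays the same.\<close>
  have "val j ?P (conj z) s" if zP: "z \<in> ?P" and zs: "val j ?P z s" for z s
  proof -
    have "z \<in> L"
      using zP P.sub by blast
    obtain f where f: "expansion fps_X \<eta> z = fps_to_fls f"
      using zP by (auto simp: series_place_def)
    have "fps_nth f 0 = s"
      using P.val_unique val_series_place[OF series \<open>z \<in> L\<close> f] zs by blast
    obtain p q where z: "z = ev2 j x c p / ev2 j x c q" "ev2 j x c q \<noteq> 0"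
      using \<open>z \<in> L\<close> unfolding gen2_def by (rule fractionsE)
    let ?e = "ev2 fps_const fps_X \<eta>" and ?n = "\<lambda>p. pcompose p [:0, - 1:]"
    have en: "?e (?n p) = neg (?e p)" for p
      using const.comp_ev2[OF neg_map, of fps_X \<eta> p] const.ev2_neg[of fps_X \<eta> p]
      by (simp add: neg_X neg_\<eta> neg_const)
    have tr: "expansion fps_X \<eta> (ev2 j x c p / ev2 j x c q) = fps_to_fls (?e p) / fps_to_fls (?e q)"
      if "ev2 j x c q \<noteq> 0" for p q
      unfolding expansion_def
      using same_kernel.transfer_fraction[OF same_kernel_series[OF series] that, of p]
      by (simp add: series_eval_def)
    have eq0: "?e q \<noteq> 0"
      using z(2) by (simp add: series ker)
    then have "fps_to_fls (?e p) = fps_to_fls f * fps_to_fls (?e q)"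
      using f tr[OF z(2), of p] z(1) by (simp add: field_simps)
    then have pf: "?e p = f * ?e q"
      by (simp flip: fls_times_fps_to_fls)
    have q: "ev2 j x c (?n q) \<noteq> 0"
      using z(2) same_kernel.kernel[OF same_kernel_conj, of q] by (simp add: ev2_neg)
    have "conj z = ev2 j x c (?n p) / ev2 j x c (?n q)"
      unfolding z(1) conj_fraction[OF z(2)] by (simp only: ev2_neg)
    then have "expansion fps_X \<eta> (conj z) = fps_to_fls (?e (?n p)) / fps_to_fls (?e (?n q))"
      using tr[OF q] by simp
    also have "?e (?n p) = neg f * ?e (?n q)"
      unfolding en pf by simp
    also have "fps_to_fls (neg f * ?e (?n q)) / fps_to_fls (?e (?n q)) = fps_to_fls (neg f)"
      using q by (simp add: series ker fls_times_fps_to_fls)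
    finally have "expansion fps_X \<eta> (conj z) = fps_to_fls (neg f)" .
    from val_series_place[OF series conj_mem[OF \<open>z \<in> L\<close>] this] show ?thesis
      using \<open>fps_nth f 0 = s\<close> by (simp add: neg_def)
  qed
  then show ?thesis
    using P vc by blast
qed

end

theorem degree_lower_bound:
  assumes "preimage_field j x c N a" "N \<ge> 2" "h \<in> gen2 j x c" "h \<notin> range j"
    and "vdim n (gen j h) (gen2 j x c)"
  shows "2 ^ (N - 2) \<le> n"
  using assms(2,1,3-)
proof (induction N arbitrary: x n rule: nat_induct_at_least)
  case base
  interpret preimage_field j x c 2 a by fact
  \<comment> \<open>For N = 2 the bound is 2^0 = 1.\<close>
  have "n > 0"
    by (rule vdim_pos[OF subfld_gen base(4) subfld_1[OF subfld_gen2]])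
  then show ?case by simp
next
  case (Suc N)
  interpret preimage_field_Suc j x c N a
    using Suc.prems(1) by (simp add: preimage_field_Suc_def)
  obtain K where K: "N = Suc (Suc K)"
    using Suc.hyps by (metis add_2_eq_Suc le_Suc_ex)
  note h = Suc.prems(2,3) and hdim = Suc.prems(4)
  have hL: "gen j h \<subseteq> L"
    by (intro gen_subset subfld_gen2 range_subset_gen2 h)
  show ?case
  proof (cases "conj h = h")
    \<comment> \<open>The index m of the lower field in L is at least 2, since for m = 1 the element
      x would be fixed. This factor is the gain from level N to Suc N.\<close>
    case True
    then have h': "h \<in> lower_field"
      using lower_field_if_fixed h by blast
    have "gen j h \<subseteq> lower_field"
      by (intro gen_subset subfld_gen2 range_subset_gen2 h')
    then obtain e m where em: "vdim e (gen j h) lower_field" "vdim m lower_field L" "n = e * m"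
      by (rule vdim_tower_split[OF subfld_gen subfld_gen2 subfld_gen2 _ lower_field_subset_L hdim])
    have e: "2 ^ (N - 2) \<le> e"
      using Suc.IH[OF lower_preimage_field h' h(2) em(1)] .
    have "m > 0"
      by (rule vdim_pos[OF subfld_gen2 em(2) subfld_1[OF subfld_gen2]])
    moreover have "m \<noteq> 1"
    proof
      assume "m = 1"
      then have "L \<subseteq> lower_field"
        using vdim_1_eq[OF subfld_gen2 _ subfld_1[OF subfld_gen2]] em(2) by blast
      then have "conj x = x"
        using conj_lower_field L_mem(2) by blast
      then have "- x = x"
        by (simp only: conj_x)
      then have "2 * x = 0"
        by (metis add.right_inverse mult_2)
      then show False
        using two_ne_0 x_ne_0 by simp
    qed
    ultimately have "2 \<le> m"
      by simp
    have "2 ^ (N - 2) * 2 \<le> e * m"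
      using e \<open>2 \<le> m\<close> by (rule mult_le_mono)
    moreover have "2 ^ (Suc N - 2) = 2 ^ (N - 2) * (2 :: nat)"
      by (simp add: K)
    ultimately show ?thesis
      using em(3) by simp
  next
    case False
    obtain t d where t: "t \<in> L" "t \<notin> range j" "vdim d (gen j t) L"
      using small_degree_function Suc.hyps by auto
    interpret function_field_in_one_variable j L t d
      by unfold_locales (auto simp: subfld_gen2 range_subset_gen2[THEN subsetD] t)
    \<comment> \<open>The parameters below the points with x = 0. By \<open>simple\<close> they are
      2^N distinct values, 2^N being the degree of \<open>crit_poly (Suc N) a\<close>.\<close>
    define B where "B = {b. poly (crit_poly (Suc N) a) b = 0}"
    have "crit_poly (Suc N) a \<noteq> 0"
      using degree_crit_poly_Suc[of N a] by auto
    then have "card B = 2 ^ N"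
      using card_simple_roots[of "crit_poly (Suc N) a"] simple
      by (auto simp: B_def crit_simple_def degree_crit_poly_Suc)
    have "\<forall>b\<in>B. \<exists>P\<in>places j L. val j P c b \<and> (\<forall>z\<in>P. \<forall>s. val j P z s \<longrightarrow> val j P (conj z) s)"
      using fixed_place by (auto simp: B_def)
    then obtain f where f: "\<And>b. b \<in> B \<Longrightarrow> f b \<in> places j L" "\<And>b. b \<in> B \<Longrightarrow> val j (f b) c b"
        "\<And>b z s. b \<in> B \<Longrightarrow> z \<in> f b \<Longrightarrow> val j (f b) z s \<Longrightarrow> val j (f b) (conj z) s"
      by metis
    have "inj_on f B"
    proof (rule inj_onI)
      fix b b' assume "b \<in> B" "b' \<in> B" "f b = f b'"
      then show "b = b'"
        using val_c_unique[OF f(1)[of b] f(2)[of b]] f(2)[of b'] by simp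
    qed
    define Z where "Z = f ` B"
    have cardZ: "card Z = 2 ^ N"
      using \<open>inj_on f B\<close> \<open>card B = 2 ^ N\<close> by (simp add: Z_def card_image)
    have Z: "finite Z" "Z \<subseteq> places j L"
    proof -
      show "finite Z"
        using cardZ by (intro card_ge_0_finite) simp
      show "Z \<subseteq> places j L"
        using f(1) by (auto simp: Z_def)
    qed
    \<comment> \<open>At a fixed place where h has a pole there is no residue to compare, so the
      poles are moved off Z first. The field generated by h, and with it n, is unchanged.\<close>
    obtain s where s: "h \<noteq> j s" "\<And>P. P \<in> Z \<Longrightarrow> inverse (h - j s) \<in> P"
      using regular_moebius[OF Z h(1)] by blast
    define h' where "h' = inverse (h - j s)"
    have "h - j s \<in> L"
      using h L_mem subfld_diff[OF subfld_gen2] by blast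
    then have h'L: "h' \<in> L"
      unfolding h'_def by (rule subfld_inverse[OF subfld_gen2])
    have gen_h': "gen j h' = gen j h"
      by (simp add: h'_def gen_inverse gen_diff)
    have h_eq: "h = inverse h' + j s"
      by (simp add: h'_def)
    have "h' \<notin> range j"
    proof
      assume "h' \<in> range j"
      then have "h \<in> range j"
        unfolding h_eq by (auto simp flip: inverse add)
      then show False
        using h by blast
    qed
    define g where "g = conj h'"
    have gL: "g \<in> L"
      by (simp add: g_def conj_mem h'L)
    define w where "w = h' - g"
    have wL: "w \<in> L"
      unfolding w_def by (intro subfld_diff subfld_gen2 h'L gL)
    have "g \<noteq> h'"
    proof
      assume "g = h'"
      then have "conj h = h"
        using h_eq conj_simps(1)[of "inverse h'" "j s"] conj_simps(5)[OF h'L] h'L L_mem(1)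
          subfld_inverse[OF subfld_gen2] by (simp add: g_def)
      then show False
        using False by blast
    qed
    \<comment> \<open>Conjugation sends w to -w, so a constant w would be 0 and h' would be
      fixed.\<close>
    have "w \<notin> range j"
    proof
      assume "w \<in> range j"
      then have "conj w = w"
        by auto
      moreover have "conj w = - w"
        using conj_simps(4)[OF h'L gL] conj_conj[OF h'L] by (simp add: w_def g_def)
      ultimately have "2 * w = 0"
        by (metis add.right_inverse mult_2)
      then show False
        using two_ne_0 \<open>g \<noteq> h'\<close> by (simp add: w_def)
    qed
    have zeros: "w \<in> nonunits P" if PZ: "P \<in> Z" for P
    proof -
      obtain b where b: "b \<in> B" "P = f b"
        using PZ by (auto simp: Z_def)
      have P: "P \<in> places j L"
        using PZ Z by blast
      interpret P: place j L P
        using placeI[OF P] .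
      have "h' \<in> P"
        using s(2)[OF PZ] by (simp add: h'_def)
      then obtain r where r: "val j P h' r"
        using residue_field[OF P] by blast
      then have "val j P g r"
        unfolding g_def using f(3) b \<open>h' \<in> P\<close> by blast
      then have "val j P w (r - r)"
        unfolding w_def using r by (intro P.val_diff)
      then show ?thesis
        by (simp add: P.val_0_iff)
    qed
    \<comment> \<open>The degree of w is controlled over K(h', w) only. This field may be smaller
      than L, and the index m then multiplies the degrees of h' and w alike: card Z is at most d' m,
      which is at most 2 e m = 2 n.\<close>
    let ?E = "gen2 j h' w"
    have EL: "?E \<subseteq> L"
      by (intro gen2_subset subfld_gen2 range_subset_gen2 h'L wL)
    have hE: "gen j h' \<subseteq> ?E"
      by (intro gen_subset subfld_gen2 range_subset_gen2 gen2_mem)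
    obtain e m where em: "vdim e (gen j h') ?E" "vdim m ?E L" "n = e * m"
      by (rule vdim_tower_split[OF subfld_gen subfld_gen2 subfld_gen2 hE EL hdim[folded gen_h']])
    have sym: "ev2 j h' g p = 0" if "ev2 j g h' p = 0" for p
    proof -
      have "conj (ev2 j g h' p) = ev2 j h' g p"
        using conj_ev2[OF gL h'L] conj_conj[OF h'L] by (simp add: g_def)
      then show ?thesis
        using that conj_const[of 0] by simp
    qed
    obtain d' where d': "d' \<le> 2 * e" "vdim d' (gen j w) ?E"
      using degree_difference[of h' g e, folded w_def, OF \<open>h' \<notin> range j\<close> \<open>w \<notin> range j\<close> em(1) sym] by blast
    have "vdim (d' * m) (gen j w) L"
      by (rule vdim_tower[OF subfld_gen subfld_gen2 d'(2) em(2)])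
    then have "card Z \<le> d' * m"
      using card_zeros_le_degree[OF wL \<open>w \<notin> range j\<close> _ Z zeros] by blast
    also have "\<dots> \<le> 2 * n"
      using d'(1) em(3) by (simp add: mult.assoc[symmetric])
    finally have "2 ^ N \<le> 2 * n"
      by (simp add: cardZ)
    moreover have "2 ^ N = 2 * (2 :: nat) ^ (Suc N - 2)"
      by (simp add: K)
    ultimately show ?thesis
      by simp
  qed
qed

section \<open>The projective line\<close>

abbreviation (input) finite_point :: "'k::field \<Rightarrow> ('k \<times> 'k) set" where
  "finite_point s \<equiv> hom_point s 1"

abbreviation (input) infinite_point :: "('k::field \<times> 'k) set" where
  "infinite_point \<equiv> hom_point 1 0"

lemma hom_point_scale: "l \<noteq> 0 \<Longrightarrow> hom_point (l * u) (l * v) = hom_point u (v :: 'k::field)"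
proof
  assume l: "l \<noteq> 0"
  show "hom_point (l * u) (l * v) \<subseteq> hom_point u v"
    unfolding hom_point_def using l by (auto simp: mult.assoc[symmetric])
  show "hom_point u v \<subseteq> hom_point (l * u) (l * v)"
  proof
    fix p assume "p \<in> hom_point u v"
    then obtain k where k: "k \<noteq> 0" "p = (k * u, k * v)"
      by (auto simp: hom_point_def)
    then have "p = ((k / l) * (l * u), (k / l) * (l * v))" "k / l \<noteq> 0"
      using l by auto
    then show "p \<in> hom_point (l * u) (l * v)"
      unfolding hom_point_def by blast
  qed
qed

lemma hom_point_finite: "v \<noteq> 0 \<Longrightarrow> hom_point u v = finite_point (u / v)"
  using hom_point_scale[of v "u / v" 1] by simp

lemma hom_point_infinite: "u \<noteq> 0 \<Longrightarrow> hom_point u 0 = infinite_point"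
  using hom_point_scale[of u 1 0] by simp

lemma hom_point_self: "(u, v) \<in> hom_point u v"
  unfolding hom_point_def by (auto intro: exI[of _ 1])

lemma finite_point_eq_iff [simp]: "hom_point s 1 = hom_point s' 1 \<longleftrightarrow> s = (s' :: 'k::field)"
proof
  assume "hom_point s 1 = hom_point s' 1"
  then have "(s, 1) \<in> hom_point s' 1"
    using hom_point_self by metis
  then show "s = s'"
    by (auto simp: hom_point_def)
qed auto

lemma finite_point_ne_infinite_point [simp]:
  "hom_point s 1 \<noteq> hom_point 1 (0 :: 'k::field)" "hom_point 1 0 \<noteq> hom_point s (1 :: 'k)"
proof -
  have "(s, 1) \<notin> hom_point 1 (0 :: 'k)"
    by (auto simp: hom_point_def)
  then show "hom_point s 1 \<noteq> hom_point 1 (0 :: 'k)" "hom_point 1 0 \<noteq> hom_point s (1 :: 'k)"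
    using hom_point_self[of s 1] by metis+
qed

lemma proj_line_eq: "proj_line = insert infinite_point (range finite_point)"
proof
  show "proj_line \<subseteq> insert infinite_point (range (finite_point :: 'a \<Rightarrow> _))"
  proof
    fix Q :: "('a \<times> 'a) set" assume "Q \<in> proj_line"
    then obtain u v where "Q = hom_point u v" "(u, v) \<noteq> (0, 0)"
      by (auto simp: proj_line_def)
    then show "Q \<in> insert infinite_point (range (finite_point :: 'a \<Rightarrow> _))"
      using hom_point_finite[of v u] hom_point_infinite[of u] by (cases "v = 0") auto
  qed
  have "infinite_point \<in> (proj_line :: ('a \<times> 'a) set set)"
    unfolding proj_line_def by (rule CollectI, rule exI[of _ 1], rule exI[of _ 0]) simp
  moreover have "finite_point s \<in> (proj_line :: ('a \<times> 'a) set set)" for s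
    unfolding proj_line_def by (rule CollectI, rule exI[of _ s], rule exI[of _ 1]) simp
  ultimately show "insert infinite_point (range finite_point) \<subseteq> (proj_line :: ('a \<times> 'a) set set)"
    by auto
qed

lemma proj_line_cases:
  assumes "Q \<in> proj_line"
  obtains s where "Q = finite_point s" | "Q = infinite_point"
  using assms unfolding proj_line_eq by auto

definition form_poly :: "nat \<Rightarrow> (nat \<Rightarrow> 'k::field) \<Rightarrow> 'k poly" where
  "form_poly d b = (\<Sum>i\<le>d. monom (b i) i)"

lemma coeff_form_poly: "coeff (form_poly d b) i = (if i \<le> d then b i else 0)"
  unfolding form_poly_def coeff_sum by (simp add: coeff_monom)

lemma degree_form_poly: "degree (form_poly d b) \<le> d"
  by (rule degree_le) (simp add: coeff_form_poly)

lemma binary_form_finite: "binary_form d b s 1 = poly (form_poly d b) s"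
  unfolding binary_form_def form_poly_def poly_sum by (simp add: poly_monom)

lemma binary_form_infinite: "binary_form d b 1 0 = b d"
proof -
  have "binary_form d b 1 0 = (\<Sum>i\<le>d. if i = d then b i else 0)"
    unfolding binary_form_def by (rule sum.cong) (auto simp: power_0_left)
  then show ?thesis
    by simp
qed

lemma binary_form_scale: "binary_form d b (l * u) (l * v) = l ^ d * binary_form d b u v"
  unfolding binary_form_def sum_distrib_left
proof (rule sum.cong)
  fix i assume "i \<in> {..d}"
  then have "l ^ d = l ^ i * l ^ (d - i)"
    by (simp flip: power_add)
  then show "b i * (l * u) ^ i * (l * v) ^ (d - i) = l ^ d * (b i * u ^ i * v ^ (d - i))"
    by (simp add: power_mult_distrib)
qed auto

lemma binary_form_coeff:
  assumes "degree q \<le> d" "v \<noteq> 0"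
  shows "binary_form d (coeff q) u v = v ^ d * poly q (u / v)"
proof -
  have "form_poly d (coeff q) = q"
    using assms(1) by (intro poly_eqI) (auto simp: coeff_form_poly coeff_eq_0)
  then show ?thesis
    using binary_form_scale[of d "coeff q" v "u / v" 1] assms(2) by (simp add: binary_form_finite)
qed

lemma form_poly_nonzero:
  assumes "binary_form d b u v \<noteq> 0"
  shows "form_poly d b \<noteq> 0"
proof
  assume 0: "form_poly d b = 0"
  have "b i = 0" if "i \<le> d" for i
    using arg_cong[OF 0, of "\<lambda>p. coeff p i"] that by (simp add: coeff_form_poly)
  then have "binary_form d b u v = 0"
    unfolding binary_form_def by (intro sum.neutral) auto
  then show False
    using assms by simp
qed

text \<open>One form in S that is nonzero somewhere already confines Z to infinity and the finitely
  many roots of its dehomogenisation.\<close>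

lemma proj_line_closed_cases:
  assumes "proj_line_closed Z"
  shows "Z = proj_line \<or> (finite Z \<and> Z \<subseteq> proj_line)"
proof -
  obtain S where Z: "Z = {hom_point u v | u v.
      (u, v) \<noteq> (0, 0) \<and> (\<forall>(d, b) \<in> S. binary_form d b u v = 0)}"
    using assms unfolding proj_line_closed_def by blast
  have sub: "Z \<subseteq> proj_line"
    unfolding Z proj_line_def by blast
  show ?thesis
  proof (cases "\<exists>d b u v. (d, b) \<in> S \<and> binary_form d b u v \<noteq> 0")
    case True
    then obtain d b u v where db: "(d, b) \<in> S" "binary_form d b u v \<noteq> 0"
      by blast
    have "Z \<subseteq> insert infinite_point (finite_point ` {s. poly (form_poly d b) s = 0})"
    proof
      fix Q assume "Q \<in> Z"
      then obtain u v where uv: "Q = hom_point u v" "(u, v) \<noteq> (0, 0)" "binary_form d b u v = 0"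
        unfolding Z using db(1) by auto
      show "Q \<in> insert infinite_point (finite_point ` {s. poly (form_poly d b) s = 0})"
      proof (cases "v = 0")
        case True
        then show ?thesis
          using uv hom_point_infinite[of u] by auto
      next
        case False
        have "v ^ d * binary_form d b (u / v) 1 = 0"
          using binary_form_scale[of d b v "u / v" 1] False uv(3) by simp
        then have "poly (form_poly d b) (u / v) = 0"
          using False by (simp add: binary_form_finite)
        then show ?thesis
          using uv(1) hom_point_finite[OF False] by auto
      qed
    qed
    moreover have "finite {s. poly (form_poly d b) s = 0}"
      using form_poly_nonzero[OF db(2)] by (rule poly_roots_finite)
    ultimately have "finite Z"
      by (meson finite.insertI finite_imageI finite_subset)
    then show ?thesis
      using sub by blast
  next
    case False
    then have "\<forall>(d, b) \<in> S. binary_form d b u v = 0" for u v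
      by auto
    then have "Z = proj_line"
      unfolding Z proj_line_def by simp
    then show ?thesis by blast
  qed
qed

lemma proj_line_closed_form:
  "proj_line_closed {hom_point u v | u v. (u, v) \<noteq> (0, 0) \<and> binary_form d b u v = 0}"
  unfolding proj_line_closed_def by (rule exI[of _ "{(d, b)}"]) simp

lemma proj_line_closed_singleton:
  assumes "Q \<in> proj_line"
  shows "proj_line_closed {Q :: ('k::field \<times> 'k) set}"
proof -
  obtain u0 v0 :: 'k where Q: "Q = hom_point u0 v0" "(u0, v0) \<noteq> (0, 0)"
    using assms by (auto simp: proj_line_def)
  \<comment> \<open>Coefficients of the linear form v0 u - u0 v.\<close>
  define b where "b i = (if i = 0 then - u0 else v0)" for i :: nat
  have form: "binary_form 1 b u v = v0 * u - u0 * v" for u v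
    by (simp add: binary_form_def b_def)
  have "{hom_point u v | u v. (u, v) \<noteq> (0, 0) \<and> binary_form 1 b u v = 0} = {Q}"
  proof (intro equalityI subsetI)
    fix R assume "R \<in> {hom_point u v | u v. (u, v) \<noteq> (0, 0) \<and> binary_form 1 b u v = 0}"
    then obtain u v where R: "R = hom_point u v" "(u, v) \<noteq> (0, 0)" and "binary_form 1 b u v = 0"
      by blast
    then have eq: "v0 * u = u0 * v"
      unfolding form by simp
    show "R \<in> {Q}"
    proof (cases "v0 = 0")
      case True
      then have "v = 0"
        using eq Q(2) by auto
      then show ?thesis
        using R Q True hom_point_infinite[of u] hom_point_infinite[of u0] by auto
    next
      case False
      then have "v \<noteq> 0"
        using eq R(2) by auto
      moreover have "u / v = u0 / v0"
        using eq False \<open>v \<noteq> 0\<close> by (simp add: field_simps)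
      ultimately show ?thesis
        using R(1) Q(1) False hom_point_finite[of v u] hom_point_finite[of v0 u0] by simp
    qed
  next
    fix R assume "R \<in> {Q}"
    then show "R \<in> {hom_point u v | u v. (u, v) \<noteq> (0, 0) \<and> binary_form 1 b u v = 0}"
      unfolding form using Q
      by (intro CollectI exI[of _ u0] exI[of _ v0]) (auto simp: mult.commute)
  qed
  then show ?thesis
    using proj_line_closed_form[of 1 b] by simp
qed

lemma proj_line_open_cofinite:
  assumes "proj_line_open V" "V \<noteq> {}"
  shows "finite (proj_line - V)"
  using assms proj_line_closed_cases[of "proj_line - V"] unfolding proj_line_open_def by blast

text \<open>A basic open set of the affine chart, never containing infinity; for q = 1 it is the
  whole affine line.\<close>

definition nonvanishing :: "'k::field poly \<Rightarrow> ('k \<times> 'k) set set" where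
  "nonvanishing q = {finite_point s | s. poly q s \<noteq> 0}"

lemma proj_line_open_nonvanishing: "proj_line_open (nonvanishing q)"
proof -
  define d where "d = degree q"
  have dq: "degree q \<le> d"
    by (simp add: d_def)
  \<comment> \<open>Read as a form of degree d + 1, the homogenisation of q acquires a factor v,
    which puts infinity into the zero set.\<close>
  define b where "b i = (if i \<le> d then coeff q i else 0)" for i
  have form: "binary_form (Suc d) b u v = v * binary_form d (coeff q) u v" for u v
  proof -
    have "binary_form (Suc d) b u v = (\<Sum>i\<le>d. b i * u ^ i * v ^ (Suc d - i))"
      unfolding binary_form_def by (simp add: b_def)
    also have "\<dots> = v * binary_form d (coeff q) u v"
      unfolding binary_form_def sum_distrib_left
      by (rule sum.cong) (auto simp: b_def Suc_diff_le)
    finally show ?thesis .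
  qed
  have "proj_line - nonvanishing q =
      {hom_point u v | u v. (u, v) \<noteq> (0, 0) \<and> binary_form (Suc d) b u v = 0}" (is "_ = ?Z")
  proof (intro equalityI subsetI)
    fix Q assume Q: "Q \<in> proj_line - nonvanishing q"
    then have "Q \<in> proj_line" by simp
    then show "Q \<in> ?Z"
    proof (cases rule: proj_line_cases)
      case (1 s)
      then have "poly q s = 0"
        using Q by (auto simp: nonvanishing_def)
      then have "binary_form (Suc d) b s 1 = 0"
        using binary_form_coeff[of q d 1 s] dq by (simp add: form)
      then show ?thesis
        using 1 by (intro CollectI exI[of _ s] exI[of _ 1]) simp
    next
      case 2
      then show ?thesis
        by (intro CollectI exI[of _ 1] exI[of _ 0]) (simp add: form)
    qed
  next
    fix Q assume "Q \<in> ?Z"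
    then obtain u v where uv: "Q = hom_point u v" "(u, v) \<noteq> (0, 0)" "binary_form (Suc d) b u v = 0"
      by blast
    have "Q \<in> proj_line"
      using uv unfolding proj_line_def by blast
    moreover have "Q \<notin> nonvanishing q"
    proof
      assume "Q \<in> nonvanishing q"
      then obtain s where s: "Q = finite_point s" "poly q s \<noteq> 0"
        by (auto simp: nonvanishing_def)
      have "v \<noteq> 0"
        using uv s hom_point_infinite[of u] by auto
      then have "poly q (u / v) = 0"
        using uv(3) binary_form_coeff[OF dq, of v u] by (simp add: form)
      moreover have "u / v = s"
        using uv(1) s(1) hom_point_finite[OF \<open>v \<noteq> 0\<close>] by simp
      ultimately show False
        using s by simp
    qed
    ultimately show "Q \<in> proj_line - nonvanishing q"
      by blast
  qed
  then have "proj_line_closed (proj_line - nonvanishing q)"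
    using proj_line_closed_form[of "Suc d" b] by simp
  then show ?thesis
    unfolding proj_line_open_def nonvanishing_def proj_line_eq by auto
qed

text \<open>At infinity the description has no solution and the value is unspecified; the function
  is evaluated only on \<open>nonvanishing q\<close>.\<close>

definition ratio_function :: "'k::field poly \<Rightarrow> 'k poly \<Rightarrow> ('k \<times> 'k) set \<Rightarrow> 'k" where
  "ratio_function p q Q = (let s = (THE s. Q = finite_point s) in poly p s / poly q s)"

lemma ratio_function_finite_point [simp]: "ratio_function p q (hom_point s 1) = poly p s / poly q s"
  unfolding ratio_function_def by simp

lemma proj_line_regular_ratio_function: "proj_line_regular_on (nonvanishing q) (ratio_function p q)"
  unfolding proj_line_regular_on_def
proof
  fix Q assume Q: "Q \<in> nonvanishing q"
  define d where "d = max (degree p) (degree q)"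
  have *: "binary_form d (coeff q) u v \<noteq> 0 \<and>
      ratio_function p q (hom_point u v) = binary_form d (coeff p) u v / binary_form d (coeff q) u v"
    if uv: "hom_point u v \<in> nonvanishing q" "(u, v) \<noteq> (0, 0)" for u v
  proof -
    obtain s where s: "hom_point u v = finite_point s" "poly q s \<noteq> 0"
      using uv by (auto simp: nonvanishing_def)
    have "v \<noteq> 0"
      using uv s hom_point_infinite[of u] by auto
    moreover have "u / v = s"
      using s(1) hom_point_finite[OF \<open>v \<noteq> 0\<close>] by simp
    ultimately show ?thesis
      using s binary_form_coeff[of p d v u] binary_form_coeff[of q d v u] by (simp add: d_def)
  qed
  show "\<exists>U. proj_line_open U \<and> Q \<in> U \<and> U \<subseteq> nonvanishing q \<and>
        (\<exists>d A B. \<forall>u v. (u, v) \<noteq> (0, 0) \<and> hom_point u v \<in> U \<longrightarrow>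
            binary_form d B u v \<noteq> 0 \<and>
            ratio_function p q (hom_point u v) = binary_form d A u v / binary_form d B u v)"
    by (rule exI[of _ "nonvanishing q"]) (use Q * proj_line_open_nonvanishing in blast)
qed

text \<open>A local quotient of forms read in the affine coordinate and at infinity. Both forms have
  the same degree d, so the value at infinity is the quotient of the coefficients of index
  d.\<close>

lemma proj_line_regularE:
  assumes "proj_line_regular_on V g" "Q \<in> V"
  obtains U d A B where "proj_line_open U" "Q \<in> U" "U \<subseteq> V" "form_poly d B \<noteq> 0"
    "\<And>s. finite_point s \<in> U \<Longrightarrow> poly (form_poly d B) s \<noteq> 0 \<and>
        g (finite_point s) = poly (form_poly d A) s / poly (form_poly d B) s"
    "infinite_point \<in> U \<Longrightarrow> B d \<noteq> 0 \<and> g infinite_point = A d / B d"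
proof -
  obtain U d A B where U: "proj_line_open U" "Q \<in> U" "U \<subseteq> V"
    and g: "\<And>u v. (u, v) \<noteq> (0, 0) \<Longrightarrow> hom_point u v \<in> U \<Longrightarrow> binary_form d B u v \<noteq> 0 \<and>
            g (hom_point u v) = binary_form d A u v / binary_form d B u v"
    using assms unfolding proj_line_regular_on_def by metis
  have fin: "poly (form_poly d B) s \<noteq> 0 \<and> g (finite_point s) = poly (form_poly d A) s / poly (form_poly d B) s"
    if "finite_point s \<in> U" for s
    using g[of s 1] that by (simp add: binary_form_finite)
  have inf: "B d \<noteq> 0 \<and> g infinite_point = A d / B d" if "infinite_point \<in> U"
    using g[of 1 0] that by (simp add: binary_form_infinite)
  have "Q \<in> proj_line"
    using U unfolding proj_line_open_def by blast
  then obtain u v where "Q = hom_point u v" "(u, v) \<noteq> (0, 0)"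
    by (auto simp: proj_line_def)
  then have "form_poly d B \<noteq> 0"
    using g[of u v] U(2) form_poly_nonzero by blast
  then show ?thesis
    using that[OF U] fin inf by blast
qed

section \<open>The function field as a field of fractions\<close>

lemma poly_ring_simps:
  "carrier (ring_of_type_algebra :: 'r::comm_ring_1 ring) = UNIV"
  "p \<otimes>\<^bsub>ring_of_type_algebra\<^esub> q = p * (q :: 'r)" "p \<oplus>\<^bsub>ring_of_type_algebra\<^esub> q = p + (q :: 'r)"
  "\<one>\<^bsub>ring_of_type_algebra\<^esub> = (1 :: 'r)" "\<zero>\<^bsub>ring_of_type_algebra\<^esub> = (0 :: 'r)"
  by (simp_all add: ring_of_type_algebra_def)

context preimage_field
begin

abbreviation "CR \<equiv> coordinate_ring N a"
abbreviation "F \<equiv> function_field N a"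
abbreviation "\<iota> \<equiv> constant_function N a"

definition coset_of :: "'k poly poly \<Rightarrow> 'k poly poly set" where
  "coset_of p = preimage_ideal N a +>\<^bsub>ring_of_type_algebra\<^esub> p"

text \<open>All pairs of cosets that represent z. By \<open>frac_class_coset_of\<close> this is the
  very equivalence class that \<open>fraction_field\<close> uses, so \<open>frac_of\<close>
  identifies L with the function field of the statement.\<close>

definition frac_of :: "'f \<Rightarrow> ('k poly poly set \<times> 'k poly poly set) set" where
  "frac_of z = {(coset_of p, coset_of q) | p q. ev2 j x c q \<noteq> 0 \<and> z = ev2 j x c p / ev2 j x c q}"

lemma coset_of_eq: "coset_of p = {q * preimage_poly N a + p | q. True}"
  unfolding coset_of_def preimage_ideal_def a_r_coset_def' cgenideal_def by (auto simp: poly_ring_simps)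

lemma coset_of_eq_iff: "coset_of p = coset_of q \<longleftrightarrow> ev2 j x c p = ev2 j x c q"
proof
  assume eq: "coset_of p = coset_of q"
  have "p \<in> coset_of p"
    unfolding coset_of_eq by (auto intro!: exI[of _ 0])
  then obtain r where "p = r * preimage_poly N a + q"
    unfolding eq unfolding coset_of_eq by auto
  then show "ev2 j x c p = ev2 j x c q"
    using ker[of "preimage_poly N a"] by simp
next
  assume "ev2 j x c p = ev2 j x c q"
  then have "ev2 j x c (p - q) = 0"
    by simp
  then obtain r where r: "p - q = preimage_poly N a * r"
    unfolding ker by blast
  then have p: "p = q + preimage_poly N a * r"
    by (simp add: diff_eq_eq add.commute)
  show "coset_of p = coset_of q"
    unfolding coset_of_eq
  proof (intro equalityI subsetI)
    fix s assume "s \<in> {t * preimage_poly N a + p | t. True}"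
    then obtain t where "s = t * preimage_poly N a + p" by blast
    then have "s = (t + r) * preimage_poly N a + q"
      unfolding p by (simp add: algebra_simps)
    then show "s \<in> {t * preimage_poly N a + q | t. True}" by blast
  next
    fix s assume "s \<in> {t * preimage_poly N a + q | t. True}"
    then obtain t where "s = t * preimage_poly N a + q" by blast
    then have "s = (t - r) * preimage_poly N a + p"
      unfolding p by (simp add: algebra_simps)
    then show "s \<in> {t * preimage_poly N a + p | t. True}" by blast
  qed
qed

lemma coset_of_hom: "coset_of \<in> ring_hom ring_of_type_algebra CR"
proof -
  interpret PR: cring "ring_of_type_algebra :: 'k poly poly ring"
    by (rule cring_from_type_algebra)
  have "ideal (preimage_ideal N a) (ring_of_type_algebra :: 'k poly poly ring)"
    unfolding preimage_ideal_def by (rule PR.cgenideal_ideal) (simp add: poly_ring_simps)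
  from ideal.rcos_ring_hom[OF this] show ?thesis
    unfolding coordinate_ring_def coset_of_def[abs_def] .
qed

lemma CR_simps:
  "carrier CR = range coset_of"
  "coset_of p \<otimes>\<^bsub>CR\<^esub> coset_of q = coset_of (p * q)" "coset_of p \<oplus>\<^bsub>CR\<^esub> coset_of q = coset_of (p + q)"
  "\<one>\<^bsub>CR\<^esub> = coset_of 1" "\<zero>\<^bsub>CR\<^esub> = coset_of 0"
proof -
  show "carrier CR = range coset_of"
    unfolding coordinate_ring_def FactRing_def A_RCOSETS_def' coset_of_def[abs_def]
    by (auto simp: poly_ring_simps)
  show "coset_of p \<otimes>\<^bsub>CR\<^esub> coset_of q = coset_of (p * q)"
    using ring_hom_mult[OF coset_of_hom, of p q] by (simp add: poly_ring_simps)
  show "coset_of p \<oplus>\<^bsub>CR\<^esub> coset_of q = coset_of (p + q)"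
    using ring_hom_add[OF coset_of_hom, of p q] by (simp add: poly_ring_simps)
  show "\<one>\<^bsub>CR\<^esub> = coset_of 1"
    using ring_hom_one[OF coset_of_hom] by (simp add: poly_ring_simps)
  show "\<zero>\<^bsub>CR\<^esub> = coset_of 0"
    unfolding coordinate_ring_def FactRing_def coset_of_eq preimage_ideal_def cgenideal_def
    by (auto simp: poly_ring_simps)
qed

lemma coset_of_eq_0_iff: "coset_of q = \<zero>\<^bsub>CR\<^esub> \<longleftrightarrow> ev2 j x c q = 0"
  by (simp add: CR_simps coset_of_eq_iff)

lemma frac_class_coset_of:
  assumes q: "ev2 j x c q \<noteq> 0"
  shows "frac_class CR (coset_of p) (coset_of q) = frac_of (ev2 j x c p / ev2 j x c q)"
proof -
  have "((coset_of p, coset_of q), (r, s)) \<in> frac_rel CR \<longleftrightarrow>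
      (r, s) \<in> frac_of (ev2 j x c p / ev2 j x c q)" for r s
  proof
    assume "((coset_of p, coset_of q), (r, s)) \<in> frac_rel CR"
    then have rs: "r \<in> carrier CR" "s \<in> carrier CR" "s \<noteq> \<zero>\<^bsub>CR\<^esub>" "coset_of p \<otimes>\<^bsub>CR\<^esub> s = r \<otimes>\<^bsub>CR\<^esub> coset_of q"
      by (auto simp: frac_rel_def)
    then obtain p' q' where p'q': "r = coset_of p'" "s = coset_of q'"
      by (auto simp: CR_simps(1))
    have q': "ev2 j x c q' \<noteq> 0"
      using rs(3) p'q' coset_of_eq_0_iff by blast
    have "ev2 j x c (p * q') = ev2 j x c (p' * q)"
      using rs(4) unfolding p'q' CR_simps(2) coset_of_eq_iff .
    then have "ev2 j x c p / ev2 j x c q = ev2 j x c p' / ev2 j x c q'"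
      using q q' by (simp add: field_simps)
    then show "(r, s) \<in> frac_of (ev2 j x c p / ev2 j x c q)"
      unfolding frac_of_def using p'q' q' by blast
  next
    assume "(r, s) \<in> frac_of (ev2 j x c p / ev2 j x c q)"
    then obtain p' q' where rs: "r = coset_of p'" "s = coset_of q'" and q': "ev2 j x c q' \<noteq> 0"
      and eq: "ev2 j x c p / ev2 j x c q = ev2 j x c p' / ev2 j x c q'"
      unfolding frac_of_def by blast
    have "ev2 j x c (p * q') = ev2 j x c (p' * q)"
      using eq q q' by (simp add: field_simps)
    then have "coset_of p \<otimes>\<^bsub>CR\<^esub> s = r \<otimes>\<^bsub>CR\<^esub> coset_of q"
      unfolding rs CR_simps(2) coset_of_eq_iff .
    then show "((coset_of p, coset_of q), (r, s)) \<in> frac_rel CR"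
      unfolding frac_rel_def using rs q q' coset_of_eq_0_iff by (auto simp: CR_simps(1))
  qed
  then show ?thesis
    unfolding frac_class_def by auto
qed

lemma frac_ofE:
  assumes "r \<in> frac_of z"
  obtains p q where "r = (coset_of p, coset_of q)" "ev2 j x c q \<noteq> 0" "z = ev2 j x c p / ev2 j x c q"
  using assms unfolding frac_of_def by blast

lemma frac_of_nonempty:
  assumes "z \<in> L"
  shows "\<exists>r. r \<in> frac_of z"
proof -
  obtain p q where "z = ev2 j x c p / ev2 j x c q" "ev2 j x c q \<noteq> 0"
    using assms unfolding gen2_def by (rule fractionsE)
  then show ?thesis
    unfolding frac_of_def by blast
qed

lemma frac_of_inj: "inj_on frac_of L"
proof (rule inj_onI)
  fix z w assume zw: "z \<in> L" "w \<in> L" "frac_of z = frac_of w"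
  obtain r where r: "r \<in> frac_of z"
    using frac_of_nonempty zw by blast
  then have r': "r \<in> frac_of w"
    using zw(3) by simp
  obtain p q where pq: "r = (coset_of p, coset_of q)" "z = ev2 j x c p / ev2 j x c q"
    using r by (rule frac_ofE)
  obtain p' q' where pq': "r = (coset_of p', coset_of q')" "w = ev2 j x c p' / ev2 j x c q'"
    using r' by (rule frac_ofE)
  have "ev2 j x c p = ev2 j x c p'" "ev2 j x c q = ev2 j x c q'"
    using pq(1) pq'(1) coset_of_eq_iff by auto
  then show "z = w"
    using pq(2) pq'(2) by simp
qed

lemma carrier_F: "carrier F = frac_of ` L"
proof -
  have "carrier F = {frac_class CR r s | r s. r \<in> carrier CR \<and> s \<in> carrier CR - {\<zero>\<^bsub>CR\<^esub>}}"
    unfolding function_field_def fraction_field_def frac_class_def quotient_def by auto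
  also have "\<dots> = {frac_class CR (coset_of p) (coset_of q) | p q. ev2 j x c q \<noteq> 0}"
  proof (intro equalityI subsetI)
    fix r assume "r \<in> {frac_class CR (coset_of p) (coset_of q) | p q. ev2 j x c q \<noteq> 0}"
    then obtain p q where "r = frac_class CR (coset_of p) (coset_of q)" "coset_of q \<noteq> \<zero>\<^bsub>CR\<^esub>"
      using coset_of_eq_0_iff by auto
    then show "r \<in> {frac_class CR r s | r s. r \<in> carrier CR \<and> s \<in> carrier CR - {\<zero>\<^bsub>CR\<^esub>}}"
      unfolding CR_simps(1) by (intro CollectI exI[of _ "coset_of p"] exI[of _ "coset_of q"]) simp
  qed (use coset_of_eq_0_iff in \<open>auto simp: CR_simps(1)\<close>)
  also have "\<dots> = {frac_of (ev2 j x c p / ev2 j x c q) | p q. ev2 j x c q \<noteq> 0}"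
    using frac_class_coset_of by (intro Collect_cong) metis
  also have "\<dots> = frac_of ` L"
    unfolding gen2_def fractions_def by blast
  finally show ?thesis .
qed

text \<open>The operations of \<open>fraction_field\<close> are unions over all representatives. If
  every choice gives the same set A, the union over the nonempty index set collapses to A.\<close>

lemma UN_frac_of:
  assumes z: "z \<in> L" and w: "w \<in> L"
    and G: "\<And>p q p' q'. ev2 j x c q \<noteq> 0 \<Longrightarrow> ev2 j x c q' \<noteq> 0 \<Longrightarrow> z = ev2 j x c p / ev2 j x c q \<Longrightarrow>
        w = ev2 j x c p' / ev2 j x c q' \<Longrightarrow>
        G (coset_of p) (coset_of q) (coset_of p') (coset_of q') = A"
  shows "(\<Union>(r, s)\<in>frac_of z. \<Union>(r', s')\<in>frac_of w. G r s r' s') = A"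
proof -
  have *: "G r s r' s' = A" if rs: "(r, s) \<in> frac_of z" and rs': "(r', s') \<in> frac_of w" for r s r' s'
  proof -
    obtain p q where "(r, s) = (coset_of p, coset_of q)" "ev2 j x c q \<noteq> 0" "z = ev2 j x c p / ev2 j x c q"
      using rs by (rule frac_ofE)
    moreover obtain p' q' where "(r', s') = (coset_of p', coset_of q')" "ev2 j x c q' \<noteq> 0"
        "w = ev2 j x c p' / ev2 j x c q'"
      using rs' by (rule frac_ofE)
    ultimately show ?thesis
      using G by simp
  qed
  obtain r s r' s' where "(r, s) \<in> frac_of z" "(r', s') \<in> frac_of w"
    using frac_of_nonempty z w by fastforce
  then show ?thesis
    using * by fastforce
qed

lemma F_mult:
  assumes "z \<in> L" "w \<in> L"
  shows "frac_of z \<otimes>\<^bsub>F\<^esub> frac_of w = frac_of (z * w)"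
proof -
  have "frac_of z \<otimes>\<^bsub>F\<^esub> frac_of w =
      (\<Union>(r, s)\<in>frac_of z. \<Union>(r', s')\<in>frac_of w. frac_class CR (r \<otimes>\<^bsub>CR\<^esub> r') (s \<otimes>\<^bsub>CR\<^esub> s'))"
    unfolding function_field_def fraction_field_def by simp
  also have "\<dots> = frac_of (z * w)"
    by (rule UN_frac_of[OF assms]) (simp add: CR_simps(2) frac_class_coset_of)
  finally show ?thesis .
qed

lemma F_add:
  assumes "z \<in> L" "w \<in> L"
  shows "frac_of z \<oplus>\<^bsub>F\<^esub> frac_of w = frac_of (z + w)"
proof -
  have "frac_of z \<oplus>\<^bsub>F\<^esub> frac_of w =
      (\<Union>(r, s)\<in>frac_of z. \<Union>(r', s')\<in>frac_of w.
        frac_class CR (r \<otimes>\<^bsub>CR\<^esub> s' \<oplus>\<^bsub>CR\<^esub> r' \<otimes>\<^bsub>CR\<^esub> s) (s \<otimes>\<^bsub>CR\<^esub> s'))"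
    unfolding function_field_def fraction_field_def by simp
  also have "\<dots> = frac_of (z + w)"
    by (rule UN_frac_of[OF assms])
       (simp add: CR_simps(2,3) frac_class_coset_of add_frac_eq)
  finally show ?thesis .
qed

lemma F_one: "\<one>\<^bsub>F\<^esub> = frac_of 1"
  using frac_class_coset_of[of 1 1] by (simp add: function_field_def fraction_field_def CR_simps(4))

lemma F_zero: "\<zero>\<^bsub>F\<^esub> = frac_of 0"
  using frac_class_coset_of[of 1 0] by (simp add: function_field_def fraction_field_def CR_simps(4,5))

lemma F_const: "\<iota> t = frac_of (j t)"
proof -
  have "\<iota> t = frac_class CR (coset_of [:[:t:]:]) (coset_of 1)"
    by (simp add: constant_function_def coset_of_def[symmetric] CR_simps(4))
  then show ?thesis
    using frac_class_coset_of[of 1 "[:[:t:]:]"] by simp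
qed

lemma subfield_L: "subfield L type_ring"
  using subfld_gen2 by (simp add: subfld_def)

lemma frac_of_iso: "frac_of \<in> ring_iso (type_ring\<lparr>carrier := L\<rparr>) F"
  unfolding ring_iso_def
proof (intro CollectI conjI)
  show "frac_of \<in> ring_hom (type_ring\<lparr>carrier := L\<rparr>) F"
    by (rule ring_hom_memI) (auto simp: carrier_F F_mult F_add F_one)
  show "bij_betw frac_of (carrier (type_ring\<lparr>carrier := L\<rparr>)) (carrier F)"
    using frac_of_inj by (simp add: bij_betw_def carrier_F)
qed

lemma field_F: "field F"
proof -
  have "field (type_ring\<lparr>carrier := L\<rparr>)"
    by (rule type_ring.subfield_iff(2)[OF subfield_L])
  from field.ring_iso_imp_img_field[OF this frac_of_iso] show ?thesis
    by (simp flip: F_one F_zero)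
qed

lemma frac_of_eq_iff: "z \<in> L \<Longrightarrow> w \<in> L \<Longrightarrow> frac_of z = frac_of w \<longleftrightarrow> z = w"
  using frac_of_inj by (auto dest: inj_onD)

lemmas L_closed = subfld_closed[OF subfld_gen2[of x c]] L_mem

lemma F_a_inv:
  assumes "z \<in> L"
  shows "\<ominus>\<^bsub>F\<^esub> frac_of z = frac_of (- z)"
proof -
  interpret F: field F by (rule field_F)
  show ?thesis
    by (rule F.minus_equality) (use assms L_closed in \<open>auto simp: F_add F_zero carrier_F\<close>)
qed

lemma F_minus:
  assumes "z \<in> L" "w \<in> L"
  shows "frac_of z \<ominus>\<^bsub>F\<^esub> frac_of w = frac_of (z - w)"
  using F_add[of z "- w"] assms L_closed(3)[of w] by (simp add: a_minus_def F_a_inv)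

lemma F_m_inv:
  assumes "z \<in> L" "z \<noteq> 0"
  shows "inv\<^bsub>F\<^esub> frac_of z = frac_of (inverse z)"
proof -
  interpret F: field F by (rule field_F)
  show ?thesis
    by (rule F.comm_inv_char) (use assms L_closed in \<open>auto simp: F_mult F_one carrier_F\<close>)
qed

subsection \<open>Points of the curve are places\<close>

lemma frac_of_image_places:
  assumes P: "P \<in> places j L"
  shows "frac_of ` P \<in> curve_points F \<iota>"
proof -
  interpret F: field F by (rule field_F)
  interpret place j L P
    by unfold_locales (simp_all add: P subfld_gen2)
  have PL: "P \<subseteq> L" "P \<noteq> L" "range j \<noteq> P"
    using P by (auto simp: places_def)
  have mem: "frac_of z \<in> frac_of ` P \<longleftrightarrow> z \<in> P" if "z \<in> L" for z
    using frac_of_eq_iff that PL(1) by blast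
  have "subring (frac_of ` P) F"
  proof (rule F.subringI)
    show "frac_of ` P \<subseteq> carrier F"
      using PL by (auto simp: carrier_F)
  qed (use PL(1) sub in \<open>auto simp: F_one F_a_inv F_mult F_add one_mem uminus_mem mult_mem add_mem\<close>)
  moreover have "range \<iota> \<subset> frac_of ` P"
  proof -
    have "range \<iota> \<subseteq> frac_of ` P"
      using const_mem by (auto simp: F_const)
    moreover obtain z where "z \<in> P" "z \<notin> range j"
      using PL(3) const_mem by blast
    then have "frac_of z \<notin> range \<iota>"
      using frac_of_eq_iff sub L_mem(1) by (auto simp: F_const)
    ultimately show ?thesis
      using \<open>z \<in> P\<close> by blast
  qed
  moreover have "frac_of ` P \<subset> carrier F"
  proof -
    obtain z where "z \<in> L" "z \<notin> P"
      using PL by blast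
    then show ?thesis
      using mem PL(1) by (auto simp: carrier_F)
  qed
  moreover have "y \<in> frac_of ` P \<or> inv\<^bsub>F\<^esub> y \<in> frac_of ` P" if y: "y \<in> carrier F - {\<zero>\<^bsub>F\<^esub>}" for y
  proof -
    obtain z where z: "z \<in> L" "y = frac_of z" "z \<noteq> 0"
      using y by (auto simp: carrier_F F_zero)
    then show ?thesis
      using cases[of z] by (auto simp: F_m_inv)
  qed
  ultimately show ?thesis
    unfolding curve_points_def by blast
qed

lemma curve_pointsE:
  assumes Q: "Q \<in> curve_points F \<iota>"
  obtains P where "P \<in> places j L" "Q = frac_of ` P"
proof -
  define P where "P = {z \<in> L. frac_of z \<in> Q}"
  have QF: "subring Q F" "range \<iota> \<subset> Q" "Q \<subset> carrier F"
    "\<And>z. z \<in> carrier F - {\<zero>\<^bsub>F\<^esub>} \<Longrightarrow> z \<in> Q \<or> inv\<^bsub>F\<^esub> z \<in> Q"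
    using Q unfolding curve_points_def by blast+
  have Q_eq: "Q = frac_of ` P"
    using QF(3) by (auto simp: P_def carrier_F)
  have "P \<in> places j L"
    unfolding places_def
  proof (intro CollectI conjI ballI)
    show "P \<subseteq> L"
      by (auto simp: P_def)
    show "P \<noteq> L"
      using QF(3) Q_eq by (auto simp: carrier_F)
    show "range j \<subseteq> P"
      using QF(2) L_mem(1) by (auto simp: P_def F_const)
    show "range j \<noteq> P"
    proof
      assume "range j = P"
      then have "Q \<subseteq> range \<iota>"
        unfolding Q_eq by (auto simp: F_const)
      then show False
        using QF(2) by blast
    qed
    show "z + w \<in> P" "z * w \<in> P" if "z \<in> P" "w \<in> P" for z w
      using that subringE(6,7)[OF QF(1), of "frac_of z" "frac_of w"] L_closed
      by (auto simp: P_def F_add F_mult)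
    show "- z \<in> P" if "z \<in> P" for z
      using that subringE(5)[OF QF(1), of "frac_of z"] L_closed by (auto simp: P_def F_a_inv)
    show "z \<in> P \<or> inverse z \<in> P" if z: "z \<in> L - {0}" for z
    proof -
      have "frac_of z \<in> carrier F - {\<zero>\<^bsub>F\<^esub>}"
        using z frac_of_eq_iff[of z 0] L_closed by (auto simp: carrier_F F_zero)
      then show ?thesis
        using QF(4)[of "frac_of z"] z L_closed by (auto simp: P_def F_m_inv)
    qed
  qed
  then show ?thesis
    using that Q_eq by blast
qed

lemma has_value_at_iff:
  assumes P: "P \<in> places j L" and z: "z \<in> L"
  shows "has_value_at F \<iota> (frac_of ` P) (frac_of z) t \<longleftrightarrow> val j P z t"
proof -
  interpret place j L P
    by unfold_locales (simp_all add: P subfld_gen2)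
  have mem: "frac_of w \<in> frac_of ` P \<longleftrightarrow> w \<in> P" if "w \<in> L" for w
    using frac_of_eq_iff that sub by blast
  have "frac_of w \<in> Units (F\<lparr>carrier := frac_of ` P\<rparr>) \<longleftrightarrow> w \<in> P \<and> w \<noteq> 0 \<and> inverse w \<in> P" if w: "w \<in> L" for w
  proof
    assume "frac_of w \<in> Units (F\<lparr>carrier := frac_of ` P\<rparr>)"
    then obtain v where v: "v \<in> P" "frac_of v \<otimes>\<^bsub>F\<^esub> frac_of w = \<one>\<^bsub>F\<^esub>" and "w \<in> P"
      using mem[OF w] by (auto simp: Units_def)
    have "frac_of (v * w) = frac_of 1"
      using v F_mult[OF sub[OF v(1)] w] F_one by simp
    then have "v * w = 1"
      using frac_of_eq_iff[of "v * w" 1] L_closed(2,4) sub[OF v(1)] w by simp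
    then show "w \<in> P \<and> w \<noteq> 0 \<and> inverse w \<in> P"
      using v(1) \<open>w \<in> P\<close> by (metis inverse_unique mult.commute mult_zero_right zero_neq_one)
  next
    assume u: "w \<in> P \<and> w \<noteq> 0 \<and> inverse w \<in> P"
    then have "frac_of (inverse w) \<otimes>\<^bsub>F\<^esub> frac_of w = \<one>\<^bsub>F\<^esub>" "frac_of w \<otimes>\<^bsub>F\<^esub> frac_of (inverse w) = \<one>\<^bsub>F\<^esub>"
      using F_mult sub by (auto simp: F_one)
    then show "frac_of w \<in> Units (F\<lparr>carrier := frac_of ` P\<rparr>)"
      using u by (auto simp: Units_def)
  qed
  then have "frac_of w \<in> max_ideal_at F (frac_of ` P) \<longleftrightarrow> w \<in> nonunits P" if "w \<in> L" for w
    unfolding max_ideal_at_def nonunits_def using mem that by auto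
  then show ?thesis
    unfolding has_value_at_def val_def F_const F_minus[OF z L_mem(1)]
    using mem[OF z] L_closed z by simp
qed

subsection \<open>Degrees\<close>

text \<open>L as a ring of its own is compared with the field type by inclusion and with F by
  \<open>frac_of\<close>; injective homomorphisms preserve dimensions.\<close>

lemma dimension_iff_vdim:
  assumes S: "subfld S" "S \<subseteq> L"
  shows "ring.dimension F n (frac_of ` S) (carrier F) \<longleftrightarrow> vdim n S L"
proof -
  interpret F: field F by (rule field_F)
  let ?RL = "type_ring\<lparr>carrier := L\<rparr>"
  have fld: "field ?RL"
    by (rule type_ring.subfield_iff(2)[OF subfield_L])
  interpret RL: domain ?RL
    using fld by (rule field.axioms(1))
  have subL: "subring L type_ring"
    using subfieldE(1)[OF subfield_L] .
  have S_RL: "subfield S ?RL"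
  proof (rule RL.subfield_iff(1))
    show "S \<subseteq> carrier ?RL"
      using S by simp
    have "field (type_ring\<lparr>carrier := S\<rparr>)"
      by (rule type_ring.subfield_iff(2)) (use S(1) in \<open>simp add: subfld_def\<close>)
    then show "field (?RL\<lparr>carrier := S\<rparr>)"
      by simp
  qed
  interpret D: ring_hom_ring ?RL F frac_of
    by (rule ring_hom_ringI2) (use RL.ring_axioms F.ring_axioms frac_of_iso in \<open>auto simp: ring_iso_def\<close>)
  interpret I: ring_hom_ring ?RL type_ring id
    by (rule ring_hom_ringI2[OF RL.ring_axioms type_ring.ring_axioms], rule ring_hom_memI) auto
  have up: "RL.dimension n S L \<Longrightarrow> vdim n S L" for n
    using I.inj_hom_dimension[OF S_RL, of L n] by (simp add: vdim_def)
  have to_F: "RL.dimension n S L \<Longrightarrow> F.dimension n (frac_of ` S) (carrier F)" for n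
    using D.inj_hom_dimension[OF S_RL _ frac_of_inj] F.one_not_zero by (simp add: carrier_F)
  show ?thesis
  proof
    assume dim: "vdim n S L"
    have sf: "subfield S type_ring"
      using S(1) by (simp add: subfld_def)
    \<comment> \<open>A basis found in the ambient type also spans L inside L, so L is
      finite-dimensional there. Uniqueness of dimension identifies its dimension m with n.\<close>
    obtain Us where Us: "set Us \<subseteq> carrier type_ring" "type_ring.Span S Us = L"
      using type_ring.exists_base[OF sf dim[unfolded vdim_def]] by blast
    have "set Us \<subseteq> L"
      using type_ring.Span_base_incl[OF sf Us(1)] Us(2) by simp
    moreover have "RL.Span S Us = L"
      using type_ring.Span_consistent[OF subL] Us(2) by simp
    ultimately have "RL.finite_dimension S L"
      using RL.Span_finite_dimension[OF S_RL, of Us] by simp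
    then obtain m where m: "RL.dimension m S L"
      unfolding RL.finite_dimension_def by blast
    then have "m = n"
      using up[OF m] dim type_ring.dimension_is_inj[OF sf] unfolding vdim_def by blast
    then show "F.dimension n (frac_of ` S) (carrier F)"
      using to_F m by blast
  next
    assume dim: "F.dimension n (frac_of ` S) (carrier F)"
    define inv_D where "inv_D = the_inv_into L frac_of"
    have inv_D: "inv_D (frac_of z) = z" if "z \<in> L" for z
      unfolding inv_D_def by (rule the_inv_into_f_f[OF frac_of_inj that])
    interpret J: ring_hom_ring F type_ring inv_D
    proof (rule ring_hom_ringI2[OF F.ring_axioms type_ring.ring_axioms], rule ring_hom_memI)
      show "inv_D \<one>\<^bsub>F\<^esub> = \<one>\<^bsub>type_ring\<^esub>"
        using inv_D[OF L_closed(2)] by (simp add: F_one)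
    qed (use L_closed in \<open>auto simp: carrier_F F_mult F_add inv_D\<close>)
    have "inj_on inv_D (carrier F)"
      by (auto simp: inj_on_def carrier_F inv_D)
    moreover have "subfield (frac_of ` S) F"
      using D.img_is_subfield(2)[OF S_RL] by simp
    ultimately have "type_ring.dimension n (inv_D ` frac_of ` S) (inv_D ` carrier F)"
      using J.inj_hom_dimension dim by simp
    moreover have "inv_D ` frac_of ` S = S" "inv_D ` carrier F = L"
      using S(2) by (force simp: image_image carrier_F inv_D subset_iff)+
    ultimately show "vdim n S L"
      by (simp add: vdim_def)
  qed
qed

end

section \<open>Morphisms to the projective line\<close>

context preimage_field
begin

lemma placeI': "P \<in> places j L \<Longrightarrow> place j L P"
  by unfold_locales (simp_all add: subfld_gen2)

lemma image_places_inj: "inj_on (\<lambda>P. frac_of ` P) (places j L)"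
  using frac_of_inj by (auto simp: inj_on_def places_def inj_on_image_eq_iff)

lemma curve_points_eq: "curve_points F \<iota> = (\<lambda>P. frac_of ` P) ` places j L"
  using frac_of_image_places curve_pointsE by blast

lemma curve_preimage_eq:
  "curve_preimage F \<iota> \<phi> V = (\<lambda>P. frac_of ` P) ` {P \<in> places j L. \<phi> (frac_of ` P) \<in> V}"
  unfolding curve_preimage_def curve_points_eq by blast

lemma function_field:
  assumes "N \<ge> 2"
  obtains t n where "function_field_in_one_variable j L t n" "n \<le> 2 ^ (N - 2)"
proof -
  obtain t n where t: "t \<in> L" "t \<notin> range j" "vdim n (gen j t) L" and n: "n \<le> 2 ^ (N - 2)"
    using small_degree_function[OF assms] by blast
  have "function_field_in_one_variable j L t n"
    by unfold_locales (auto simp: subfld_gen2 range_subset_gen2[THEN subsetD] t)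
  then show ?thesis
    using that n by blast
qed

text \<open>The identity principle, used to turn equal values at infinitely many places into
  equality of functions.\<close>

lemma zero_if_infinite_zeros:
  assumes "N \<ge> 2" and C: "C \<subseteq> places j L" "infinite C" "\<And>P. P \<in> C \<Longrightarrow> z \<in> nonunits P" and z: "z \<in> L"
  shows "z = 0"
proof (rule ccontr)
  assume "z \<noteq> 0"
  obtain t n where "function_field_in_one_variable j L t n"
    using function_field[OF assms(1)] by blast
  then have "finite {P \<in> places j L. z \<in> nonunits P}"
    using function_field_in_one_variable.finite_zeros[of j L t n z] z \<open>z \<noteq> 0\<close> by blast
  moreover have "C \<subseteq> {P \<in> places j L. z \<in> nonunits P}"
    using C by blast
  ultimately show False
    using C(2) finite_subset by blast
qed

text \<open>The coordinate \<open>u/v\<close> on the line pulls back to \<open>h\<close>.\<close>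

definition affine_pullback :: "(('k poly poly set \<times> 'k poly poly set) set set \<Rightarrow> ('k \<times> 'k) set) \<Rightarrow> 'f \<Rightarrow> bool" where
  "affine_pullback \<phi> h \<longleftrightarrow> h \<in> L \<and>
     (\<forall>P\<in>places j L. \<forall>s. \<phi> (frac_of ` P) = finite_point s \<longrightarrow> val j P h s)"

context
  fixes \<phi>
  assumes mor: "morphism_to_proj_line F \<iota> \<phi>" and nonconst: "nonconstant_on_curve F \<iota> \<phi>" and N: "N \<ge> 2"
begin

lemma \<phi>_mem: "P \<in> places j L \<Longrightarrow> \<phi> (frac_of ` P) \<in> proj_line"
  using mor unfolding morphism_to_proj_line_def curve_points_eq by blast

text \<open>The fibre is the preimage of a closed point, hence finite or the whole curve; the latter
  would make the morphism constant.\<close>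

lemma finite_fiber:
  assumes "Q \<in> proj_line"
  shows "finite {P \<in> places j L. \<phi> (frac_of ` P) = Q}"
proof -
  have "proj_line_closed {Q}"
    by (rule proj_line_closed_singleton[OF assms])
  then have "finite (curve_preimage F \<iota> \<phi> {Q}) \<or> curve_preimage F \<iota> \<phi> {Q} = curve_points F \<iota>"
    using mor unfolding morphism_to_proj_line_def curve_closed_def by blast
  moreover have "curve_preimage F \<iota> \<phi> {Q} \<noteq> curve_points F \<iota>"
  proof
    assume "curve_preimage F \<iota> \<phi> {Q} = curve_points F \<iota>"
    then have "\<phi> P = Q" if "P \<in> curve_points F \<iota>" for P
      using that unfolding curve_preimage_def by blast
    then show False
      using nonconst unfolding nonconstant_on_curve_def by blast
  qed
  ultimately have "finite ((\<lambda>P. frac_of ` P) ` {P \<in> places j L. \<phi> (frac_of ` P) \<in> {Q}})"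
    unfolding curve_preimage_eq by blast
  moreover have "inj_on (\<lambda>P. frac_of ` P) {P \<in> places j L. \<phi> (frac_of ` P) \<in> {Q}}"
    by (rule inj_on_subset[OF image_places_inj]) blast
  ultimately have "finite {P \<in> places j L. \<phi> (frac_of ` P) \<in> {Q}}"
    by (rule finite_imageD)
  then show ?thesis
    by simp
qed

lemma finite_outside_open:
  assumes "proj_line_open V" "V \<noteq> {}"
  shows "finite {P \<in> places j L. \<phi> (frac_of ` P) \<notin> V}"
proof -
  have "{P \<in> places j L. \<phi> (frac_of ` P) \<notin> V} \<subseteq>
      (\<Union>Q\<in>proj_line - V. {P \<in> places j L. \<phi> (frac_of ` P) = Q})"
    using \<phi>_mem by blast
  moreover have "finite (\<Union>Q\<in>proj_line - V. {P \<in> places j L. \<phi> (frac_of ` P) = Q})"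
    using proj_line_open_cofinite[OF assms] finite_fiber by blast
  ultimately show ?thesis
    using finite_subset by blast
qed

text \<open>Each nonempty open set misses the images of finitely many places only, while there are
  infinitely many places.\<close>

lemma infinite_inside_open:
  assumes "proj_line_open V" "V \<noteq> {}" "proj_line_open W" "W \<noteq> {}"
  shows "infinite {P \<in> places j L. \<phi> (frac_of ` P) \<in> V \<inter> W}"
proof
  assume "finite {P \<in> places j L. \<phi> (frac_of ` P) \<in> V \<inter> W}"
  then have "finite ({P \<in> places j L. \<phi> (frac_of ` P) \<in> V \<inter> W} \<union>
      {P \<in> places j L. \<phi> (frac_of ` P) \<notin> V} \<union> {P \<in> places j L. \<phi> (frac_of ` P) \<notin> W})"
    using finite_outside_open assms by blast
  moreover have "places j L \<subseteq> {P \<in> places j L. \<phi> (frac_of ` P) \<in> V \<inter> W} \<union>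
      {P \<in> places j L. \<phi> (frac_of ` P) \<notin> V} \<union> {P \<in> places j L. \<phi> (frac_of ` P) \<notin> W}"
    by blast
  ultimately show False
    using infinite_places finite_subset by blast
qed

lemma nonvanishing_1: "proj_line_open (nonvanishing (1 :: 'k poly))" "nonvanishing (1 :: 'k poly) \<noteq> {}"
  by (rule proj_line_open_nonvanishing) (auto simp: nonvanishing_def)

text \<open>The coordinate is regular on the affine line, and a morphism pulls regular functions
  back to regular functions.\<close>

lemma affine_pullback_exists: "\<exists>h. affine_pullback \<phi> h"
proof -
  have "curve_regular_on F \<iota> (curve_preimage F \<iota> \<phi> (nonvanishing 1)) (ratio_function [:0, 1:] 1 \<circ> \<phi>)"
    using mor proj_line_open_nonvanishing proj_line_regular_ratio_function
    unfolding morphism_to_proj_line_def by blast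
  then obtain y where y: "y \<in> carrier F" "\<forall>P\<in>curve_preimage F \<iota> \<phi> (nonvanishing 1).
      has_value_at F \<iota> P y ((ratio_function [:0, 1:] 1 \<circ> \<phi>) P)"
    unfolding curve_regular_on_def by (elim bexE)
  obtain h where h: "h \<in> L" "y = frac_of h"
    using y(1) unfolding carrier_F by (elim imageE)
  have "val j P h s" if P: "P \<in> places j L" and s: "\<phi> (frac_of ` P) = finite_point s" for P s
  proof -
    have "frac_of ` P \<in> curve_preimage F \<iota> \<phi> (nonvanishing 1)"
      unfolding curve_preimage_eq
    proof (rule imageI, rule CollectI, intro conjI P)
      show "\<phi> (frac_of ` P) \<in> nonvanishing 1"
        unfolding s nonvanishing_def by (rule CollectI, rule exI[of _ s]) simp
    qed
    with y(2) have "has_value_at F \<iota> (frac_of ` P) (frac_of h) (ratio_function [:0, 1:] 1 (\<phi> (frac_of ` P)))"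
      unfolding h(2) comp_apply by (rule bspec)
    then show ?thesis
      unfolding has_value_at_iff[OF P h(1)] s by simp
  qed
  then show ?thesis
    unfolding affine_pullback_def using h(1) by blast
qed

context
  fixes h
  assumes h: "affine_pullback \<phi> h"
begin

lemma h_mem: "h \<in> L"
  using h by (simp add: affine_pullback_def)

lemma h_val: "P \<in> places j L \<Longrightarrow> \<phi> (frac_of ` P) = finite_point s \<Longrightarrow> val j P h s"
  using h by (simp add: affine_pullback_def)

text \<open>A constant h = b would send every place over the affine line to the point b, whose fibre
  is finite.\<close>

lemma affine_pullback_nonconstant: "h \<notin> range j"
proof
  assume "h \<in> range j"
  then obtain b where b: "h = j b"
    by auto
  have "{P \<in> places j L. \<phi> (frac_of ` P) \<in> nonvanishing 1 \<inter> nonvanishing 1} \<subseteq>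
      {P \<in> places j L. \<phi> (frac_of ` P) = finite_point b}"
  proof
    fix P assume "P \<in> {P \<in> places j L. \<phi> (frac_of ` P) \<in> nonvanishing 1 \<inter> nonvanishing 1}"
    then obtain s where P: "P \<in> places j L" and s: "\<phi> (frac_of ` P) = finite_point s"
      by (auto simp: nonvanishing_def)
    interpret place j L P using placeI'[OF P] .
    have "s = b"
      using val_unique h_val[OF P s] val_const[of b] b by blast
    then show "P \<in> {P \<in> places j L. \<phi> (frac_of ` P) = finite_point b}"
      using P s by simp
  qed
  moreover have "finite {P \<in> places j L. \<phi> (frac_of ` P) = finite_point b}"
    by (rule finite_fiber) (simp add: proj_line_eq)
  ultimately have "finite {P \<in> places j L. \<phi> (frac_of ` P) \<in> nonvanishing 1 \<inter> nonvanishing 1}"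
    by (rule finite_subset)
  then show False
    using infinite_inside_open[OF nonvanishing_1 nonvanishing_1] by (rule notE[rotated])
qed

text \<open>A quotient p(h)/q(h) comes from the regular function p/q on
  \<open>nonvanishing q\<close>. Conversely, if z is the pullback of g and g = A/B near some point,
  then z B(h) - A(h) vanishes at infinitely many places and is therefore 0.\<close>

lemma pullback_field_eq: "pullback_field F \<iota> \<phi> = frac_of ` gen j h"
proof
  have genL: "gen j h \<subseteq> L"
    by (intro gen_subset subfld_gen2 range_subset_gen2 h_mem)
  show "frac_of ` gen j h \<subseteq> pullback_field F \<iota> \<phi>"
  proof
    fix y assume "y \<in> frac_of ` gen j h"
    then obtain z where z: "z \<in> gen j h" "y = frac_of z"
      by blast
    have zL: "z \<in> L"
      using z(1) genL by blast
    obtain p q where pq: "z = pev j h p / pev j h q" "pev j h q \<noteq> 0"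
      using z(1) unfolding gen_def by (rule fractionsE)
    have "q \<noteq> 0"
      using pq(2) by auto
    then have "finite {s. poly q s = 0}"
      by (rule poly_roots_finite)
    from ex_new_if_finite[OF infinite_alg_closed_UNIV this] obtain s where "poly q s \<noteq> 0"
      by blast
    then have ne: "nonvanishing q \<noteq> {}"
      unfolding nonvanishing_def by blast
    have val_y: "has_value_at F \<iota> R y (ratio_function p q (\<phi> R))"
      if R: "R \<in> curve_preimage F \<iota> \<phi> (nonvanishing q)" for R
    proof -
      obtain P where "P \<in> {P \<in> places j L. \<phi> (frac_of ` P) \<in> nonvanishing q}" and R_eq: "R = frac_of ` P"
        using R unfolding curve_preimage_eq by (elim imageE)
      then have P: "P \<in> places j L" and "\<phi> (frac_of ` P) \<in> nonvanishing q"
        by simp_all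
      then obtain s where s: "\<phi> (frac_of ` P) = finite_point s" "poly q s \<noteq> 0"
        unfolding nonvanishing_def by (elim CollectE exE conjE)
      interpret place j L P using placeI'[OF P] .
      have "val j P z (poly p s / poly q s)"
        unfolding pq(1) using h_val[OF P s(1)] s(2) by (intro val_divide val_pev)
      then show ?thesis
        unfolding R_eq s(1) ratio_function_finite_point z(2) has_value_at_iff[OF P zL] .
    qed
    have "y \<in> carrier F"
      unfolding carrier_F z(2) using zL by (rule imageI)
    then show "y \<in> pullback_field F \<iota> \<phi>"
      unfolding pullback_field_def
      by (intro CollectI conjI exI[of _ "nonvanishing q"] exI[of _ "ratio_function p q"] ballI ne val_y
          proj_line_open_nonvanishing proj_line_regular_ratio_function)
  qed
  show "pullback_field F \<iota> \<phi> \<subseteq> frac_of ` gen j h"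
  proof
    fix y assume "y \<in> pullback_field F \<iota> \<phi>"
    then obtain V g where yF: "y \<in> carrier F" and V: "proj_line_open V" "V \<noteq> {}" "proj_line_regular_on V g"
      and val_y: "\<And>R. R \<in> curve_preimage F \<iota> \<phi> V \<Longrightarrow> has_value_at F \<iota> R y (g (\<phi> R))"
      unfolding pullback_field_def by blast
    obtain z where z: "z \<in> L" "y = frac_of z"
      using yF by (auto simp: carrier_F)
    obtain Q where "Q \<in> V"
      using V by blast
    obtain U d A B where U: "proj_line_open U" "Q \<in> U" "U \<subseteq> V" and B0: "form_poly d B \<noteq> 0"
      and g: "\<And>s. finite_point s \<in> U \<Longrightarrow> poly (form_poly d B) s \<noteq> 0 \<and>
        g (finite_point s) = poly (form_poly d A) s / poly (form_poly d B) s"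
      using proj_line_regularE[OF V(3) \<open>Q \<in> V\<close>] by metis
    define C where "C = {P \<in> places j L. \<phi> (frac_of ` P) \<in> U \<inter> nonvanishing 1}"
    have "infinite C"
      unfolding C_def using U(2) by (intro infinite_inside_open nonvanishing_1 U) auto
    define w where "w = z * pev j h (form_poly d B) - pev j h (form_poly d A)"
    have pevL: "pev j h p \<in> L" for p
      by (intro pev_in_subfld subfld_gen2 range_subset_gen2 h_mem)
    have "w \<in> L"
      unfolding w_def by (intro subfld_diff subfld_mult subfld_gen2 z pevL)
    have "w \<in> nonunits P" if PC: "P \<in> C" for P
    proof -
      have P: "P \<in> places j L" and U': "\<phi> (frac_of ` P) \<in> U" and "\<phi> (frac_of ` P) \<in> nonvanishing 1"
        using PC unfolding C_def by blast+
      then obtain s where s: "\<phi> (frac_of ` P) = finite_point s" "finite_point s \<in> U"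
        unfolding nonvanishing_def by auto
      interpret place j L P using placeI'[OF P] .
      have hs: "val j P h s"
        by (rule h_val[OF P s(1)])
      have "frac_of ` P \<in> curve_preimage F \<iota> \<phi> V"
        unfolding curve_preimage_eq using P U' U(3) by blast
      from val_y[OF this] have "val j P z (g (finite_point s))"
        unfolding z(2) has_value_at_iff[OF P z(1)] s(1) .
      then have "val j P w (g (finite_point s) * poly (form_poly d B) s - poly (form_poly d A) s)"
        unfolding w_def using hs by (intro val_diff val_mult val_pev)
      then show ?thesis
        using g[OF s(2)] by (simp add: val_0_iff)
    qed
    then have "w = 0"
      by (rule zero_if_infinite_zeros[OF N _ \<open>infinite C\<close> _ \<open>w \<in> L\<close>, rotated]) (auto simp: C_def)
    moreover have "pev j h (form_poly d B) \<noteq> 0"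
      using pev_eq_0_iff[OF affine_pullback_nonconstant] B0 by simp
    ultimately have "z = pev j h (form_poly d A) / pev j h (form_poly d B)"
      by (simp add: w_def field_simps)
    then have "z \<in> gen j h"
      by (simp add: subfld_divide subfld_gen pev_in_gen)
    then show "y \<in> frac_of ` gen j h"
      using z by blast
  qed
qed

lemma has_morphism_degree_iff: "has_morphism_degree F \<iota> \<phi> n \<longleftrightarrow> vdim n (gen j h) L"
  unfolding has_morphism_degree_def pullback_field_eq
  by (intro dimension_iff_vdim subfld_gen gen_subset subfld_gen2 range_subset_gen2 h_mem)

end

end

text \<open>R is a point of the abstract curve and P the place of L corresponding to it. Poles of t
  go to infinity; elsewhere the chosen s is the unique residue of t.\<close>

definition morphism_of :: "'f \<Rightarrow> ('k poly poly set \<times> 'k poly poly set) set set \<Rightarrow> ('k \<times> 'k) set" where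
  "morphism_of t R = (let P = {z \<in> L. frac_of z \<in> R} in
     if t \<in> P then finite_point (SOME s. val j P t s) else infinite_point)"

context
  fixes t n
  assumes ff: "function_field_in_one_variable j L t n"
begin

interpretation function_field_in_one_variable j L t n
  by (fact ff)

lemma morphism_of_image:
  assumes P: "P \<in> places j L"
  shows "morphism_of t (frac_of ` P) = (if t \<in> P then finite_point (SOME s. val j P t s) else infinite_point)"
proof -
  have "{z \<in> L. frac_of z \<in> frac_of ` P} = P"
    using frac_of_eq_iff P unfolding places_def by blast
  then show ?thesis
    by (simp add: morphism_of_def)
qed

lemma morphism_of_finite_iff:
  assumes P: "P \<in> places j L"
  shows "morphism_of t (frac_of ` P) = finite_point s \<longleftrightarrow> val j P t s"
proof -
  interpret place j L P using placeI[OF P] .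
  show ?thesis
  proof (cases "t \<in> P")
    case True
    then have v: "val j P t (SOME s. val j P t s)"
      using residue_field[OF P] someI_ex by metis
    then show ?thesis
      unfolding morphism_of_image[OF P] using True val_unique by auto
  next
    case False
    then show ?thesis
      unfolding morphism_of_image[OF P] using val_mem by auto
  qed
qed

lemma morphism_of_infinite_iff:
  assumes P: "P \<in> places j L"
  shows "morphism_of t (frac_of ` P) = infinite_point \<longleftrightarrow> t \<notin> P"
  unfolding morphism_of_image[OF P] by simp

lemma finite_fiber_morphism_of: "finite {P \<in> places j L. morphism_of t (frac_of ` P) = Q}"
proof (cases "Q \<in> proj_line")
  case True
  then show ?thesis
  proof (cases rule: proj_line_cases)
    case (1 s)
    have "t - j s \<in> L" "t - j s \<noteq> 0"
      using t range_L subfld_L by (auto intro!: subfld_diff)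
    from finite_zeros[OF this] show ?thesis
      by (rule finite_subset[rotated]) (auto simp: 1 morphism_of_finite_iff val_def)
  next
    case 2
    have "inverse t \<in> L" "inverse t \<noteq> 0"
      using t zero subfld_L by (auto intro!: subfld_inverse)
    from finite_zeros[OF this] show ?thesis
      by (rule finite_subset[rotated])
         (auto simp: 2 morphism_of_infinite_iff intro: place.inverse_m[OF placeI] t)
  qed
next
  case False
  have "morphism_of t (frac_of ` P) \<in> proj_line" for P
    unfolding morphism_of_def proj_line_eq by (auto simp: Let_def)
  then have "{P \<in> places j L. morphism_of t (frac_of ` P) = Q} = {}"
    using False by blast
  then show ?thesis
    by (metis finite.emptyI)
qed

text \<open>At a pole of t use \<open>\<tau>\<close> = 1/t. Numerator and denominator are t^d times
  the reversed polynomials in \<open>\<tau>\<close>, whose constant terms are A d and B d.\<close>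

lemma val_ratio_at_infinity:
  assumes P: "P \<in> places j L" and tP: "t \<notin> P" and B: "B d \<noteq> 0"
  shows "val j P (pev j t (form_poly d A) / pev j t (form_poly d B)) (A d / B d)"
proof -
  interpret place j L P using placeI[OF P] .
  define \<tau> where "\<tau> = inverse t"
  have "t \<noteq> 0"
    using tP zero_mem by auto
  have \<tau>: "val j P \<tau> 0"
    using inverse_m[OF t(1) tP] by (simp add: val_0_iff \<tau>_def)
  define r where "r A = (\<Sum>i\<le>d. monom (A i) (d - i))" for A :: "nat \<Rightarrow> 'k"
  have rev: "pev j t (form_poly d A) = t ^ d * pev j \<tau> (r A)" for A
  proof -
    interpret e: ring_map "pev j \<tau>" by (rule ring_map_pev)
    have mon: "pev j \<tau> (monom b i) = j b * \<tau> ^ i" for b i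
      unfolding pev_def by (simp add: map_poly_monom poly_monom)
    have "pev j t (form_poly d A) = (\<Sum>i\<le>d. j (A i) * t ^ i)"
      unfolding pev_eq_sum[OF degree_form_poly] by (rule sum.cong) (auto simp: coeff_form_poly)
    also have "\<dots> = (\<Sum>i\<le>d. t ^ d * (j (A i) * \<tau> ^ (d - i)))"
    proof (rule sum.cong)
      fix i assume "i \<in> {..d}"
      then have "t ^ d = t ^ i * t ^ (d - i)"
        by (simp flip: power_add)
      then show "j (A i) * t ^ i = t ^ d * (j (A i) * \<tau> ^ (d - i))"
        using \<open>t \<noteq> 0\<close> by (simp add: \<tau>_def field_simps)
    qed auto
    also have "\<dots> = t ^ d * pev j \<tau> (r A)"
      unfolding r_def e.sum mon sum_distrib_left ..
    finally show ?thesis .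
  qed
  have r0: "poly (r A) 0 = A d" for A
  proof -
    have "poly (r A) 0 = (\<Sum>i\<le>d. if i = d then A i else 0)"
      unfolding r_def poly_sum by (rule sum.cong) (auto simp: poly_monom power_0_left)
    then show ?thesis
      by simp
  qed
  have "val j P (pev j \<tau> (r A) / pev j \<tau> (r B)) (poly (r A) 0 / poly (r B) 0)"
    using B by (intro val_divide val_pev \<tau>) (simp add: r0)
  then show ?thesis
    unfolding rev r0 using \<open>t \<noteq> 0\<close> by simp
qed

text \<open>A single h must give the values of g on all of V. Two local quotients agree at
  infinitely many affine points, hence define the same element of K(t), so the h built near one
  point Q0 serves everywhere.\<close>

lemma morphism_of_regular:
  assumes V: "proj_line_open V" and g: "proj_line_regular_on V g"
  shows "curve_regular_on F \<iota> (curve_preimage F \<iota> (morphism_of t) V) (g \<circ> morphism_of t)"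
proof (cases "V = {}")
  \<comment> \<open>Over the empty set any function qualifies, but the carrier must supply
    one.\<close>
  case True
  then show ?thesis
    unfolding curve_regular_on_def curve_preimage_def carrier_F using L_mem by auto
next
  case False
  then obtain Q0 where "Q0 \<in> V"
    by blast
  obtain U0 d0 A0 B0 where U0: "proj_line_open U0" "Q0 \<in> U0" and nz0: "form_poly d0 B0 \<noteq> 0"
    and g0: "\<And>s. finite_point s \<in> U0 \<Longrightarrow> poly (form_poly d0 B0) s \<noteq> 0 \<and>
        g (finite_point s) = poly (form_poly d0 A0) s / poly (form_poly d0 B0) s"
    using proj_line_regularE[OF g \<open>Q0 \<in> V\<close>] by metis
  define h where "h = pev j t (form_poly d0 A0) / pev j t (form_poly d0 B0)"
  have pevL: "pev j t p \<in> L" for p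
    by (intro pev_in_subfld subfld_gen2 range_subset_gen2 t)
  have "h \<in> L"
    unfolding h_def by (intro subfld_divide subfld_gen2 pevL)
  interpret e: ring_map "pev j t" by (rule ring_map_pev)
  have "val j P h (g (morphism_of t (frac_of ` P)))"
    if P: "P \<in> places j L" and PV: "morphism_of t (frac_of ` P) \<in> V" for P
  proof -
    interpret place j L P using placeI[OF P] .
    let ?Q = "morphism_of t (frac_of ` P)"
    obtain U d A B where U: "proj_line_open U" "?Q \<in> U" and nz: "form_poly d B \<noteq> 0"
      and g1: "\<And>s. finite_point s \<in> U \<Longrightarrow> poly (form_poly d B) s \<noteq> 0 \<and>
        g (finite_point s) = poly (form_poly d A) s / poly (form_poly d B) s"
      and ginf: "infinite_point \<in> U \<Longrightarrow> B d \<noteq> 0 \<and> g infinite_point = A d / B d"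
      using proj_line_regularE[OF g PV] by metis
    define D where "D = form_poly d0 A0 * form_poly d B - form_poly d A * form_poly d0 B0"
    have "D = 0"
    proof (rule ccontr)
      assume "D \<noteq> 0"
      then have "finite {s. poly D s = 0}"
        by (rule poly_roots_finite)
      moreover have "finite ((proj_line - U0) \<union> (proj_line - U))"
        using proj_line_open_cofinite U0 U by blast
      then have "finite {s. finite_point s \<in> (proj_line - U0) \<union> (proj_line - U)}"
        by (rule finite_vimageI[unfolded vimage_def]) (simp add: inj_on_def)
      ultimately obtain s where s: "poly D s \<noteq> 0" "finite_point s \<notin> (proj_line - U0) \<union> (proj_line - U)"
        using infinite_alg_closed_UNIV[where 'k = 'k]
          ex_new_if_finite[of "{s. poly D s = 0} \<union> {s. finite_point s \<in> (proj_line - U0) \<union> (proj_line - U)}"]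
        by auto
      have "finite_point s \<in> proj_line"
        by (simp add: proj_line_eq)
      then have "finite_point s \<in> U0" "finite_point s \<in> U"
        using s(2) by auto
      then have "poly D s = 0"
        using g0[of s] g1[of s] by (simp add: D_def field_simps)
      then show False
        using s(1) by simp
    qed
    then have "pev j t (form_poly d0 A0) * pev j t (form_poly d B) =
        pev j t (form_poly d A) * pev j t (form_poly d0 B0)"
      unfolding D_def by (metis e.mult eq_iff_diff_eq_0)
    moreover have "pev j t (form_poly d0 B0) \<noteq> 0" "pev j t (form_poly d B) \<noteq> 0"
      using pev_eq_0_iff[OF t(2)] nz nz0 by simp_all
    ultimately have h_eq: "h = pev j t (form_poly d A) / pev j t (form_poly d B)"
      unfolding h_def by (simp add: frac_eq_eq)
    show ?thesis
    proof (cases "t \<in> P")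
      case True
      then obtain s where s: "val j P t s"
        using residue_field[OF P] by blast
      then have Q: "?Q = finite_point s"
        using morphism_of_finite_iff[OF P] by blast
      then have "val j P h (poly (form_poly d A) s / poly (form_poly d B) s)"
        unfolding h_eq using s g1[of s] U(2) by (intro val_divide val_pev) auto
      then show ?thesis
        using g1[of s] U(2) Q by simp
    next
      case False
      then have Q: "?Q = infinite_point"
        using morphism_of_infinite_iff[OF P] by blast
      then have inf: "B d \<noteq> 0" "g infinite_point = A d / B d"
        using ginf U(2) by auto
      then show ?thesis
        unfolding Q h_eq inf(2) by (intro val_ratio_at_infinity P False)
    qed
  qed
  then have "\<forall>R\<in>curve_preimage F \<iota> (morphism_of t) V.
      has_value_at F \<iota> R (frac_of h) ((g \<circ> morphism_of t) R)"
    unfolding curve_preimage_eq using has_value_at_iff \<open>h \<in> L\<close> by auto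
  then show ?thesis
    unfolding curve_regular_on_def carrier_F using \<open>h \<in> L\<close> by blast
qed

lemma morphism_of_is_morphism: "morphism_to_proj_line F \<iota> (morphism_of t)"
  unfolding morphism_to_proj_line_def
proof (intro conjI allI impI ballI)
  show "morphism_of t P \<in> proj_line" for P
    unfolding morphism_of_def proj_line_eq by (auto simp: Let_def)
  show "curve_closed F \<iota> (curve_preimage F \<iota> (morphism_of t) Z)" if Z: "proj_line_closed Z" for Z
    unfolding curve_closed_def
  proof (intro conjI)
    show "curve_preimage F \<iota> (morphism_of t) Z \<subseteq> curve_points F \<iota>"
      by (auto simp: curve_preimage_def)
    show "finite (curve_preimage F \<iota> (morphism_of t) Z) \<or> curve_preimage F \<iota> (morphism_of t) Z = curve_points F \<iota>"
    proof (cases "Z = proj_line")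
      case True
      have "morphism_of t P \<in> proj_line" for P
        unfolding morphism_of_def proj_line_eq by (auto simp: Let_def)
      then show ?thesis
        unfolding True curve_preimage_def by auto
    next
      case False
      then have "finite Z"
        using proj_line_closed_cases[OF Z] by blast
      have "{P \<in> places j L. morphism_of t (frac_of ` P) \<in> Z} =
          (\<Union>Q\<in>Z. {P \<in> places j L. morphism_of t (frac_of ` P) = Q})"
        by blast
      then have "finite {P \<in> places j L. morphism_of t (frac_of ` P) \<in> Z}"
        using \<open>finite Z\<close> finite_fiber_morphism_of by simp
      then show ?thesis
        unfolding curve_preimage_eq by blast
    qed
  qed
  show "curve_regular_on F \<iota> (curve_preimage F \<iota> (morphism_of t) V) (g \<circ> morphism_of t)"
    if "proj_line_open V \<and> proj_line_regular_on V g" for V g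
    using that morphism_of_regular by blast
qed

lemma morphism_of_nonconstant: "nonconstant_on_curve F \<iota> (morphism_of t)"
proof (rule ccontr)
  assume const: "\<not> ?thesis"
  obtain P where P: "P \<in> places j L"
    using infinite_places by fastforce
  have "morphism_of t (frac_of ` P') = morphism_of t (frac_of ` P)" if "P' \<in> places j L" for P'
    using const P that unfolding nonconstant_on_curve_def curve_points_eq by blast
  then have "places j L \<subseteq> {P' \<in> places j L. morphism_of t (frac_of ` P') = morphism_of t (frac_of ` P)}"
    by blast
  then show False
    using finite_fiber_morphism_of infinite_places finite_subset by blast
qed

lemma affine_pullback_morphism_of: "affine_pullback (morphism_of t) t"
  unfolding affine_pullback_def using t(1) morphism_of_finite_iff by blast

end

theorem gonality_eq:
  assumes N: "N \<ge> 2"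
  shows "gonality F \<iota> = 2 ^ (N - 2)"
proof -
  define degrees where "degrees n \<longleftrightarrow> (\<exists>\<phi>. morphism_to_proj_line F \<iota> \<phi> \<and>
      nonconstant_on_curve F \<iota> \<phi> \<and> has_morphism_degree F \<iota> \<phi> n)" for n
  have lower: "2 ^ (N - 2) \<le> n" if n: "degrees n" for n
  proof -
    obtain \<phi> where \<phi>: "morphism_to_proj_line F \<iota> \<phi>" "nonconstant_on_curve F \<iota> \<phi>" "has_morphism_degree F \<iota> \<phi> n"
      using n unfolding degrees_def by blast
    obtain h where h: "affine_pullback \<phi> h"
      using affine_pullback_exists[OF \<phi>(1,2) N] by blast
    have "vdim n (gen j h) L"
      using has_morphism_degree_iff[OF \<phi>(1,2) N h] \<phi>(3) by blast
    then show ?thesis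
      using degree_lower_bound[OF preimage_field_axioms N h_mem[OF \<phi>(1,2) N h]
          affine_pullback_nonconstant[OF \<phi>(1,2) N h]] by blast
  qed
  obtain t n where ff: "function_field_in_one_variable j L t n" and n: "n \<le> 2 ^ (N - 2)"
    using function_field[OF N] by blast
  have "vdim n (gen j t) L"
    using ff by (rule function_field_in_one_variable.dim)
  then have "has_morphism_degree F \<iota> (morphism_of t) n"
    using has_morphism_degree_iff[OF morphism_of_is_morphism[OF ff] morphism_of_nonconstant[OF ff] N
        affine_pullback_morphism_of[OF ff]] by blast
  then have "degrees n"
    unfolding degrees_def using morphism_of_is_morphism[OF ff] morphism_of_nonconstant[OF ff] by blast
  \<comment> \<open>The function found has degree n at most 2^(N - 2); the lower bound forces
    equality, so the minimum is attained.\<close>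
  then have "degrees (2 ^ (N - 2))"
    using lower[of n] n by simp
  then show ?thesis
    unfolding gonality_def degrees_def[symmetric] using lower by (rule Least_equality)
qed

end

theorem theorem3p6:
  fixes a :: "'k::alg_closed_field" and N :: nat
  assumes "CHAR('k) \<noteq> 2"
    and "N \<ge> 2"
    and "preimage_curve_nonsingular N a"
  shows "gonality (function_field N a) (constant_function N a) = 2 ^ (N - 2)"
proof -
  obtain M where M: "N = Suc M"
    using assms(2) by (cases N) auto
  have simple: "crit_simple N a"
    by (rule crit_simple_if_nonsingular[OF assms(3)])
  have two: "(2 :: 'k) \<noteq> 0"
  proof
    assume "(2 :: 'k) = 0"
    then have "of_nat 2 = (0 :: 'k)"
      by simp
    then have "CHAR('k) dvd 2"
      by (simp only: of_nat_eq_0_iff_char_dvd)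
    then have "CHAR('k) = 1"
      using assms(1) by (metis prime_nat_iff two_is_prime_nat)
    then have "of_nat 1 = (0 :: 'k)"
      by (metis of_nat_CHAR)
    then show False by simp
  qed
  obtain c0 where c0: "poly (crit_poly (Suc M) a) c0 = 0"
    using alg_closed_imp_poly_has_root[of "crit_poly (Suc M) a"] by (auto simp: degree_crit_poly_Suc)
  interpret const: ring_map "fps_const :: 'k \<Rightarrow> 'k fps" by (rule ring_map_fps_const)
  \<comment> \<open>A concrete model: near the point (0, c0) the curve is parametrised by x itself,
    so x = s and c = \<open>\<eta>\<close> embed its function field into K((s)).\<close>
  obtain \<eta> where series: "\<And>p. ev2 fps_const fps_X \<eta> p = 0 \<longleftrightarrow> preimage_poly N a dvd p"
    using even_series[of M a c0] simple c0 unfolding M by metis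
  define j :: "'k \<Rightarrow> 'k fls" where "j b = fps_to_fls (fps_const b)" for b
  have "ring_map j"
    unfolding j_def[abs_def] by (rule ring_map_comp[OF ring_map_fps_const ring_map_fps_to_fls])
  then interpret j: field_map j
    by (simp add: field_map_def)
  have ev: "ev2 j (fps_to_fls fps_X) (fps_to_fls \<eta>) p = fps_to_fls (ev2 fps_const fps_X \<eta> p)" for p
    using const.comp_ev2[OF ring_map_fps_to_fls, of fps_X \<eta> p] by (simp add: j_def[abs_def])
  have "preimage_field j (fps_to_fls fps_X) (fps_to_fls \<eta>) N a"
  proof (intro preimage_field.intro alg_closed_embedding.intro preimage_field_axioms.intro)
    show "ev2 j (fps_to_fls fps_X) (fps_to_fls \<eta>) p = 0 \<longleftrightarrow> preimage_poly N a dvd p" for p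
      unfolding ev fps_to_fls_eq_0_iff by (rule series)
  qed (fact j.field_map_axioms two simple)+
  then show ?thesis
    using assms(2) by (rule preimage_field.gonality_eq)
qed

end
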